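(* Let $(M,g,J_1,J_2,J_3)$ be an almost hyperhermitian 8-dimensional manifold. The following conditions are equivalent: 1) $(M,g,J_1,J_2,J_3)$ is an AHKT manifold. 2) The Nijenhuis tensors $N^1,N^2,N^3$ are totally skew-symmetric and, for every cyclic permutation $(a,b,c)$ of $(1,2,3)$, $$\delta\Phi^b-\delta\Phi^c=J_a\nu^a\wedge F^a-\theta^a\lrcorner(\Phi^b-\Phi^c)=J_a\nu^a\wedge F^a+J_b\theta^a\wedge F^b-J_c\theta^a\wedge F^c,\qquad \nu^a=\theta^b-\theta^c.$$ On an AHKT 8-manifold the Nijenhuis tensors and the torsion $T$ are given, for every cyclic permutation $(a,b,c)$ of $(1,2,3)$, by $$N^a=J_b\nu^a\wedge F^b-J_c\nu^a\wedge F^c,$$ $$T=-\delta\Phi^a+J_a\theta^a\wedge F^a+J_b\nu^a\wedge F^b-J_c\nu^a\wedge F^c.$$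
   Context: An almost hyperhermitian 8-manifold is a Riemannian 8-manifold $(M,g)$ with almost complex structures satisfying $J_1J_2=-J_2J_1=J_3$, $J_a^2=-1$, $g(J_aX,J_aY)=g(X,Y)$. Set $F^a(X,Y)=g(X,J_aY)$, $\Phi^a=\frac12F^a\wedge F^a$. The Nijenhuis tensor of $J=J_a$ is $N^a(X,Y)=[JX,JY]-[X,Y]-J[JX,Y]-J[X,JY]$, regarded as the $(0,3)$-tensor $N^a(X,Y,Z)=g(N^a(X,Y),Z)$. AHKT means there is a linear connection $\nabla$ with $\nabla g=\nabla J_1=\nabla J_2=\nabla J_3=0$ and totally skew-symmetric torsion $T(X,Y,Z)=g(\nabla_XY-\nabla_YX-[X,Y],Z)$ (such $\nabla$ is then unique). For a local orthonormal frame $\{e_s\}$ (summation over $s$), the Lee forms are $\theta^a(X)=\frac12dF^a(X,J_ae_s,e_s)$ (equal to $(\delta F^a)(J_aX)$), and, for totally skew-symmetric Nijenhuis tensors and $(a,b,c)$ a cyclic permutation of $(1,2,3)$, $\nu^a(X)=\frac14N^a(J_bX,J_be_s,e_s)=-\frac14N^a(J_cX,J_ce_s,e_s)$. For a 1-form $\alpha$, $(J_a\alpha)(X)=-\alpha(J_aX)$, and $\alpha\lrcorner$ denotes interior multiplication by the vector dual to $\alpha$. $\delta$ is the codifferential of $g$ ($\delta=-*d*$ in dimension 8). *)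

theory Defs
  imports "HOL-Analysis.Analysis"
begin

section \<open>Smooth manifolds\<close>

text \<open>For open sets, the usual $C^k$ and $C^\infty$ conditions, by iterated directional derivatives.\<close>

fun Ck_on :: "nat \<Rightarrow> 'a::euclidean_space set \<Rightarrow> ('a \<Rightarrow> 'b::real_normed_vector) \<Rightarrow> bool" where
  "Ck_on 0 S f \<longleftrightarrow> continuous_on S f"
| "Ck_on (Suc k) S f \<longleftrightarrow>
     (\<forall>x\<in>S. f differentiable (at x)) \<and>
     (\<forall>v. Ck_on k S (\<lambda>x. frechet_derivative f (at x) v))"

definition smooth_on :: "'a::euclidean_space set \<Rightarrow> ('a \<Rightarrow> 'b::real_normed_vector) \<Rightarrow> bool" where
  "smooth_on S f \<longleftrightarrow> (\<forall>k. Ck_on k S f)"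

text \<open>A chart is a pair of a domain and a coordinate map; the values of the map outside the
  domain are irrelevant.\<close>

type_synonym ('m, 'e) chart = "'m set \<times> ('m \<Rightarrow> 'e)"

definition chart_range :: "('m, 'e) chart \<Rightarrow> 'e set" where
  "chart_range \<kappa> = snd \<kappa> ` fst \<kappa>"

definition chart_overlap :: "('m, 'e) chart \<Rightarrow> ('m, 'e) chart \<Rightarrow> 'e set" where
  "chart_overlap \<kappa> \<mu> = snd \<kappa> ` (fst \<kappa> \<inter> fst \<mu>)"

definition transition :: "('m, 'e) chart \<Rightarrow> ('m, 'e) chart \<Rightarrow> 'e \<Rightarrow> 'e" where
  "transition \<kappa> \<mu> = snd \<mu> \<circ> inv_into (fst \<kappa>) (snd \<kappa>)"

abbreviation dtransition ::
  "('m, 'e::euclidean_space) chart \<Rightarrow> ('m, 'e) chart \<Rightarrow> 'e \<Rightarrow> 'e \<Rightarrow> 'e" where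
  "dtransition \<kappa> \<mu> x \<equiv> frechet_derivative (transition \<kappa> \<mu>) (at x)"

text \<open>A smooth structure on the whole (Hausdorff, second countable) space \<open>'m\<close>.  The atlas need
  not be maximal.\<close>

definition smooth_atlas ::
  "('m::{t2_space, second_countable_topology}, 'e::euclidean_space) chart set \<Rightarrow> bool" where
  "smooth_atlas A \<longleftrightarrow>
     (\<Union>\<kappa>\<in>A. fst \<kappa>) = UNIV \<and>
     (\<forall>\<kappa>\<in>A. open (fst \<kappa>) \<and> open (chart_range \<kappa>) \<and>
        homeomorphism (fst \<kappa>) (chart_range \<kappa>) (snd \<kappa>) (inv_into (fst \<kappa>) (snd \<kappa>))) \<and>
     (\<forall>\<kappa>\<in>A. \<forall>\<mu>\<in>A. smooth_on (chart_overlap \<kappa> \<mu>) (transition \<kappa> \<mu>))"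


section \<open>Riemannian metrics, almost complex structures, linear connections\<close>

text \<open>A tensor field on the manifold is given by its local representatives, one for each chart
  \<open>\<kappa>\<close>, on the open set \<open>chart_range \<kappa>\<close>, which are related by the derivatives of the coordinate
  changes.  (Values at points outside \<open>chart_range \<kappa>\<close> are irrelevant.)\<close>

type_synonym 'e metric = "'e \<Rightarrow> 'e \<Rightarrow> 'e \<Rightarrow> real"   (* point, two tangent vectors *)
type_synonym 'e endo = "'e \<Rightarrow> 'e \<Rightarrow> 'e"            (* point, tangent vector *)
type_synonym 'e christoffel = "'e \<Rightarrow> 'e \<Rightarrow> 'e \<Rightarrow> 'e"

definition riemannian_metric ::
  "('m, 'e::euclidean_space) chart set \<Rightarrow> (('m, 'e) chart \<Rightarrow> 'e metric) \<Rightarrow> bool" where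
  "riemannian_metric A g \<longleftrightarrow>
     (\<forall>\<kappa>\<in>A. (\<forall>u v. smooth_on (chart_range \<kappa>) (\<lambda>x. g \<kappa> x u v)) \<and>
        (\<forall>x\<in>chart_range \<kappa>. bilinear (g \<kappa> x) \<and> (\<forall>u v. g \<kappa> x u v = g \<kappa> x v u) \<and>
           (\<forall>u. u \<noteq> 0 \<longrightarrow> g \<kappa> x u u > 0))) \<and>
     (\<forall>\<kappa>\<in>A. \<forall>\<mu>\<in>A. \<forall>x\<in>chart_overlap \<kappa> \<mu>. \<forall>u v.
        g \<kappa> x u v =
        g \<mu> (transition \<kappa> \<mu> x) (dtransition \<kappa> \<mu> x u) (dtransition \<kappa> \<mu> x v))"

definition endomorphism_field ::
  "('m, 'e::euclidean_space) chart set \<Rightarrow> (('m, 'e) chart \<Rightarrow> 'e endo) \<Rightarrow> bool" where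
  "endomorphism_field A J \<longleftrightarrow>
     (\<forall>\<kappa>\<in>A. (\<forall>u. smooth_on (chart_range \<kappa>) (\<lambda>x. J \<kappa> x u)) \<and>
        (\<forall>x\<in>chart_range \<kappa>. linear (J \<kappa> x))) \<and>
     (\<forall>\<kappa>\<in>A. \<forall>\<mu>\<in>A. \<forall>x\<in>chart_overlap \<kappa> \<mu>. \<forall>u.
        dtransition \<kappa> \<mu> x (J \<kappa> x u) = J \<mu> (transition \<kappa> \<mu> x) (dtransition \<kappa> \<mu> x u))"

definition almost_hyperhermitian ::
  "('m::{t2_space, second_countable_topology}, 'e::euclidean_space) chart set \<Rightarrow>
   (('m, 'e) chart \<Rightarrow> 'e metric) \<Rightarrow> (nat \<Rightarrow> ('m, 'e) chart \<Rightarrow> 'e endo) \<Rightarrow> bool" where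
  "almost_hyperhermitian A g J \<longleftrightarrow>
     smooth_atlas A \<and> riemannian_metric A g \<and> (\<forall>a\<in>{1,2,3}. endomorphism_field A (J a)) \<and>
     (\<forall>\<kappa>\<in>A. \<forall>x\<in>chart_range \<kappa>. \<forall>u.
        J 1 \<kappa> x (J 2 \<kappa> x u) = J 3 \<kappa> x u \<and>
        - J 2 \<kappa> x (J 1 \<kappa> x u) = J 3 \<kappa> x u) \<and>
     (\<forall>a\<in>{1,2,3}. \<forall>\<kappa>\<in>A. \<forall>x\<in>chart_range \<kappa>. \<forall>u v.
        J a \<kappa> x (J a \<kappa> x u) = - u \<and>
        g \<kappa> x (J a \<kappa> x u) (J a \<kappa> x v) = g \<kappa> x u v)"

definition lie_bracket :: "('e::euclidean_space \<Rightarrow> 'e) \<Rightarrow> ('e \<Rightarrow> 'e) \<Rightarrow> 'e \<Rightarrow> 'e" where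
  "lie_bracket X Y x =
     frechet_derivative Y (at x) (X x) - frechet_derivative X (at x) (Y x)"

text \<open>The covariant derivative of \<open>Y\<close> along \<open>X\<close> in a chart, for Christoffel symbols \<open>\<Gamma>\<close>.\<close>

definition nabla ::
  "'e christoffel \<Rightarrow> ('e \<Rightarrow> 'e) \<Rightarrow> ('e \<Rightarrow> 'e) \<Rightarrow> 'e::euclidean_space \<Rightarrow> 'e" where
  "nabla \<Gamma> X Y x = frechet_derivative Y (at x) (X x) + \<Gamma> x (X x) (Y x)"

text \<open>The last clause is the transformation law of Christoffel symbols: with \<open>\<tau>\<close> the coordinate
  change, it says that $\tau_*(\nabla_X Y) = \nabla_{\tau_* X} (\tau_* Y)$ for local vector fields
  $X$, $Y$.\<close>

definition linear_connection ::
  "('m, 'e::euclidean_space) chart set \<Rightarrow> (('m, 'e) chart \<Rightarrow> 'e christoffel) \<Rightarrow> bool" where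
  "linear_connection A \<Gamma> \<longleftrightarrow>
     (\<forall>\<kappa>\<in>A. (\<forall>u v. smooth_on (chart_range \<kappa>) (\<lambda>x. \<Gamma> \<kappa> x u v)) \<and>
        (\<forall>x\<in>chart_range \<kappa>. bilinear (\<Gamma> \<kappa> x))) \<and>
     (\<forall>\<kappa>\<in>A. \<forall>\<mu>\<in>A. \<forall>x\<in>chart_overlap \<kappa> \<mu>. \<forall>u v.
        dtransition \<kappa> \<mu> x (\<Gamma> \<kappa> x u v) =
        frechet_derivative (\<lambda>y. dtransition \<kappa> \<mu> y v) (at x) u +
        \<Gamma> \<mu> (transition \<kappa> \<mu> x) (dtransition \<kappa> \<mu> x u) (dtransition \<kappa> \<mu> x v))"


section \<open>Exterior algebra at a point\<close>

text \<open>A \<open>k\<close>-form at a point is a function on lists of tangent vectors, of which only the values on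
  lists of length \<open>k\<close> are relevant.  The wedge product and the exterior derivative carry no
  $1/(p+q)!$ resp. $1/(k+1)$; thus $(\alpha \wedge \beta)(X,Y) = \alpha(X)\beta(Y) -
  \alpha(Y)\beta(X)$ for 1-forms.\<close>

type_synonym 'e form = "'e list \<Rightarrow> real"

definition wedge :: "nat \<Rightarrow> nat \<Rightarrow> 'e form \<Rightarrow> 'e form \<Rightarrow> 'e form" where
  "wedge p q \<alpha> \<beta> vs =
     (\<Sum>\<sigma> | \<sigma> permutes {..<p+q}.
        of_int (sign \<sigma>) * \<alpha> (map (\<lambda>i. vs ! \<sigma> i) [0..<p]) * \<beta> (map (\<lambda>i. vs ! \<sigma> i) [p..<p+q]))
     / (fact p * fact q)"

definition totally_skew :: "'e form \<Rightarrow> bool" where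
  "totally_skew T \<longleftrightarrow>
     (\<forall>u v w. T [u, v, w] = - T [v, u, w] \<and> T [u, v, w] = - T [u, w, v])"

definition orthonormal_frame :: "('e \<Rightarrow> 'e \<Rightarrow> real) \<Rightarrow> (nat \<Rightarrow> 'e::euclidean_space) \<Rightarrow> bool" where
  "orthonormal_frame h e \<longleftrightarrow>
     (\<forall>i<DIM('e). \<forall>j<DIM('e). h (e i) (e j) = (if i = j then 1 else 0))"

definition some_frame :: "('e \<Rightarrow> 'e \<Rightarrow> real) \<Rightarrow> nat \<Rightarrow> 'e::euclidean_space" where
  "some_frame h = (SOME e. orthonormal_frame h e)"

text \<open>$\sum_s B(e_s, e_s)$; for bilinear \<open>B\<close> this does not depend on the orthonormal frame.\<close>

definition metric_trace ::
  "('e \<Rightarrow> 'e \<Rightarrow> real) \<Rightarrow> ('e::euclidean_space \<Rightarrow> 'e \<Rightarrow> real) \<Rightarrow> real" where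
  "metric_trace h B = (\<Sum>s<DIM('e). B (some_frame h s) (some_frame h s))"

definition sharp :: "('e \<Rightarrow> 'e \<Rightarrow> real) \<Rightarrow> 'e form \<Rightarrow> 'e" where
  "sharp h \<alpha> = (THE v. \<forall>w. h v w = \<alpha> [w])"

definition interior_mult :: "('e \<Rightarrow> 'e \<Rightarrow> real) \<Rightarrow> 'e form \<Rightarrow> 'e form \<Rightarrow> 'e form" where
  "interior_mult h \<alpha> \<beta> vs = \<beta> (sharp h \<alpha> # vs)"

definition ldet :: "nat \<Rightarrow> (nat \<Rightarrow> nat \<Rightarrow> real) \<Rightarrow> real" where
  "ldet n M = (\<Sum>\<sigma> | \<sigma> permutes {..<n}. of_int (sign \<sigma>) * (\<Prod>i<n. M i (\<sigma> i)))"

text \<open>An arbitrary but fixed ordering of the standard basis; it fixes the orientation of the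
  coordinate space.\<close>

definition coord_frame :: "nat \<Rightarrow> 'e::euclidean_space" where
  "coord_frame = (SOME b. bij_betw b {..<DIM('e)} (Basis :: 'e set))"

definition volume_form :: "('e \<Rightarrow> 'e \<Rightarrow> real) \<Rightarrow> 'e::euclidean_space form" where
  "volume_form h vs =
     sqrt (ldet DIM('e) (\<lambda>i j. h (coord_frame i) (coord_frame j))) *
     ldet DIM('e) (\<lambda>i j. coord_frame i \<bullet> (vs ! j))"

text \<open>$(*\alpha)(v_{1},\dots) = \frac1{k!} \sum_{i_1,\dots,i_k}
  \alpha(e_{i_1},\dots,e_{i_k})\, \mathrm{vol}(e_{i_1},\dots,e_{i_k}, v_1,\dots)$, so that
  $\alpha \wedge *\beta = \langle\alpha,\beta\rangle\,\mathrm{vol}$.\<close>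

definition hodge :: "nat \<Rightarrow> ('e \<Rightarrow> 'e \<Rightarrow> real) \<Rightarrow> 'e::euclidean_space form \<Rightarrow> 'e form" where
  "hodge k h \<alpha> vs =
     (\<Sum>is | set is \<subseteq> {..<DIM('e)} \<and> length is = k.
        \<alpha> (map (some_frame h) is) * volume_form h (map (some_frame h) is @ vs)) / fact k"


section \<open>Differential operators in a chart\<close>

text \<open>Tensors given by a formula in vector fields $X$, $Y$, \dots are evaluated on tangent vectors
  by extending these to vector fields with constant components in the chart.\<close>

definition ext_deriv :: "nat \<Rightarrow> ('e \<Rightarrow> 'e form) \<Rightarrow> 'e::euclidean_space \<Rightarrow> 'e form" where
  "ext_deriv k \<alpha> x vs =
     (\<Sum>i\<le>k. (-1) ^ i *
        frechet_derivative (\<lambda>y. \<alpha> y (take i vs @ drop (Suc i) vs)) (at x) (vs ! i))"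

text \<open>$\delta = -{*}d{*}$, the codifferential in even dimension.  It does not depend on the
  orientation used by \<open>hodge\<close>.\<close>

definition codifferential ::
  "nat \<Rightarrow> 'e metric \<Rightarrow> ('e \<Rightarrow> 'e form) \<Rightarrow> 'e::euclidean_space \<Rightarrow> 'e form" where
  "codifferential k G \<alpha> x vs =
     - hodge (DIM('e) - k + 1) (G x)
         (ext_deriv (DIM('e) - k) (\<lambda>y. hodge k (G y) (\<alpha> y)) x) vs"

definition fundamental_form :: "'e metric \<Rightarrow> 'e endo \<Rightarrow> 'e \<Rightarrow> 'e form" where
  "fundamental_form G J x vs = G x (vs ! 0) (J x (vs ! 1))"

definition Phi_form :: "'e metric \<Rightarrow> 'e endo \<Rightarrow> 'e \<Rightarrow> 'e form" where
  "Phi_form G J x vs = wedge 2 2 (fundamental_form G J x) (fundamental_form G J x) vs / 2"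

definition nijenhuis ::
  "'e endo \<Rightarrow> ('e \<Rightarrow> 'e) \<Rightarrow> ('e \<Rightarrow> 'e) \<Rightarrow> 'e::euclidean_space \<Rightarrow> 'e" where
  "nijenhuis J X Y x =
     lie_bracket (\<lambda>y. J y (X y)) (\<lambda>y. J y (Y y)) x - lie_bracket X Y x
     - J x (lie_bracket (\<lambda>y. J y (X y)) Y x) - J x (lie_bracket X (\<lambda>y. J y (Y y)) x)"

definition nijenhuis_tensor :: "'e metric \<Rightarrow> 'e endo \<Rightarrow> 'e::euclidean_space \<Rightarrow> 'e form" where
  "nijenhuis_tensor G J x vs = G x (nijenhuis J (\<lambda>_. vs ! 0) (\<lambda>_. vs ! 1) x) (vs ! 2)"

definition torsion_tensor :: "'e metric \<Rightarrow> 'e christoffel \<Rightarrow> 'e::euclidean_space \<Rightarrow> 'e form" where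
  "torsion_tensor G \<Gamma> x vs =
     (let X = (\<lambda>_. vs ! 0); Y = (\<lambda>_. vs ! 1)
      in G x (nabla \<Gamma> X Y x - nabla \<Gamma> Y X x - lie_bracket X Y x) (vs ! 2))"

definition J_act :: "'e endo \<Rightarrow> 'e \<Rightarrow> 'e form \<Rightarrow> 'e form" where
  "J_act J x \<alpha> vs = - \<alpha> [J x (vs ! 0)]"

definition lee_form :: "'e metric \<Rightarrow> 'e endo \<Rightarrow> 'e::euclidean_space \<Rightarrow> 'e form" where
  "lee_form G J x vs =
     metric_trace (G x)
       (\<lambda>u v. ext_deriv 2 (fundamental_form G J) x [vs ! 0, J x u, v]) / 2"

text \<open>The 1-form $\nu^a$, for \<open>J\<close> $= J_a$ and \<open>K\<close> $= J_b$ with $(a,b,c)$ cyclic.\<close>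

definition nu_form :: "'e metric \<Rightarrow> 'e endo \<Rightarrow> 'e endo \<Rightarrow> 'e::euclidean_space \<Rightarrow> 'e form" where
  "nu_form G J K x vs =
     metric_trace (G x) (\<lambda>u v. nijenhuis_tensor G J x [K x (vs ! 0), K x u, v]) / 4"


section \<open>AHKT manifolds\<close>

definition ahkt_connection ::
  "('m, 'e::euclidean_space) chart set \<Rightarrow> (('m, 'e) chart \<Rightarrow> 'e metric) \<Rightarrow>
   (nat \<Rightarrow> ('m, 'e) chart \<Rightarrow> 'e endo) \<Rightarrow> (('m, 'e) chart \<Rightarrow> 'e christoffel) \<Rightarrow> bool" where
  "ahkt_connection A g J \<Gamma> \<longleftrightarrow>
     linear_connection A \<Gamma> \<and>
     (\<forall>\<kappa>\<in>A. \<forall>X Y Z. smooth_on (chart_range \<kappa>) X \<longrightarrow> smooth_on (chart_range \<kappa>) Y \<longrightarrow>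
        smooth_on (chart_range \<kappa>) Z \<longrightarrow> (\<forall>x\<in>chart_range \<kappa>.
          frechet_derivative (\<lambda>y. g \<kappa> y (Y y) (Z y)) (at x) (X x) =
          g \<kappa> x (nabla (\<Gamma> \<kappa>) X Y x) (Z x) + g \<kappa> x (Y x) (nabla (\<Gamma> \<kappa>) X Z x))) \<and>
     (\<forall>a\<in>{1,2,3}. \<forall>\<kappa>\<in>A. \<forall>X Y. smooth_on (chart_range \<kappa>) X \<longrightarrow>
        smooth_on (chart_range \<kappa>) Y \<longrightarrow> (\<forall>x\<in>chart_range \<kappa>.
          nabla (\<Gamma> \<kappa>) X (\<lambda>y. J a \<kappa> y (Y y)) x = J a \<kappa> x (nabla (\<Gamma> \<kappa>) X Y x))) \<and>
     (\<forall>\<kappa>\<in>A. \<forall>x\<in>chart_range \<kappa>. totally_skew (torsion_tensor (g \<kappa>) (\<Gamma> \<kappa>) x))"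

definition ahkt ::
  "('m::{t2_space, second_countable_topology}, 'e::euclidean_space) chart set \<Rightarrow>
   (('m, 'e) chart \<Rightarrow> 'e metric) \<Rightarrow> (nat \<Rightarrow> ('m, 'e) chart \<Rightarrow> 'e endo) \<Rightarrow> bool" where
  "ahkt A g J \<longleftrightarrow> almost_hyperhermitian A g J \<and> (\<exists>\<Gamma>. ahkt_connection A g J \<Gamma>)"

definition cyclic_triples :: "(nat \<times> nat \<times> nat) set" where
  "cyclic_triples = {(1, 2, 3), (2, 3, 1), (3, 1, 2)}"

end

theory Submission
  imports Defs "HOL-Combinatorics.Multiset_Permutations"
begin

text \<open>An almost Hermitian structure with totally skew Nijenhuis tensor admits exactly one metric
  connection with skew torsion that preserves $J$; its torsion is $T = -dF(J\cdot, J\cdot, J\cdot) + N$.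
  Hence a manifold is AHKT iff all $N^a$ are skew and the three tensors $T^a$ coincide.

  In dimension 8 the form $\Phi^a$ is self-dual up to the orientation, so $\delta\Phi^a = \mp {*}(F^a \wedge dF^a)$,
  and evaluating this on a unitary basis gives
  $\delta\Phi^a = dF^a(J_a\cdot, J_a\cdot, J_a\cdot) + J_a\theta^a \wedge F^a$.  A skew $N^a$ has type
  $(3,0)+(0,3)$ and is therefore determined by $\nu^a$:
  $N^a = J_b\nu^a \wedge F^b - J_c\nu^a \wedge F^c$.  Thus $T^a = -\delta\Phi^a + J_a\theta^a \wedge F^a +
  J_b\nu^a \wedge F^b - J_c\nu^a \wedge F^c$, and once $\nu^a = \theta^b - \theta^c$, which holds for a common
  torsion by taking traces, $T^b = T^c$ is the condition on $\delta\Phi^b - \delta\Phi^c$.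

  The common connection is defined chartwise by the Koszul formula; it transforms correctly under a
  change of charts because it is unique at each point.\<close>

section \<open>Calculus of smooth functions\<close>

text \<open>Orthonormal frames are chosen by \<open>SOME\<close> separately at each point, with no
  regularity in the point, whereas the codifferential differentiates a Hodge dual. So Hodge duals
  have to be computed independently of the frame, and the dual of \<Phi> must be known on a whole
  neighbourhood: there it is \<Phi> times an orientation sign, constant by continuity. Apart from
  this sign all work is pointwise. The first derivatives of the metric and of J at a point are
  treated as algebraic data, which turns dF, N and the compatible connections into statements about
  trilinear maps. The identities special to dimension 8 compare alternating forms on a frame e, Ie,
  Je, Ke, f, If, Jf, Kf, which leaves finitely many increasing index lists. The shape of the second
  condition comes from inserting the relations between \<nu> and \<theta> into T^b - T^c: the terms
  with F^b add up to J_b \<theta>^a, those with F^c to -J_c \<theta>^a, those with F^a to J_a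
  \<nu>^a.\<close>

lemma Ck_on_cong:
  assumes "open S" "\<And>x. x \<in> S \<Longrightarrow> f x = g x" "Ck_on k S f"
  shows "Ck_on k S g"
  using assms(2,3)
proof (induction k arbitrary: f g)
  case 0
  then show ?case by (simp cong: continuous_on_cong)
next
  case (Suc k)
  have d: "f differentiable at x" if "x \<in> S" for x using Suc.prems that by simp
  have eq: "frechet_derivative f (at x) = frechet_derivative g (at x)" if "x \<in> S" for x
    by (rule frechet_derivative_transform_within_open[OF d[OF that] assms(1) that]) (use Suc in auto)
  have "g differentiable at x" if "x \<in> S" for x
    using d[OF that] has_derivative_transform_within_open[OF _ assms(1) that, of f _ UNIV g] Suc.prems
    unfolding differentiable_def by blast
  moreover have "Ck_on k S (\<lambda>x. frechet_derivative g (at x) v)" for v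
    by (rule Suc.IH[of "\<lambda>x. frechet_derivative f (at x) v"]) (use Suc.prems eq in auto)
  ultimately show ?case by simp
qed

lemma Ck_on_SucD: "Ck_on (Suc k) S f \<Longrightarrow> Ck_on k S f"
proof (induction k arbitrary: f)
  case 0
  then show ?case
    by (auto intro!: continuous_at_imp_continuous_on differentiable_imp_continuous_within)
next
  case (Suc k)
  then show ?case by (metis Ck_on.simps(2))
qed

text \<open>Any \<open>f'\<close> delivered by a \<open>has_derivative\<close> rule may replace
  \<open>frechet_derivative\<close>, so the closure proofs below only need the usual differentiation
  rules.\<close>

lemma Ck_on_SucI:
  assumes "open S" "\<And>x. x \<in> S \<Longrightarrow> (f has_derivative f' x) (at x)"
    "\<And>v. Ck_on k S (\<lambda>x. f' x v)"
  shows "Ck_on (Suc k) S f"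
proof -
  have "Ck_on k S (\<lambda>x. frechet_derivative f (at x) v)" for v
    by (rule Ck_on_cong[OF assms(1) _ assms(3)[of v]])
      (metis assms(2) frechet_derivative_at)
  then show ?thesis using assms(2) by (auto simp: differentiable_def)
qed

lemma Ck_on_Suc_has_derivative:
  "Ck_on (Suc k) S f \<Longrightarrow> x \<in> S \<Longrightarrow> (f has_derivative frechet_derivative f (at x)) (at x)"
  by (simp flip: frechet_derivative_works)

lemma Ck_on_const: "open S \<Longrightarrow> Ck_on k S (\<lambda>x. c)"
  by (induction k arbitrary: c) (auto intro: Ck_on_SucI has_derivative_const simp del: Ck_on.simps(2))

lemma Ck_on_add:
  "open S \<Longrightarrow> Ck_on k S f \<Longrightarrow> Ck_on k S g \<Longrightarrow> Ck_on k S (\<lambda>x. f x + g x)"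
proof (induction k arbitrary: f g)
  case 0 then show ?case by (simp add: continuous_on_add)
next
  case (Suc k)
  show ?case
    by (rule Ck_on_SucI[OF Suc.prems(1) has_derivative_add[OF Ck_on_Suc_has_derivative[OF Suc.prems(2)]
          Ck_on_Suc_has_derivative[OF Suc.prems(3)]]]) (use Suc in auto)
qed

lemma Ck_on_sum:
  "open S \<Longrightarrow> (\<And>i. i \<in> I \<Longrightarrow> Ck_on k S (f i)) \<Longrightarrow> Ck_on k S (\<lambda>x. \<Sum>i\<in>I. f i x)"
proof (induction I rule: infinite_finite_induct)
  case (insert i I) then show ?case by (simp add: Ck_on_add)
qed (simp_all add: Ck_on_const)

lemma Ck_on_bilinear:
  assumes "bounded_bilinear p"
  shows "open S \<Longrightarrow> Ck_on k S f \<Longrightarrow> Ck_on k S g \<Longrightarrow> Ck_on k S (\<lambda>x. p (f x) (g x))"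
proof (induction k arbitrary: f g)
  case 0
  then have "continuous_on S f" "continuous_on S g" by simp_all
  then have "continuous_on S (\<lambda>x. p (f x) (g x))"
    unfolding continuous_on_def by (blast intro: bounded_bilinear.tendsto[OF assms])
  then show ?case by simp
next
  case (Suc k)
  have D: "Ck_on k S (\<lambda>x. frechet_derivative f (at x) v)" "Ck_on k S (\<lambda>x. frechet_derivative g (at x) v)"
    "Ck_on k S f" "Ck_on k S g" for v
    using Suc.prems Ck_on_SucD by auto
  show ?case
    by (rule Ck_on_SucI[OF Suc.prems(1) bounded_bilinear.FDERIV[OF assms Ck_on_Suc_has_derivative[OF Suc.prems(2)]
          Ck_on_Suc_has_derivative[OF Suc.prems(3)]]])
      (assumption+, intro Ck_on_add Suc.IH D Suc.prems(1))
qed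

lemmas Ck_on_scaleR = Ck_on_bilinear[OF bounded_bilinear_scaleR]
lemmas Ck_on_mult = Ck_on_bilinear[OF bounded_bilinear_mult]
lemmas Ck_on_inner = Ck_on_bilinear[OF bounded_bilinear_inner]

lemma Ck_on_prod:
  fixes f :: "'i \<Rightarrow> 'a::euclidean_space \<Rightarrow> real"
  shows "open S \<Longrightarrow> (\<And>i. i \<in> I \<Longrightarrow> Ck_on k S (f i)) \<Longrightarrow> Ck_on k S (\<lambda>x. \<Prod>i\<in>I. f i x)"
proof (induction I rule: infinite_finite_induct)
  case (insert i I) then show ?case by (simp add: Ck_on_mult)
qed (simp_all add: Ck_on_const)

text \<open>The derivative -f'/f^2 contains 1/f again, and this factor is C^k by the induction
  hypothesis.\<close>

lemma Ck_on_inverse: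
  fixes f :: "'a::euclidean_space \<Rightarrow> real"
  shows "open S \<Longrightarrow> Ck_on k S f \<Longrightarrow> (\<And>x. x \<in> S \<Longrightarrow> f x \<noteq> 0) \<Longrightarrow> Ck_on k S (\<lambda>x. inverse (f x))"
proof (induction k arbitrary: f)
  case 0 then show ?case by (simp add: continuous_on_inverse)
next
  case (Suc k)
  have 1: "((\<lambda>x. inverse (f x)) has_derivative
      (\<lambda>h. (-1) * (inverse (f x) * frechet_derivative f (at x) h * inverse (f x)))) (at x)" if "x \<in> S" for x
    using Deriv.has_derivative_inverse[OF Suc.prems(3)[OF that] Ck_on_Suc_has_derivative[OF Suc.prems(2) that]] by simp
  have 2: "Ck_on k S (\<lambda>x. inverse (f x))"
    by (intro Suc.IH Suc.prems Ck_on_SucD[OF Suc.prems(2)])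
  have 3: "Ck_on k S (\<lambda>x. frechet_derivative f (at x) v)" for v
    using Suc.prems(2) by simp
  have 4: "Ck_on k S (\<lambda>x. (-1) * (inverse (f x) * frechet_derivative f (at x) v * inverse (f x)))" for v
    by (rule Ck_on_mult[OF Suc.prems(1) Ck_on_const[OF Suc.prems(1)]
          Ck_on_mult[OF Suc.prems(1) Ck_on_mult[OF Suc.prems(1) 2 3] 2]])
  show ?case
  proof (rule Ck_on_SucI)
    show "open S" by fact
    show "((\<lambda>x. inverse (f x)) has_derivative
      (\<lambda>h. (-1) * (inverse (f x) * frechet_derivative f (at x) h * inverse (f x)))) (at x)" if "x \<in> S" for x
      by (rule 1[OF that])
  qed (rule 4)
qed

lemma smooth_on_cong: "open S \<Longrightarrow> (\<And>x. x \<in> S \<Longrightarrow> f x = g x) \<Longrightarrow> smooth_on S f \<Longrightarrow> smooth_on S g"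
  unfolding smooth_on_def by (blast intro: Ck_on_cong)

lemma smooth_on_frechet: "smooth_on S f \<Longrightarrow> smooth_on S (\<lambda>x. frechet_derivative f (at x) v)"
  unfolding smooth_on_def by (metis Ck_on.simps(2))

lemma smooth_on_differentiable: "smooth_on S f \<Longrightarrow> x \<in> S \<Longrightarrow> f differentiable (at x)"
  unfolding smooth_on_def by (metis Ck_on.simps(2))

lemma smooth_on_has_derivative:
  "smooth_on S f \<Longrightarrow> x \<in> S \<Longrightarrow> (f has_derivative frechet_derivative f (at x)) (at x)"
  by (simp add: smooth_on_differentiable flip: frechet_derivative_works)

lemma smooth_on_continuous_on: "smooth_on S f \<Longrightarrow> continuous_on S f"
  unfolding smooth_on_def by (metis Ck_on.simps(1))

lemma smooth_on_const: "open S \<Longrightarrow> smooth_on S (\<lambda>x. c)"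
  unfolding smooth_on_def by (simp add: Ck_on_const)

lemma smooth_on_add: "open S \<Longrightarrow> smooth_on S f \<Longrightarrow> smooth_on S g \<Longrightarrow> smooth_on S (\<lambda>x. f x + g x)"
  unfolding smooth_on_def by (simp add: Ck_on_add)

lemma smooth_on_scaleR:
  "open S \<Longrightarrow> smooth_on S f \<Longrightarrow> smooth_on S g \<Longrightarrow> smooth_on S (\<lambda>x. f x *\<^sub>R g x)"
  unfolding smooth_on_def by (simp add: Ck_on_scaleR)

lemma smooth_on_mult:
  fixes f :: "'a::euclidean_space \<Rightarrow> real"
  shows "open S \<Longrightarrow> smooth_on S f \<Longrightarrow> smooth_on S g \<Longrightarrow> smooth_on S (\<lambda>x. f x * g x)"
  unfolding smooth_on_def by (intro allI Ck_on_mult) auto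

lemma smooth_on_minus: "open S \<Longrightarrow> smooth_on S f \<Longrightarrow> smooth_on S (\<lambda>x. - f x)"
  using smooth_on_scaleR[OF _ smooth_on_const, of S f "-1"] by simp

lemma smooth_on_diff: "open S \<Longrightarrow> smooth_on S f \<Longrightarrow> smooth_on S g \<Longrightarrow> smooth_on S (\<lambda>x. f x - g x)"
  using smooth_on_add[of S f "\<lambda>x. - g x"] by (simp add: smooth_on_minus)

lemma smooth_on_inner_const:
  "open S \<Longrightarrow> smooth_on S f \<Longrightarrow> smooth_on S (\<lambda>x. f x \<bullet> b)"
  unfolding smooth_on_def by (simp add: Ck_on_inner Ck_on_const)

lemma smooth_on_sum: "open S \<Longrightarrow> (\<And>i. i \<in> I \<Longrightarrow> smooth_on S (f i)) \<Longrightarrow> smooth_on S (\<lambda>x. \<Sum>i\<in>I. f i x)"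
  unfolding smooth_on_def by (simp add: Ck_on_sum)

lemma smooth_on_prod:
  fixes f :: "'i \<Rightarrow> 'a::euclidean_space \<Rightarrow> real"
  shows "open S \<Longrightarrow> (\<And>i. i \<in> I \<Longrightarrow> smooth_on S (f i)) \<Longrightarrow> smooth_on S (\<lambda>x. \<Prod>i\<in>I. f i x)"
  unfolding smooth_on_def by (simp add: Ck_on_prod)

lemma smooth_on_divide:
  fixes f :: "'a::euclidean_space \<Rightarrow> real"
  shows "open S \<Longrightarrow> smooth_on S f \<Longrightarrow> smooth_on S g \<Longrightarrow> (\<And>x. x \<in> S \<Longrightarrow> g x \<noteq> 0) \<Longrightarrow>
    smooth_on S (\<lambda>x. f x / g x)"
  unfolding smooth_on_def divide_inverse by (intro allI Ck_on_mult Ck_on_inverse) auto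

lemmas smooth_intros = smooth_on_const smooth_on_add smooth_on_scaleR smooth_on_mult smooth_on_minus
  smooth_on_diff smooth_on_inner_const smooth_on_sum smooth_on_prod smooth_on_divide smooth_on_frechet

section \<open>Linear and bilinear maps that vary with the point\<close>

lemma linear_expand:
  fixes v :: "'a::euclidean_space"
  assumes "linear L" shows "L v = (\<Sum>b\<in>Basis. (v \<bullet> b) *\<^sub>R L b)"
  by (metis (no_types, lifting) assms euclidean_representation linear_cmul linear_sum sum.cong)

text \<open>Smoothness of a tensor field is given on constant vectors only; expanding the argument
  in the standard basis extends it to smooth vector fields.\<close>

lemma smooth_on_param:
  fixes Y :: "'c::euclidean_space \<Rightarrow> 'a::euclidean_space"
  assumes S: "open S" and L: "\<And>v. smooth_on S (\<lambda>x. L x v)" "\<And>x. x \<in> S \<Longrightarrow> linear (L x)"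
    and Y: "smooth_on S Y"
  shows "smooth_on S (\<lambda>x. L x (Y x))"
  by (rule smooth_on_cong[OF S, of "\<lambda>x. \<Sum>b\<in>Basis. (Y x \<bullet> b) *\<^sub>R L x b"])
    (auto simp: linear_expand[OF L(2), symmetric] intro!: smooth_intros S L Y)

text \<open>Leibniz rule: the first term differentiates \<open>L\<close> with the vector frozen at
  \<open>Y x\<close>. It follows by expanding \<open>Y\<close> in the standard basis and collecting
  the terms again.\<close>

lemma has_derivative_param:
  fixes Y :: "'c::euclidean_space \<Rightarrow> 'a::euclidean_space"
  assumes S: "open S" "x \<in> S" and L: "\<And>v. (\<lambda>y. L y v) differentiable at x"
    and lin: "\<And>y. y \<in> S \<Longrightarrow> linear (L y)"
    and Y: "(Y has_derivative Y') (at x)"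
  shows "((\<lambda>y. L y (Y y)) has_derivative
    (\<lambda>u. frechet_derivative (\<lambda>y. L y (Y x)) (at x) u + L x (Y' u))) (at x)"
proof -
  let ?D = "\<lambda>b. frechet_derivative (\<lambda>y. L y b) (at x)"
  have D: "((\<lambda>y. L y b) has_derivative ?D b) (at x)" for b
    using L frechet_derivative_works by blast
  have "((\<lambda>y. \<Sum>b\<in>Basis. (Y x \<bullet> b) *\<^sub>R L y b) has_derivative (\<lambda>u. \<Sum>b\<in>Basis. (Y x \<bullet> b) *\<^sub>R ?D b u)) (at x)"
    by (intro has_derivative_sum has_derivative_scaleR_right D)
  then have "((\<lambda>y. L y (Y x)) has_derivative (\<lambda>u. \<Sum>b\<in>Basis. (Y x \<bullet> b) *\<^sub>R ?D b u)) (at x)"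
    by (rule has_derivative_transform_within_open[OF _ S]) (simp add: linear_expand[OF lin, symmetric])
  then have eq: "frechet_derivative (\<lambda>y. L y (Y x)) (at x) = (\<lambda>u. \<Sum>b\<in>Basis. (Y x \<bullet> b) *\<^sub>R ?D b u)"
    by (metis frechet_derivative_at)
  have "((\<lambda>y. \<Sum>b\<in>Basis. (Y y \<bullet> b) *\<^sub>R L y b) has_derivative
     (\<lambda>u. \<Sum>b\<in>Basis. (Y x \<bullet> b) *\<^sub>R ?D b u + (Y' u \<bullet> b) *\<^sub>R L x b)) (at x)"
    by (intro has_derivative_sum has_derivative_scaleR has_derivative_inner_left Y D)
  then have "((\<lambda>y. L y (Y y)) has_derivative
     (\<lambda>u. \<Sum>b\<in>Basis. (Y x \<bullet> b) *\<^sub>R ?D b u + (Y' u \<bullet> b) *\<^sub>R L x b)) (at x)"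
    by (rule has_derivative_transform_within_open[OF _ S]) (simp add: linear_expand[OF lin, symmetric])
  then show ?thesis
    unfolding eq by (simp add: sum.distrib linear_expand[OF lin[OF S(2)], symmetric])
qed

lemma has_derivative_param2:
  fixes L :: "'c::euclidean_space \<Rightarrow> 'a::euclidean_space \<Rightarrow> 'a \<Rightarrow> 'b::real_normed_vector"
  assumes S: "open S" "x \<in> S" and L: "\<And>v w. (\<lambda>y. L y v w) differentiable (at x)"
    and lin: "\<And>y w. y \<in> S \<Longrightarrow> linear (\<lambda>v. L y v w)" "\<And>y v. y \<in> S \<Longrightarrow> linear (\<lambda>w. L y v w)"
    and Y: "(Y has_derivative Y') (at x)" and Z: "(Z has_derivative Z') (at x)"
  shows "((\<lambda>y. L y (Y y) (Z y)) has_derivative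
    (\<lambda>u. frechet_derivative (\<lambda>y. L y (Y x) (Z x)) (at x) u + L x (Y' u) (Z x) + L x (Y x) (Z' u))) (at x)"
proof -
  have 1: "((\<lambda>y. L y v (Z y)) has_derivative
      (\<lambda>u. frechet_derivative (\<lambda>y. L y v (Z x)) (at x) u + L x v (Z' u))) (at x)" for v
    by (rule has_derivative_param[where L = "\<lambda>y. L y v", OF S L lin(2) Z])
  have "((\<lambda>y. L y (Y y) (Z y)) has_derivative
     (\<lambda>u. frechet_derivative (\<lambda>y. L y (Y x) (Z y)) (at x) u + L x (Y' u) (Z x))) (at x)"
    by (rule has_derivative_param[where L = "\<lambda>y v. L y v (Z y)", OF S _ lin(1) Y])
      (use 1 in \<open>auto simp: differentiable_def\<close>)
  moreover have "frechet_derivative (\<lambda>y. L y (Y x) (Z y)) (at x) =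
      (\<lambda>u. frechet_derivative (\<lambda>y. L y (Y x) (Z x)) (at x) u + L x (Y x) (Z' u))"
    using frechet_derivative_at[OF 1] by simp
  ultimately show ?thesis by (simp add: algebra_simps)
qed

lemma linear_frechet_param:
  fixes L :: "'c::euclidean_space \<Rightarrow> 'a::euclidean_space \<Rightarrow> 'b::real_normed_vector"
  assumes S: "open S" "x \<in> S" and L: "\<And>v. (\<lambda>y. L y v) differentiable at x"
    and lin: "\<And>y. y \<in> S \<Longrightarrow> linear (L y)"
  shows "linear (\<lambda>v. frechet_derivative (\<lambda>y. L y v) (at x) u)"
proof (rule linearI)
  let ?D = "\<lambda>b. frechet_derivative (\<lambda>y. L y b) (at x)"
  have D: "((\<lambda>y. L y b) has_derivative ?D b) (at x)" for b
    using L frechet_derivative_works by blast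
  fix v w :: 'a and c :: real
  have "L y v + L y w = L y (v + w)" "c *\<^sub>R L y v = L y (c *\<^sub>R v)" if "y \<in> S" for y
    using lin[OF that] by (simp_all add: linear_add linear_cmul)
  note tr = this
  have "((\<lambda>y. L y (v + w)) has_derivative (\<lambda>u. ?D v u + ?D w u)) (at x)"
    by (rule has_derivative_transform_within_open[where f = "\<lambda>y. L y v + L y w", OF _ S])
      (use tr(1) in \<open>auto intro: has_derivative_add D\<close>)
  from frechet_derivative_at[OF this] show "?D (v + w) u = ?D v u + ?D w u" by metis
  have "((\<lambda>y. L y (c *\<^sub>R v)) has_derivative (\<lambda>u. c *\<^sub>R ?D v u)) (at x)"
    by (rule has_derivative_transform_within_open[where f = "\<lambda>y. c *\<^sub>R L y v", OF _ S])
      (use tr(2) in \<open>auto intro: has_derivative_scaleR_right D\<close>)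
  from frechet_derivative_at[OF this] show "?D (c *\<^sub>R v) u = c *\<^sub>R ?D v u" by metis
qed

text \<open>The left-hand side is symmetric in \<open>u\<close> and \<open>v\<close>; for \<open>s \<rightarrow> 0\<close> this gives the symmetry of second
  derivatives.\<close>

lemma mixed_difference:
  fixes f :: "'a::euclidean_space \<Rightarrow> real"
  assumes S: "open S" "cball x r \<subseteq> S" "smooth_on S f" and s: "0 < s" "s * (norm u + norm v) \<le> r"
  shows "\<exists>p\<in>cball x r. f (x + s *\<^sub>R u + s *\<^sub>R v) - f (x + s *\<^sub>R u) - f (x + s *\<^sub>R v) + f x =
     s\<^sup>2 * frechet_derivative (\<lambda>y. frechet_derivative f (at y) u) (at p) v"
proof -
  let ?fu = "\<lambda>y. frechet_derivative f (at y) u"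
  have inb: "x + a *\<^sub>R u + b *\<^sub>R v \<in> cball x r" if "0 \<le> a" "a \<le> s" "0 \<le> b" "b \<le> s" for a b
  proof -
    have "norm (a *\<^sub>R u + b *\<^sub>R v) \<le> a * norm u + b * norm v"
      using norm_triangle_ineq[of "a *\<^sub>R u" "b *\<^sub>R v"] that by simp
    also have "\<dots> \<le> s * norm u + s * norm v" using that by (intro add_mono mult_right_mono) auto
    finally have "norm (- (a *\<^sub>R u + b *\<^sub>R v)) \<le> r" using s by (simp add: algebra_simps del: minus_add_distrib)
    then show ?thesis by (simp add: dist_norm algebra_simps)
  qed
  have D: "(f has_derivative frechet_derivative f (at y)) (at y)" if "y \<in> cball x r" for y
    using smooth_on_has_derivative S that by blast
  have D2: "(?fu has_derivative frechet_derivative ?fu (at y)) (at y)" if "y \<in> cball x r" for y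
    using smooth_on_has_derivative[OF smooth_on_frechet[OF S(3)]] S that by blast
  \<comment> \<open>Mean value theorem in direction \<open>u\<close> for the increment in direction
    \<open>v\<close>. It leaves a difference of \<open>?fu\<close>, which a second application in
    direction \<open>v\<close> turns into a second derivative.\<close>
  have "\<exists>a. 0 < a \<and> a < s \<and> f (x + s *\<^sub>R u + s *\<^sub>R v) - f (x + s *\<^sub>R u + 0 *\<^sub>R v) -
        (f (x + 0 *\<^sub>R u + s *\<^sub>R v) - f (x + 0 *\<^sub>R u + 0 *\<^sub>R v))
      = (s - 0) * (?fu (x + a *\<^sub>R u + s *\<^sub>R v) - ?fu (x + a *\<^sub>R u + 0 *\<^sub>R v))"
  proof -
    have 1: "((\<lambda>a. f (x + a *\<^sub>R u + s *\<^sub>R v) - f (x + a *\<^sub>R u + 0 *\<^sub>R v)) has_real_derivative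
      (?fu (x + a *\<^sub>R u + s *\<^sub>R v) - ?fu (x + a *\<^sub>R u + 0 *\<^sub>R v))) (at a)" if "0 \<le> a" "a \<le> s" for a
    proof -
      have g: "((\<lambda>a. f (x + a *\<^sub>R u + b *\<^sub>R v)) has_real_derivative ?fu (x + a *\<^sub>R u + b *\<^sub>R v)) (at a)"
        if b: "0 \<le> b" "b \<le> s" for b
      proof -
        have "((\<lambda>a. f (x + a *\<^sub>R u + b *\<^sub>R v)) has_derivative
           (\<lambda>h. frechet_derivative f (at (x + a *\<^sub>R u + b *\<^sub>R v)) (h *\<^sub>R u))) (at a)"
          by (rule has_derivative_compose[where f = "\<lambda>a. x + a *\<^sub>R u + b *\<^sub>R v" and g = f, OF _ D[OF inb[of a b]]])
            (use \<open>0 \<le> a\<close> \<open>a \<le> s\<close> b in \<open>auto intro!: derivative_eq_intros\<close>)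
        moreover have "frechet_derivative f (at (x + a *\<^sub>R u + b *\<^sub>R v)) (h *\<^sub>R u) =
            ?fu (x + a *\<^sub>R u + b *\<^sub>R v) * h" for h
          using linear_cmul[OF has_derivative_linear[OF D[OF inb]]] \<open>0 \<le> a\<close> \<open>a \<le> s\<close> b by simp
        ultimately show ?thesis by (simp add: has_field_derivative_def)
      qed
      show ?thesis by (intro DERIV_diff g) (use s in auto)
    qed
    show ?thesis using MVT2[OF s(1) 1] by blast
  qed
  then obtain a where a: "0 < a" "a < s" and fa: "f (x + s *\<^sub>R u + s *\<^sub>R v) - f (x + s *\<^sub>R u) -
        f (x + s *\<^sub>R v) + f x = s * (?fu (x + a *\<^sub>R u + s *\<^sub>R v) - ?fu (x + a *\<^sub>R u + 0 *\<^sub>R v))"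
    by auto
  let ?G = "\<lambda>b. frechet_derivative ?fu (at (x + a *\<^sub>R u + b *\<^sub>R v)) v"
  have 2: "((\<lambda>b. ?fu (x + a *\<^sub>R u + b *\<^sub>R v)) has_real_derivative ?G b) (at b)" if "0 \<le> b" "b \<le> s" for b
  proof -
    have "((\<lambda>b. ?fu (x + a *\<^sub>R u + b *\<^sub>R v)) has_derivative
       (\<lambda>h. frechet_derivative ?fu (at (x + a *\<^sub>R u + b *\<^sub>R v)) (h *\<^sub>R v))) (at b)"
      by (rule has_derivative_compose[where f = "\<lambda>b. x + a *\<^sub>R u + b *\<^sub>R v" and g = ?fu, OF _ D2[OF inb[of a b]]])
        (use a that in \<open>auto intro!: derivative_eq_intros\<close>)
    moreover have "frechet_derivative ?fu (at (x + a *\<^sub>R u + b *\<^sub>R v)) (h *\<^sub>R v) = ?G b * h" for h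
      using linear_cmul[OF has_derivative_linear[OF D2[OF inb]]] a that by simp
    ultimately show ?thesis by (simp add: has_field_derivative_def)
  qed
  obtain b where b: "0 < b" "b < s"
    and "?fu (x + a *\<^sub>R u + s *\<^sub>R v) - ?fu (x + a *\<^sub>R u + 0 *\<^sub>R v) = (s - 0) * ?G b"
    using MVT2[OF s(1) 2] by blast
  then show ?thesis
    using fa inb[of a b] a by (intro bexI[of _ "x + a *\<^sub>R u + b *\<^sub>R v"]) (auto simp: power2_eq_square)
qed

lemma frechet_derivative_symmetric_real:
  fixes f :: "'a::euclidean_space \<Rightarrow> real"
  assumes S: "open S" "x \<in> S" "smooth_on S f"
  shows "frechet_derivative (\<lambda>y. frechet_derivative f (at y) u) (at x) v =
    frechet_derivative (\<lambda>y. frechet_derivative f (at y) v) (at x) u" (is "?A u v x = ?A v u x")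
proof (rule ccontr)
  assume ne: "?A u v x \<noteq> ?A v u x"
  define e where "e = \<bar>?A u v x - ?A v u x\<bar> / 2"
  have e: "e > 0" using ne by (simp add: e_def)
  have cont: "continuous (at x) (\<lambda>p. ?A u v p)" for u v
    using smooth_on_continuous_on[OF smooth_on_frechet[OF smooth_on_frechet[OF S(3)]]] S
    by (simp add: continuous_on_eq_continuous_at)
  obtain d1 where d1: "d1 > 0" "\<And>p. dist p x < d1 \<Longrightarrow> dist (?A u v p) (?A u v x) < e"
    using cont[of u v] e unfolding continuous_at_eps_delta by metis
  obtain d2 where d2: "d2 > 0" "\<And>p. dist p x < d2 \<Longrightarrow> dist (?A v u p) (?A v u x) < e"
    using cont[of v u] e unfolding continuous_at_eps_delta by metis
  obtain r0 where r0: "r0 > 0" "cball x r0 \<subseteq> S" using S open_contains_cball by blast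
  \<comment> \<open>The halved radii put the closed ball strictly inside the open balls of radius
    \<open>d1\<close> and \<open>d2\<close>.\<close>
  define r where "r = min r0 (min (d1/2) (d2/2))"
  have r: "r > 0" "cball x r \<subseteq> S" using r0 d1 d2 by (auto simp: r_def)
  \<comment> \<open>The summand 1 keeps the denominator positive when \<open>u\<close> and
    \<open>v\<close> both vanish.\<close>
  define s where "s = r / (norm u + norm v + 1)"
  have s: "s > 0" using r by (simp add: s_def add_nonneg_pos)
  have sr: "s * (norm u + norm v) \<le> r"
  proof -
    have "0 < norm u + norm v + 1" by (simp add: add_nonneg_pos)
    then have "s * (norm u + norm v + 1) = r" by (simp add: s_def)
    then show ?thesis using s by (simp add: distrib_left)
  qed
  obtain p where p: "p \<in> cball x r" "f (x + s *\<^sub>R u + s *\<^sub>R v) - f (x + s *\<^sub>R u) - f (x + s *\<^sub>R v) + f x =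
     s\<^sup>2 * ?A u v p" using mixed_difference[OF S(1) r(2) S(3) s sr] by blast
  obtain q where q: "q \<in> cball x r" "f (x + s *\<^sub>R v + s *\<^sub>R u) - f (x + s *\<^sub>R v) - f (x + s *\<^sub>R u) + f x =
     s\<^sup>2 * ?A v u q" using mixed_difference[OF S(1) r(2) S(3) s, of v u] sr by (auto simp: add.commute)
  have "s\<^sup>2 * ?A u v p = s\<^sup>2 * ?A v u q"
    using p(2) q(2) by (simp add: algebra_simps)
  \<comment> \<open>A common value would lie within half the gap \<open>e\<close> of both limits,
    although these are \<open>2 * e\<close> apart.\<close>
  then have eq: "?A u v p = ?A v u q" using s by simp
  have "dist p x < d1" "dist q x < d2"
    using p(1) q(1) r r_def d1 d2 by (auto simp: dist_commute)
  then have "dist (?A u v p) (?A u v x) < e" "dist (?A v u q) (?A v u x) < e" using d1 d2 by auto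
  moreover have False if "\<bar>a - c\<bar> < \<bar>c - d\<bar> / 2" "\<bar>a - d\<bar> < \<bar>c - d\<bar> / 2" for a c d :: real
    using that by (simp add: abs_if split: if_splits)
  ultimately show False unfolding eq e_def dist_real_def by blast
qed

text \<open>Needed for coordinate changes: their second derivative enters the transformation law of
  a connection and must drop out of the torsion.\<close>

lemma frechet_derivative_symmetric:
  fixes f :: "'a::euclidean_space \<Rightarrow> 'b::euclidean_space"
  assumes S: "open S" "x \<in> S" "smooth_on S f"
  shows "frechet_derivative (\<lambda>y. frechet_derivative f (at y) u) (at x) v =
    frechet_derivative (\<lambda>y. frechet_derivative f (at y) v) (at x) u"
proof (rule euclidean_eqI)
  fix b :: 'b
  have D: "frechet_derivative (\<lambda>y. f y \<bullet> b) (at y) u = frechet_derivative f (at y) u \<bullet> b" if "y \<in> S" for y u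
    using has_derivative_inner_left[OF smooth_on_has_derivative[OF S(3) that], of b]
    by (metis frechet_derivative_at)
  have D2: "frechet_derivative (\<lambda>y. frechet_derivative (\<lambda>y. f y \<bullet> b) (at y) u) (at x) v =
     frechet_derivative (\<lambda>y. frechet_derivative f (at y) u) (at x) v \<bullet> b" for u v
  proof -
    have "((\<lambda>y. frechet_derivative (\<lambda>y. f y \<bullet> b) (at y) u) has_derivative
      (\<lambda>v. frechet_derivative (\<lambda>y. frechet_derivative f (at y) u) (at x) v \<bullet> b)) (at x)"
      by (rule has_derivative_transform_within_open[OF has_derivative_inner_left[OF
            smooth_on_has_derivative[OF smooth_on_frechet[OF S(3)] S(2)]] S(1,2)]) (simp add: D)
    then show ?thesis by (metis frechet_derivative_at)
  qed
  show "frechet_derivative (\<lambda>y. frechet_derivative f (at y) u) (at x) v \<bullet> b =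
    frechet_derivative (\<lambda>y. frechet_derivative f (at y) v) (at x) u \<bullet> b"
    using frechet_derivative_symmetric_real[OF S(1,2) smooth_on_inner_const[OF S(1,3), of b], of u v]
    by (simp add: D2)
qed

section \<open>Exterior algebra\<close>

definition multilinear :: "nat \<Rightarrow> 'e::real_vector form \<Rightarrow> bool" where
  "multilinear k \<alpha> \<longleftrightarrow>
     (\<forall>xs ys. length xs + length ys + 1 = k \<longrightarrow> linear (\<lambda>v. \<alpha> (xs @ v # ys)))"

text \<open>Only neighbouring arguments are exchanged. Such swaps generate all permutations, and no
  permutation sign has to be carried along.\<close>

definition alternating :: "nat \<Rightarrow> 'e::real_vector form \<Rightarrow> bool" where
  "alternating k \<alpha> \<longleftrightarrow> multilinear k \<alpha> \<and>
     (\<forall>xs a b ys. length xs + length ys + 2 = k \<longrightarrow> \<alpha> (xs @ a # b # ys) = - \<alpha> (xs @ b # a # ys))"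

lemma multilinearD:
  "multilinear k \<alpha> \<Longrightarrow> length xs + length ys + 1 = k \<Longrightarrow> linear (\<lambda>v. \<alpha> (xs @ v # ys))"
  by (simp add: multilinear_def)

lemma multilinear_Cons: "multilinear (Suc k) \<alpha> \<Longrightarrow> multilinear k (\<lambda>l. \<alpha> (v # l))"
  using multilinearD[of "Suc k" \<alpha> "v # _"] by (simp add: multilinear_def)

lemma multilinear_Cons_linear: "multilinear (Suc k) \<alpha> \<Longrightarrow> length l = k \<Longrightarrow> linear (\<lambda>v. \<alpha> (v # l))"
  using multilinearD[of "Suc k" \<alpha> "[]" l] by simp

lemma multilinear_append:
  assumes "multilinear n \<alpha>" "length vs + k = n"
  shows "multilinear k (\<lambda>l. \<alpha> (l @ vs))" "multilinear k (\<lambda>l. \<alpha> (vs @ l))"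
  using assms(1) multilinearD[OF assms(1), of _ "_ @ vs"] multilinearD[OF assms(1), of "vs @ _"] assms(2)
  by (auto simp: multilinear_def)

lemma multilinear_diff: "multilinear k \<alpha> \<Longrightarrow> multilinear k \<beta> \<Longrightarrow> multilinear k (\<lambda>l. \<alpha> l - \<beta> l)"
  by (simp add: multilinear_def linear_compose_sub)

lemma linear_cmult:
  fixes f :: "'a::real_vector \<Rightarrow> real"
  shows "linear f \<Longrightarrow> linear (\<lambda>v. c * f v)"
  using linear_compose_scale_right[of f c] by simp

lemma multilinear_sum:
  "(\<And>i. i \<in> I \<Longrightarrow> multilinear k (\<alpha> i)) \<Longrightarrow> multilinear k (\<lambda>l. \<Sum>i\<in>I. c i * \<alpha> i l)"
  unfolding multilinear_def
  by (intro allI impI linear_compose_sum ballI linear_cmult) auto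

lemma alternating_multilinear: "alternating k \<alpha> \<Longrightarrow> multilinear k \<alpha>"
  by (simp add: alternating_def)

lemma alternating_swap:
  "alternating k \<alpha> \<Longrightarrow> length xs + length ys + 2 = k \<Longrightarrow> \<alpha> (xs @ a # b # ys) = - \<alpha> (xs @ b # a # ys)"
  unfolding alternating_def by blast

lemma alternatingI:
  "multilinear k \<alpha> \<Longrightarrow> (\<And>xs a b ys. length xs + length ys + 2 = k \<Longrightarrow>
     \<alpha> (xs @ a # b # ys) = - \<alpha> (xs @ b # a # ys)) \<Longrightarrow> alternating k \<alpha>"
  unfolding alternating_def by blast

lemma alternating_diff:
  fixes \<alpha> \<beta> :: "'a::real_vector form"
  assumes "alternating k \<alpha>" "alternating k \<beta>"
  shows "alternating k (\<lambda>l. \<alpha> l - \<beta> l)"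
proof (rule alternatingI)
  fix xs ys :: "'a list" and a b assume "length xs + length ys + 2 = k"
  from alternating_swap[OF assms(1) this, of a b] alternating_swap[OF assms(2) this, of a b]
  show "\<alpha> (xs @ a # b # ys) - \<beta> (xs @ a # b # ys) = - (\<alpha> (xs @ b # a # ys) - \<beta> (xs @ b # a # ys))" by linarith
qed (intro multilinear_diff alternating_multilinear assms)

lemma alternating_sum:
  fixes \<alpha> :: "'i \<Rightarrow> 'a::real_vector form"
  assumes "\<And>i. i \<in> I \<Longrightarrow> alternating k (\<alpha> i)"
  shows "alternating k (\<lambda>l. \<Sum>i\<in>I. c i * \<alpha> i l)"
proof (rule alternatingI)
  fix xs ys :: "'a list" and a b assume l: "length xs + length ys + 2 = k"
  have "c i * \<alpha> i (xs @ a # b # ys) = - (c i * \<alpha> i (xs @ b # a # ys))" if "i \<in> I" for i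
    unfolding alternating_swap[OF assms[OF that] l, of a b] by simp
  then show "(\<Sum>i\<in>I. c i * \<alpha> i (xs @ a # b # ys)) = - (\<Sum>i\<in>I. c i * \<alpha> i (xs @ b # a # ys))"
    unfolding sum_negf[symmetric] by (rule sum.cong[OF refl])
qed (intro multilinear_sum alternating_multilinear assms)

lemma alternating_cmult: "alternating k \<alpha> \<Longrightarrow> alternating k (\<lambda>l. c * \<alpha> l)"
  using alternating_sum[of "{()}" k "\<lambda>_. \<alpha>" "\<lambda>_. c"] by simp

lemma alternating_append:
  fixes \<alpha> :: "'a::real_vector form"
  assumes "alternating n \<alpha>" "length vs + k = n"
  shows "alternating k (\<lambda>l. \<alpha> (vs @ l))"
proof (rule alternatingI)
  fix xs ys :: "'a list" and a b assume "length xs + length ys + 2 = k"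
  then have "\<alpha> ((vs @ xs) @ a # b # ys) = - \<alpha> ((vs @ xs) @ b # a # ys)"
    using assms(2) by (intro alternating_swap[OF assms(1)]) simp
  then show "\<alpha> (vs @ xs @ a # b # ys) = - \<alpha> (vs @ xs @ b # a # ys)" by simp
qed (intro multilinear_append(2)[OF alternating_multilinear[OF assms(1)] assms(2)])

text \<open>Neighbour swaps bring the head of \<open>xs\<close> to the front of \<open>ys\<close>;
  the tails are handled by induction. The function is arbitrary because the lemma serves both
  absolute values of forms and products of two forms, where the signs cancel.\<close>

lemma swap_invariant_perm:
  assumes "\<And>xs a b ys. length xs + length ys + 2 = k \<Longrightarrow> f (xs @ a # b # ys) = f (xs @ b # a # ys)"
    and "mset xs = mset ys" "length xs = k"
  shows "f xs = f ys"
  using assms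
proof (induction xs arbitrary: ys f k)
  case Nil then show ?case by simp
next
  case (Cons x xs)
  note swap = Cons.prems(1)
  have "x \<in> set ys" using Cons.prems(2) by (metis list.set_intros(1) set_mset_mset)
  then obtain as bs where ys: "ys = as @ x # bs" by (meson split_list)
  have len: "length ys = k" using Cons.prems(2,3) mset_eq_length by metis
  have "f (as @ x # bs) = f (x # as @ bs)" if "length as + length bs + 1 = k" for as bs
    using that
  proof (induction as arbitrary: bs rule: rev_induct)
    case (snoc a as)
    have "f (as @ a # x # bs) = f (as @ x # a # bs)" by (rule swap) (use snoc.prems in simp)
    also have "\<dots> = f (x # as @ a # bs)" by (rule snoc.IH) (use snoc.prems in simp)
    finally show ?case by simp
  qed simp
  then have "f ys = f (x # as @ bs)" using ys len by simp
  also have "\<dots> = f (x # xs)"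
  proof -
    have "f (x # xs) = f (x # (as @ bs))"
    proof (rule Cons.IH[of "k - 1" "\<lambda>l. f (x # l)"])
      show "f (x # us @ a # b # vs) = f (x # us @ b # a # vs)" if "length us + length vs + 2 = k - 1" for us a b vs
        using swap[of "x # us" vs a b] that by simp
    qed (use Cons.prems ys in auto)
    then show ?thesis by simp
  qed
  finally show ?case by simp
qed

text \<open>The absolute value absorbs the sign of the permutation, which is enough wherever only
  vanishing matters.\<close>

lemma alternating_abs_perm:
  fixes \<alpha> :: "'a::real_vector form"
  assumes "alternating k \<alpha>" "mset xs = mset ys" "length xs = k"
  shows "\<bar>\<alpha> xs\<bar> = \<bar>\<alpha> ys\<bar>"
proof (rule swap_invariant_perm[of k "\<lambda>l. \<bar>\<alpha> l\<bar>", OF _ assms(2,3)])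
  fix us vs :: "'a list" and a b assume "length us + length vs + 2 = k"
  from alternating_swap[OF assms(1) this, of a b]
  show "\<bar>\<alpha> (us @ a # b # vs)\<bar> = \<bar>\<alpha> (us @ b # a # vs)\<bar>" by linarith
qed

lemma alternating_not_distinct:
  assumes "alternating k \<alpha>" "length xs = k" "\<not> distinct xs"
  shows "\<alpha> xs = 0"
proof -
  obtain as y bs cs where xs: "xs = as @ [y] @ bs @ [y] @ cs"
    using not_distinct_decomp[OF assms(3)] by blast
  have "\<alpha> ([] @ y # y # (as @ bs @ cs)) = - \<alpha> ([] @ y # y # (as @ bs @ cs))"
    by (rule alternating_swap[OF assms(1)]) (use assms(2) xs in simp)
  then have "\<alpha> (y # y # as @ bs @ cs) = 0" by simp
  moreover have "\<bar>\<alpha> xs\<bar> = \<bar>\<alpha> (y # y # as @ bs @ cs)\<bar>"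
    by (rule alternating_abs_perm[OF assms(1) _ assms(2)]) (simp add: xs)
  ultimately show ?thesis by linarith
qed

lemma multilinear_zero:
  fixes E :: "nat \<Rightarrow> 'e::real_vector"
  assumes "multilinear k \<alpha>" "\<And>v. v = (\<Sum>s<n. c v s *\<^sub>R E s)"
    and "\<And>is. set is \<subseteq> {..<n} \<Longrightarrow> length is = k \<Longrightarrow> \<alpha> (map E is) = 0" and "length vs = k"
  shows "\<alpha> vs = 0"
  using assms(1,3,4)
proof (induction k arbitrary: \<alpha> vs)
  case 0
  then show ?case using 0(2)[of "[]"] by simp
next
  case (Suc k)
  obtain v l where vs: "vs = v # l" "length l = k" using Suc.prems(3) by (cases vs) auto
  show ?case unfolding vs(1)
  proof (rule Suc.IH[of "\<lambda>l. \<alpha> (v # l)"])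
    show "multilinear k (\<lambda>l. \<alpha> (v # l))" using multilinear_Cons Suc.prems(1) by blast
    fix js :: "nat list" assume js: "set js \<subseteq> {..<n}" "length js = k"
    have lin: "linear (\<lambda>v. \<alpha> (v # map E js))"
      using multilinear_Cons_linear[OF Suc.prems(1)] js by simp
    have "\<alpha> (v # map E js) = (\<Sum>s<n. c v s *\<^sub>R \<alpha> (E s # map E js))"
      by (subst assms(2)[of v]) (simp add: linear_sum[OF lin] linear_cmul[OF lin])
    also have "\<dots> = 0" using Suc.prems(2)[of "_ # js"] js by simp
    finally show "\<alpha> (v # map E js) = 0" .
  qed (fact vs)
qed

text \<open>The source of every basis computation below. Sorting the indices changes the difference
  of the two forms at most by a sign, and repeated indices make it vanish, so vanishing on
  increasing lists gives vanishing everywhere.\<close>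

lemma alternating_eqI:
  fixes E :: "nat \<Rightarrow> 'e::real_vector"
  assumes "alternating k \<alpha>" "alternating k \<beta>" "\<And>v. v = (\<Sum>s<n. c v s *\<^sub>R E s)"
    and eq: "\<And>is. set is \<subseteq> {..<n} \<Longrightarrow> length is = k \<Longrightarrow> sorted_wrt (<) is \<Longrightarrow> \<alpha> (map E is) = \<beta> (map E is)"
    and "length vs = k"
  shows "\<alpha> vs = \<beta> vs"
proof -
  let ?d = "\<lambda>l. \<alpha> l - \<beta> l"
  have alt: "alternating k ?d" by (intro alternating_diff assms)
  have "?d vs = 0"
  proof (rule multilinear_zero[OF alternating_multilinear[OF alt] assms(3) _ assms(5)])
    fix js :: "nat list" assume js: "set js \<subseteq> {..<n}" "length js = k"
    show "?d (map E js) = 0"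
    proof (cases "distinct js")
      case True
      then have "sorted_wrt (<) (sort js)" by (simp add: strict_sorted_iff)
      then have "?d (map E (sort js)) = 0" using eq[of "sort js"] js by simp
      moreover have "\<bar>?d (map E js)\<bar> = \<bar>?d (map E (sort js))\<bar>"
        by (rule alternating_abs_perm[OF alt]) (use js in auto)
      ultimately show ?thesis by simp
    next
      case False
      then have "\<not> distinct (map E js)" by (auto simp: distinct_map)
      then show ?thesis using alternating_not_distinct[OF alt] js by simp
    qed
  qed
  then show ?thesis by simp
qed

lemma ldet_alternating:
  fixes \<phi> :: "nat \<Rightarrow> 'e::real_vector \<Rightarrow> real"
  assumes lin: "\<And>i. i < n \<Longrightarrow> linear (\<phi> i)"
  shows "alternating n (\<lambda>vs. ldet n (\<lambda>i j. \<phi> i (vs ! j)))"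
  unfolding alternating_def multilinear_def
proof (intro conjI allI impI)
  fix xs ys :: "'e list" assume len: "length xs + length ys + 1 = n"
  show "linear (\<lambda>v. ldet n (\<lambda>i j. \<phi> i ((xs @ v # ys) ! j)))"
    unfolding ldet_def
  proof (intro linear_compose_sum ballI linear_cmult)
    fix \<sigma> assume "\<sigma> \<in> {\<sigma>. \<sigma> permutes {..<n}}"
    then have s: "\<sigma> permutes {..<n}" by simp
    \<comment> \<open>Only the factor of row \<open>i0\<close> sees the argument in slot
      \<open>length xs\<close>; the remaining factors form a constant, written with 0 in that
      slot.\<close>
    define i0 where "i0 = inv \<sigma> (length xs)"
    have i0: "i0 < n" "\<sigma> i0 = length xs"
      using s len permutes_inv[OF s] permutes_in_image[of "inv \<sigma>" "{..<n}" "length xs"]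
      by (auto simp: i0_def permutes_inverses)
    have ne: "\<sigma> i \<noteq> length xs" if "i \<noteq> i0" for i
      using i0(2) that permutes_inj[OF s] by (metis injD)
    have "(\<Prod>i<n. \<phi> i ((xs @ v # ys) ! \<sigma> i)) =
       (\<Prod>i\<in>{..<n}-{i0}. \<phi> i ((xs @ 0 # ys) ! \<sigma> i)) * \<phi> i0 v" for v
    proof -
      have "(\<Prod>i<n. \<phi> i ((xs @ v # ys) ! \<sigma> i)) =
         \<phi> i0 ((xs @ v # ys) ! \<sigma> i0) * (\<Prod>i\<in>{..<n}-{i0}. \<phi> i ((xs @ v # ys) ! \<sigma> i))"
        using i0 by (intro prod.remove) auto
      also have "(\<Prod>i\<in>{..<n}-{i0}. \<phi> i ((xs @ v # ys) ! \<sigma> i)) = (\<Prod>i\<in>{..<n}-{i0}. \<phi> i ((xs @ 0 # ys) ! \<sigma> i))"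
        using ne by (intro prod.cong) (auto simp: nth_append nth_Cons split: nat.splits)
      finally show ?thesis using i0 by (simp add: nth_append)
    qed
    then show "linear (\<lambda>v. \<Prod>i<n. \<phi> i ((xs @ v # ys) ! \<sigma> i))"
      using linear_cmult[OF lin[OF i0(1)]] by simp
  qed
next
  fix xs ys :: "'e list" and a b assume len: "length xs + length ys + 2 = n"
  \<comment> \<open>Composing each permutation with this transposition exchanges the two slots and
    flips each sign.\<close>
  define p where "p = Transposition.transpose (length xs) (Suc (length xs))"
  have p: "p permutes {..<n}" unfolding p_def using len by (intro permutes_swap_id) auto
  have sp: "sign (p \<circ> \<sigma>) = - sign \<sigma>" if "\<sigma> permutes {..<n}" for \<sigma>
    using that p sign_compose[of p \<sigma>] permutes_imp_permutation[of "{..<n}"]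
    by (simp add: p_def sign_swap_id)
  have nth: "(xs @ a # b # ys) ! p j = (xs @ b # a # ys) ! j" for j
    by (auto simp: p_def Transposition.transpose_def nth_append nth_Cons split: nat.splits)
  show "ldet n (\<lambda>i j. \<phi> i ((xs @ a # b # ys) ! j)) = - ldet n (\<lambda>i j. \<phi> i ((xs @ b # a # ys) ! j))"
    unfolding ldet_def
    by (subst setum_permutations_compose_left[OF p]) (simp add: sp nth sum_negf cong: sum.cong_simp)
qed

lemma ldet_identity: "ldet n (\<lambda>i j. if i = j then 1 else 0) = 1"
proof -
  have "(\<Prod>i<n. if i = \<sigma> i then 1 else 0 :: real) = (if \<sigma> = id then 1 else 0)"
    if "\<sigma> permutes {..<n}" for \<sigma>
  proof (cases "\<sigma> = id")
    case False
    then obtain i where "\<sigma> i \<noteq> i" by (auto simp: fun_eq_iff)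
    moreover from this have "i < n" using that by (auto simp: permutes_def)
    ultimately have "(\<Prod>i<n. if i = \<sigma> i then 1 else 0 :: real) = 0" by (intro prod_zero bexI[of _ i]) auto
    then show ?thesis using False by simp
  qed simp
  then have "ldet n (\<lambda>i j. if i = j then 1 else 0) =
      (\<Sum>\<sigma> | \<sigma> permutes {..<n}. if \<sigma> = id then 1 else 0)"
    unfolding ldet_def by (intro sum.cong) auto
  also have "\<dots> = 1" by (simp add: finite_permutations permutes_id)
  finally show ?thesis .
qed

lemma ldet_transpose: "ldet n (\<lambda>i j. M j i) = ldet n M"
proof -
  have "of_int (sign (inv \<sigma>)) * (\<Prod>i<n. M (inv \<sigma> i) i) = of_int (sign \<sigma>) * (\<Prod>i<n. M i (\<sigma> i))"
    if s: "\<sigma> permutes {..<n}" for \<sigma>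
  proof -
    have "(\<Prod>i<n. M i (\<sigma> i)) = (\<Prod>i<n. M (inv \<sigma> i) i)"
      by (rule prod.reindex_bij_witness[of _ "inv \<sigma>" \<sigma>])
        (use s permutes_in_image[OF permutes_inv[OF s]] permutes_in_image[OF s] in \<open>auto simp: permutes_inverses\<close>)
    moreover have "sign (inv \<sigma>) = sign \<sigma>"
      using s by (simp add: permutes_imp_permutation[of "{..<n}"] sign_inverse)
    ultimately show ?thesis by simp
  qed
  then show ?thesis
    unfolding ldet_def by (subst sum_permutations_inverse) (auto intro: sum.cong)
qed

section \<open>Inner products, orthonormal frames and the volume form\<close>

locale inner_product =
  fixes h :: "'e::euclidean_space \<Rightarrow> 'e \<Rightarrow> real"
  assumes bil: "bilinear h" and sym: "h u v = h v u" and pos: "u \<noteq> 0 \<Longrightarrow> h u u > 0"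
begin

lemma lin: "linear (\<lambda>u. h u v)" "linear (\<lambda>v. h u v)"
  using bil by (auto simp: bilinear_def)

lemmas h_simps = linear_add[OF lin(1)] linear_add[OF lin(2)] linear_cmul[OF lin(1)] linear_cmul[OF lin(2)]
  linear_neg[OF lin(1)] linear_neg[OF lin(2)] linear_diff[OF lin(1)] linear_diff[OF lin(2)]
  linear_0[OF lin(1)] linear_0[OF lin(2)] linear_sum[OF lin(1)] linear_sum[OF lin(2)]

lemma nondegenerate: "(\<And>w. h u w = h v w) \<Longrightarrow> u = v"
  using pos[of "u - v"] by (simp add: h_simps) (metis eq_iff_diff_eq_0 less_irrefl)

lemma frame_nth: "orthonormal_frame h E \<Longrightarrow> i < DIM('e) \<Longrightarrow> j < DIM('e) \<Longrightarrow> h (E i) (E j) = (if i = j then 1 else 0)"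
  by (simp add: orthonormal_frame_def)

lemma frame_expand:
  assumes "orthonormal_frame h E"
  shows "v = (\<Sum>s<DIM('e). h v (E s) *\<^sub>R E s)"
proof -
  let ?n = "DIM('e)"
  note hE = frame_nth[OF assms]
  have inj: "inj_on E {..<?n}"
    by (intro inj_onI) (metis hE lessThan_iff zero_neq_one)
  have coord: "h (\<Sum>s<?n. c s *\<^sub>R E s) (E t) = c t" if "t < ?n" for c t
  proof -
    have "h (\<Sum>s<?n. c s *\<^sub>R E s) (E t) = (\<Sum>s<?n. if s = t then c s else 0)"
      unfolding h_simps by (intro sum.cong) (use that hE in \<open>auto simp: h_simps\<close>)
    then show ?thesis using that by simp
  qed
  have ind: "independent (E ` {..<?n})"
  proof (rule independent_if_scalars_zero)
    fix f x assume 0: "(\<Sum>x\<in>E ` {..<?n}. f x *\<^sub>R x) = 0" and x: "x \<in> E ` {..<?n}"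
    then obtain t where t: "t < ?n" "x = E t" by auto
    have "(\<Sum>s<?n. f (E s) *\<^sub>R E s) = 0" using 0 by (simp add: sum.reindex[OF inj] o_def)
    then show "f x = 0" using coord[OF t(1), of "\<lambda>s. f (E s)"] t(2) by (simp add: h_simps)
  qed simp
  have "UNIV \<subseteq> span (E ` {..<?n})"
    by (rule card_ge_dim_independent[OF _ ind]) (simp_all add: card_image[OF inj])
  then have "v \<in> span (E ` {..<?n})" by blast
  then obtain f where "v = (\<Sum>x\<in>E ` {..<?n}. f x *\<^sub>R x)" by (auto simp: span_finite)
  then have v: "v = (\<Sum>s<?n. f (E s) *\<^sub>R E s)" by (simp add: sum.reindex[OF inj] o_def)
  show ?thesis
    by (subst v, rule sum.cong) (auto simp: v[symmetric] coord[of _ "\<lambda>s. f (E s)", folded v])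
qed

text \<open>The coefficients between two orthonormal frames form an orthogonal matrix
  (\<open>hh\<close>), so the double sum collapses to its diagonal.\<close>

lemma trace_frame:
  assumes E: "orthonormal_frame h E" and E': "orthonormal_frame h E'" and B: "bilinear B"
  shows "(\<Sum>s<DIM('e). B (E s) (E s)) = (\<Sum>s<DIM('e). (B (E' s) (E' s) :: real))"
proof -
  let ?n = "DIM('e)"
  have b: "linear (\<lambda>u. B u v)" "linear (\<lambda>v. B u v)" for u v using B by (auto simp: bilinear_def)
  have hh: "(\<Sum>s<?n. h (E' s) (E t) * h (E' s) (E r)) = (if t = r then 1 else 0)" if "t < ?n" "r < ?n" for t r
  proof -
    have "h (E t) (E r) = (\<Sum>s<?n. h (E t) (E' s) * h (E' s) (E r))"
      by (subst frame_expand[OF E', of "E t"]) (simp add: h_simps)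
    then show ?thesis using frame_nth[OF E that] by (simp add: sym)
  qed
  have "(\<Sum>s<?n. B (E' s) (E' s)) = (\<Sum>s<?n. \<Sum>t<?n. \<Sum>r<?n. h (E' s) (E t) * h (E' s) (E r) * B (E t) (E r))"
  proof (rule sum.cong[OF refl])
    fix s
    have "B (E' s) (E' s) = B (\<Sum>t<?n. h (E' s) (E t) *\<^sub>R E t) (\<Sum>r<?n. h (E' s) (E r) *\<^sub>R E r)"
      using frame_expand[OF E, of "E' s"] by simp
    also have "\<dots> = (\<Sum>t<?n. \<Sum>r<?n. h (E' s) (E t) * h (E' s) (E r) * B (E t) (E r))"
      by (simp add: linear_sum[OF b(1)] linear_sum[OF b(2)] linear_cmul[OF b(1)] linear_cmul[OF b(2)]
          sum_distrib_left mult_ac) (subst sum.swap, simp add: mult_ac)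
    finally show "B (E' s) (E' s) = \<dots>" .
  qed
  also have "\<dots> = (\<Sum>t<?n. \<Sum>r<?n. (\<Sum>s<?n. h (E' s) (E t) * h (E' s) (E r)) * B (E t) (E r))"
    by (subst sum.swap, rule sum.cong[OF refl], subst sum.swap) (simp add: sum_distrib_right)
  also have "\<dots> = (\<Sum>t<?n. \<Sum>r<?n. (if t = r then 1 else 0) * B (E t) (E r))"
    by (intro sum.cong refl) (simp add: hh)
  also have "\<dots> = (\<Sum>t<?n. \<Sum>r<?n. (if t = r then B (E t) (E r) else 0))"
    by (intro sum.cong refl) simp
  also have "\<dots> = (\<Sum>t<?n. B (E t) (E t))" by simp
  finally show ?thesis by simp
qed

lemma some_frame: "orthonormal_frame h E \<Longrightarrow> orthonormal_frame h (some_frame h)"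
  unfolding some_frame_def by (rule someI[of "orthonormal_frame h"])

lemma metric_trace_frame:
  "orthonormal_frame h E \<Longrightarrow> bilinear B \<Longrightarrow> metric_trace h B = (\<Sum>s<DIM('e). B (E s) (E s))"
  unfolding metric_trace_def using trace_frame some_frame by blast

lemma sum_lists_Suc:
  "(\<Sum>is | set is \<subseteq> {..<n} \<and> length is = Suc k. f is) =
   (\<Sum>s<n. \<Sum>is | set is \<subseteq> {..<n::nat} \<and> length is = k. (f (s # is) :: real))"
  unfolding sum.cartesian_product
  by (rule sum.reindex_bij_witness[of _ "\<lambda>(s, l). s # l" "\<lambda>l. (hd l, tl l)"])
    (auto simp: length_Suc_conv)

text \<open>\<open>trace_frame\<close> one slot at a time: the tail changes its frame by induction
  with the head fixed, then the head with the tail fixed. This frees \<open>hodge\<close> from the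
  arbitrary \<open>some_frame\<close>.\<close>

lemma list_trace_frame:
  assumes E: "orthonormal_frame h E" and E': "orthonormal_frame h E'"
  shows "multilinear k \<alpha> \<Longrightarrow> multilinear k \<beta> \<Longrightarrow>
   (\<Sum>is | set is \<subseteq> {..<DIM('e)} \<and> length is = k. \<alpha> (map E is) * \<beta> (map E is)) =
   (\<Sum>is | set is \<subseteq> {..<DIM('e)} \<and> length is = k. \<alpha> (map E' is) * \<beta> (map E' is))"
proof (induction k arbitrary: \<alpha> \<beta>)
  case 0
  show ?case by (rule sum.cong) auto
next
  case (Suc k)
  let ?n = "DIM('e)" and ?L = "{is. set is \<subseteq> {..<DIM('e)} \<and> length is = k}"
  have "(\<Sum>s<?n. \<Sum>is\<in>?L. \<alpha> (E s # map E is) * \<beta> (E s # map E is)) =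
     (\<Sum>s<?n. \<Sum>is\<in>?L. \<alpha> (E s # map E' is) * \<beta> (E s # map E' is))"
    by (intro sum.cong refl Suc.IH[of "\<lambda>l. \<alpha> (E _ # l)" "\<lambda>l. \<beta> (E _ # l)"] multilinear_Cons Suc.prems)
  also have "\<dots> = (\<Sum>is\<in>?L. \<Sum>s<?n. \<alpha> (E s # map E' is) * \<beta> (E s # map E' is))"
    by (rule sum.swap)
  also have "\<dots> = (\<Sum>is\<in>?L. \<Sum>s<?n. \<alpha> (E' s # map E' is) * \<beta> (E' s # map E' is))"
  proof (rule sum.cong[OF refl])
    fix js :: "nat list" assume js: "js \<in> ?L"
    have l: "linear (\<lambda>v. \<alpha> (v # map E' js))" "linear (\<lambda>v. \<beta> (v # map E' js))"
      using js by (auto intro!: multilinear_Cons_linear Suc.prems)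
    have "bilinear (\<lambda>u v. \<alpha> (u # map E' js) * \<beta> (v # map E' js))"
      unfolding bilinear_def
      by (intro conjI allI linearI)
        (simp_all add: linear_add[OF l(1)] linear_add[OF l(2)] linear_cmul[OF l(1)] linear_cmul[OF l(2)] algebra_simps)
    from trace_frame[OF E E' this]
    show "(\<Sum>s<?n. \<alpha> (E s # map E' js) * \<beta> (E s # map E' js)) =
      (\<Sum>s<?n. \<alpha> (E' s # map E' js) * \<beta> (E' s # map E' js))" .
  qed
  also have "\<dots> = (\<Sum>s<?n. \<Sum>is\<in>?L. \<alpha> (E' s # map E' is) * \<beta> (E' s # map E' is))"
    by (rule sum.swap)
  finally show ?case by (simp add: sum_lists_Suc)
qed

lemma volume_alternating: "alternating DIM('e) (volume_form h)"
proof -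
  have "alternating DIM('e) (\<lambda>vs. ldet DIM('e) (\<lambda>i j. coord_frame i \<bullet> (vs ! j)))"
    by (rule ldet_alternating) (simp add: linear_iff inner_add_right)
  from alternating_cmult[OF this] show ?thesis unfolding volume_form_def[abs_def] .
qed

lemma coord_frame_bij: "bij_betw (coord_frame :: nat \<Rightarrow> 'e) {..<DIM('e)} Basis"
proof -
  obtain b where "bij_betw b {..<DIM('e)} (Basis :: 'e set)"
    using ex_bij_betw_nat_finite[of "Basis :: 'e set"] by (auto simp: atLeast0LessThan)
  then show ?thesis unfolding coord_frame_def by (rule someI[of "\<lambda>b. bij_betw b _ _"])
qed

lemma sorted_full_list:
  assumes "set is \<subseteq> {..<n}" "length is = n" "sorted_wrt (<) is"
  shows "is = [0..<n]"
proof -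
  have d: "distinct is" "sorted is" using assms(3) by (auto simp: strict_sorted_iff)
  then have "card (set is) = n" using assms(2) distinct_card by metis
  then have "set is = {..<n}" using assms(1) by (intro card_subset_eq) auto
  then show ?thesis using d by (intro sorted_distinct_set_unique) (auto simp: atLeast0LessThan)
qed

text \<open>Forms of top degree are determined by one value, because the only increasing index list
  of full length is \<open>[0..<DIM('e)]\<close>.\<close>

lemma top_form_ldet:
  assumes E: "orthonormal_frame h E" and \<omega>: "alternating DIM('e) \<omega>" and "length vs = DIM('e)"
  shows "\<omega> vs = ldet DIM('e) (\<lambda>i j. h (E i) (vs ! j)) * \<omega> (map E [0..<DIM('e)])"
proof -
  let ?\<beta> = "\<lambda>vs. \<omega> (map E [0..<DIM('e)]) * ldet DIM('e) (\<lambda>i j. h (E i) (vs ! j))"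
  have "\<omega> vs = ?\<beta> vs"
  proof (rule alternating_eqI[OF \<omega> _ frame_expand[OF E] _ assms(3)])
    show "alternating DIM('e) ?\<beta>"
      by (intro alternating_cmult ldet_alternating lin)
    fix js :: "nat list" assume "set js \<subseteq> {..<DIM('e)}" "length js = DIM('e)" "sorted_wrt (<) js"
    then have js: "js = [0..<DIM('e)]" by (rule sorted_full_list)
    have "ldet DIM('e) (\<lambda>i j. h (E i) (map E js ! j)) = ldet DIM('e) (\<lambda>i j. if i = j then 1 else 0)"
      unfolding ldet_def js using permutes_in_image[of _ "{..<DIM('e)}"]
      by (intro sum.cong refl arg_cong2[where f = "(*)"] prod.cong) (auto simp: frame_nth[OF E])
    then show "\<omega> (map E js) = ?\<beta> (map E js)" by (simp add: ldet_identity js)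
  qed
  then show ?thesis by simp
qed

text \<open>The square appears because the frame may have either orientation. With \<open>?D\<close>
  the determinant of the coordinate frame relative to \<open>E\<close>, \<open>top_form_ldet\<close>
  gives \<open>?D * ?w ?Es = 1\<close> for the coordinate determinant and
  \<open>?H = ?D * ?D\<close> for the Gram determinant, so the root in \<open>volume_form\<close> is
  \<open>\<bar>?D\<bar>\<close>.\<close>

lemma volume_frame:
  assumes E: "orthonormal_frame h E"
  shows "(volume_form h (map E [0..<DIM('e)]))\<^sup>2 = 1"
proof -
  let ?n = "DIM('e)" and ?c = "coord_frame :: nat \<Rightarrow> 'e"
  let ?cs = "map ?c [0..<?n]" and ?Es = "map E [0..<?n]"
  let ?H = "ldet ?n (\<lambda>i j. h (?c i) (?c j))" and ?D = "ldet ?n (\<lambda>i j. h (E i) (?c j))"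
  let ?w = "\<lambda>vs. ldet ?n (\<lambda>i j. ?c i \<bullet> (vs ! j))"
  have inj: "inj_on ?c {..<?n}" and cB: "i < ?n \<Longrightarrow> ?c i \<in> Basis" for i
    using coord_frame_bij by (auto simp: bij_betw_def)
  have walt: "alternating ?n ?w"
    by (rule ldet_alternating) (simp add: linear_iff inner_add_right)
  have halt: "alternating ?n (\<lambda>vs. ldet ?n (\<lambda>i j. h (?c i) (vs ! j)))"
    by (rule ldet_alternating) (rule lin)
  have nth: "ldet ?n (\<lambda>i j. f i (map g [0..<?n] ! j)) = ldet ?n (\<lambda>i j. f i (g j))" for f :: "nat \<Rightarrow> 'e \<Rightarrow> real" and g
    unfolding ldet_def using permutes_in_image[of _ "{..<DIM('e)}"]
    by (intro sum.cong refl arg_cong2[where f = "(*)"] prod.cong) auto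
  have "?w ?cs = ldet ?n (\<lambda>i j. if i = j then 1 else 0)"
    unfolding nth unfolding ldet_def using permutes_in_image[of _ "{..<DIM('e)}"]
    by (intro sum.cong refl arg_cong2[where f = "(*)"] prod.cong)
      (auto simp: inner_Basis cB dest: inj_onD[OF inj])
  then have "?w ?cs = 1" by (simp add: ldet_identity)
  moreover have "?w ?cs = ?D * ?w ?Es"
    using top_form_ldet[OF E walt, of ?cs] nth[of "\<lambda>i. h (E i)" ?c] by simp
  ultimately have 1: "?D * ?w ?Es = 1" by simp
  have "?H = ?D * ldet ?n (\<lambda>i j. h (?c i) (E j))"
    using top_form_ldet[OF E halt, of ?cs] nth[of "\<lambda>i. h (E i)" ?c]
      nth[of "\<lambda>i. h (?c i)" ?c] nth[of "\<lambda>i. h (?c i)" E] by simp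
  also have "ldet ?n (\<lambda>i j. h (?c i) (E j)) = ?D"
    by (subst ldet_transpose[symmetric]) (simp add: sym)
  finally have "?H = ?D * ?D" .
  then have "sqrt ?H = \<bar>?D\<bar>" by simp
  then have "(volume_form h ?Es)\<^sup>2 = (?D * ?w ?Es)\<^sup>2"
    unfolding volume_form_def by (simp add: power_mult_distrib)
  then show ?thesis by (simp add: 1)
qed

end

section \<open>The Hodge star on orthonormal frames, and the dual vector\<close>

context inner_product begin

text \<open>After passing to the frame \<open>E\<close>, a list contributes only if it permutes
  \<open>{..<k}\<close>: otherwise an index is repeated, either in the list or in the remaining
  arguments. All k! surviving terms agree, as \<open>\<alpha>\<close> and the volume form change
  sign together, and this cancels \<open>fact k\<close>.\<close>

lemma hodge_frame:
  assumes E: "orthonormal_frame h E" and \<alpha>: "alternating k \<alpha>" and k: "k \<le> DIM('e)"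
  shows "hodge k h \<alpha> (map E [k..<DIM('e)]) = volume_form h (map E [0..<DIM('e)]) * \<alpha> (map E [0..<k])"
proof -
  let ?n = "DIM('e)" and ?V = "volume_form h" and ?F = "some_frame h" and ?r = "map E [k..<DIM('e)]"
  let ?L = "{is. set is \<subseteq> {..<?n} \<and> length is = k}"
  note vm = alternating_multilinear[OF volume_alternating]
  have finL: "finite ?L" by (rule finite_lists_length_eq) simp
  have "length ?r + k = ?n" using k by simp
  note vr = multilinear_append(1)[OF vm this]
  have "(\<Sum>is\<in>?L. \<alpha> (map ?F is) * ?V (map ?F is @ ?r)) = (\<Sum>is\<in>?L. \<alpha> (map E is) * ?V (map E is @ ?r))"
    by (rule list_trace_frame[OF some_frame[OF E] E alternating_multilinear[OF \<alpha>] vr])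
  also have "\<dots> = (\<Sum>is\<in>permutations_of_set {..<k}. \<alpha> (map E is) * ?V (map E is @ ?r))"
  proof (rule sum.mono_neutral_right[OF finL])
    show "permutations_of_set {..<k} \<subseteq> ?L"
      using k length_finite_permutations_of_set[of _ "{..<k}"] permutations_of_setD[of _ "{..<k}"] by fastforce
    show "\<forall>js\<in>?L - permutations_of_set {..<k}. \<alpha> (map E js) * ?V (map E js @ ?r) = 0"
    proof
      fix js assume js: "js \<in> ?L - permutations_of_set {..<k}"
      show "\<alpha> (map E js) * ?V (map E js @ ?r) = 0"
      proof (cases "distinct js")
        case False
        then have "\<not> distinct (map E js)" by (auto simp: distinct_map)
        then show ?thesis using alternating_not_distinct[OF \<alpha>] js by simp
      next
        case True
        have "\<not> set js \<subseteq> {..<k}"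
        proof
          assume "set js \<subseteq> {..<k}"
          moreover have "card (set js) = k" using True js distinct_card by auto
          ultimately have "set js = {..<k}" by (intro card_subset_eq) auto
          then show False using js True by (auto simp: permutations_of_set_def)
        qed
        then obtain i where "i \<in> set js" "i \<in> set [k..<?n]" using js by force
        then have "E i \<in> set (map E js) \<inter> set ?r" by auto
        then have "\<not> distinct (map E js @ ?r)" unfolding distinct_append by blast
        then show ?thesis using alternating_not_distinct[OF volume_alternating] js k by simp
      qed
    qed
  qed
  also have "\<dots> = (\<Sum>is\<in>permutations_of_set {..<k}. \<alpha> (map E [0..<k]) * ?V (map E [0..<k] @ ?r))"
  proof (rule sum.cong[OF refl])
    fix js assume js: "js \<in> permutations_of_set {..<k}"
    have "mset (map E js) = mset (map E [0..<k])"
    proof -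
      have "mset js = mset [0..<k]"
        using js mset_set_set[of js] by (auto simp: permutations_of_set_def atLeast0LessThan)
      then show ?thesis by simp
    qed
    then show "\<alpha> (map E js) * ?V (map E js @ ?r) = \<alpha> (map E [0..<k]) * ?V (map E [0..<k] @ ?r)"
    proof (rule swap_invariant_perm[of k "\<lambda>l. \<alpha> l * ?V (l @ ?r)", rotated])
      show "length (map E js) = k"
        using js length_finite_permutations_of_set[of js "{..<k}"] by simp
      fix xs ys :: "'e list" and a b assume l: "length xs + length ys + 2 = k"
      have "?V ((xs @ a # b # ys) @ ?r) = - ?V ((xs @ b # a # ys) @ ?r)"
        unfolding append_assoc append_Cons
        by (rule alternating_swap[OF volume_alternating]) (use l k in simp)
      moreover have "\<alpha> (xs @ a # b # ys) = - \<alpha> (xs @ b # a # ys)" by (rule alternating_swap[OF \<alpha> l])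
      ultimately show "\<alpha> (xs @ a # b # ys) * ?V ((xs @ a # b # ys) @ ?r) = \<alpha> (xs @ b # a # ys) * ?V ((xs @ b # a # ys) @ ?r)"
        by (metis minus_mult_minus)
    qed
  qed
  also have "\<dots> = fact k * (\<alpha> (map E [0..<k]) * ?V (map E [0..<?n]))"
  proof -
    have "[0..<k] @ [k..<?n] = [0..<?n]" using k upt_add_eq_append[of 0 k "?n - k"] by simp
    then have "map E [0..<k] @ ?r = map E [0..<?n]" by (metis map_append)
    then show ?thesis by simp
  qed
  finally show ?thesis unfolding hodge_def by simp
qed

text \<open>A reordered orthonormal frame is orthonormal, which gives the dual on every choice of
  complementary frame vectors.\<close>

lemma hodge_frame_perm:
  assumes E: "orthonormal_frame h E" and \<alpha>: "alternating k \<alpha>" and k: "k \<le> DIM('e)"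
    and js: "distinct js" "set js = {..<DIM('e)}"
  shows "hodge k h \<alpha> (map E (drop k js)) = volume_form h (map E js) * \<alpha> (map E (take k js))"
proof -
  have len: "length js = DIM('e)" using js distinct_card by fastforce
  have o: "orthonormal_frame h (\<lambda>i. E (js ! i))"
    unfolding orthonormal_frame_def
  proof (intro allI impI)
    fix i j assume ij: "i < DIM('e)" "j < DIM('e)"
    have "js ! i < DIM('e)" "js ! j < DIM('e)" using js(2) ij len nth_mem[of _ js] by auto
    then show "h (E (js ! i)) (E (js ! j)) = (if i = j then 1 else 0)"
      using frame_nth[OF E] nth_eq_iff_index_eq[OF js(1)] ij len by simp
  qed
  have "map (\<lambda>i. E (js ! i)) [k..<DIM('e)] = map E (drop k js)"
    using len by (intro nth_equalityI) auto
  moreover have "map (\<lambda>i. E (js ! i)) [0..<k] = map E (take k js)"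
    using len k by (intro nth_equalityI) auto
  moreover have "map (\<lambda>i. E (js ! i)) [0..<DIM('e)] = map E js"
    using len by (intro nth_equalityI) auto
  ultimately show ?thesis using hodge_frame[OF o \<alpha> k] by (simp only:)
qed

lemma hodge_alternating:
  assumes "k \<le> DIM('e)"
  shows "alternating (DIM('e) - k) (hodge k h \<alpha>)"
proof -
  have "alternating (DIM('e) - k) (\<lambda>vs. (1 / fact k) *
    (\<Sum>is | set is \<subseteq> {..<DIM('e)} \<and> length is = k. \<alpha> (map (some_frame h) is) * volume_form h (map (some_frame h) is @ vs)))"
    by (rule alternating_cmult, rule alternating_sum, rule alternating_append[OF volume_alternating])
      (use assms in auto)
  moreover have "hodge k h \<alpha> = (\<lambda>vs. (1 / fact k) *
    (\<Sum>is | set is \<subseteq> {..<DIM('e)} \<and> length is = k. \<alpha> (map (some_frame h) is) * volume_form h (map (some_frame h) is @ vs)))"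
    by (simp add: hodge_def fun_eq_iff)
  ultimately show ?thesis by simp
qed

lemma sharp_ex1:
  assumes E: "orthonormal_frame h E" and \<phi>: "linear (\<lambda>w. \<alpha> [w])"
  shows "\<exists>!v. \<forall>w. h v w = \<alpha> [w]"
proof
  let ?v = "\<Sum>s<DIM('e). \<alpha> [E s] *\<^sub>R E s"
  show "\<forall>w. h ?v w = \<alpha> [w]"
  proof
    fix w
    have "\<alpha> [w] = (\<Sum>s<DIM('e). h w (E s) * \<alpha> [E s])"
      by (subst frame_expand[OF E, of w]) (simp add: linear_sum[OF \<phi>] linear_cmul[OF \<phi>])
    then show "h ?v w = \<alpha> [w]" by (simp add: h_simps sym mult.commute)
  qed
  show "v = ?v" if "\<forall>w. h v w = \<alpha> [w]" for v
    using that \<open>\<forall>w. h ?v w = \<alpha> [w]\<close> by (intro nondegenerate) simp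
qed

lemma h_sharp:
  assumes E: "orthonormal_frame h E" and \<phi>: "linear (\<lambda>w. \<alpha> [w])"
  shows "h (sharp h \<alpha>) w = \<alpha> [w]"
  using theI'[OF sharp_ex1[OF assms]] unfolding sharp_def by blast

end

section \<open>Quaternionic linear algebra in dimension 8\<close>

lemma wedge12:
  assumes "\<And>u v. F [u, v] = - F [v, u]"
  shows "wedge 1 2 \<alpha> F [X, Y, Z] = \<alpha> [X] * F [Y, Z] - \<alpha> [Y] * F [X, Z] + \<alpha> [Z] * F [X, Y]"
proof -
  have 3: "{..<1 + 2} = {0, 1, 2 :: nat}" by auto
  have l: "[0..<1] = [0]" "[1..<1+2] = [1, 2 :: nat]" by (simp_all add: upt_rec)
  show ?thesis
    unfolding wedge_def 3 l
    by (simp add: sum_over_permutations_insert sign_compose permutation_compose permutation_swap_id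
        sign_swap_id Transposition.transpose_def assms[of Z Y] assms[of Z X] assms[of Y X] field_simps fact_numeral)
qed

text \<open>The 24 permutations form three classes of eight equal terms; the factor 1/4 in
  \<open>wedge\<close> and the 1/2 from \<Phi> remove this multiplicity.\<close>

lemma wedge22:
  assumes "\<And>u v. F [u, v] = - F [v, u]"
  shows "wedge 2 2 F F [X, Y, Z, W] / 2 = F [X, Y] * F [Z, W] - F [X, Z] * F [Y, W] + F [X, W] * F [Y, Z]"
proof -
  have 4: "{..<2 + 2} = {0, 1, 2, 3 :: nat}" by auto
  have l: "[0..<2] = [0, 1]" "[2..<2+2] = [2, 3 :: nat]" by (simp_all add: upt_rec)
  show ?thesis
    unfolding wedge_def 4 l
    by (simp add: sum_over_permutations_insert sign_compose permutation_compose permutation_swap_id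
        sign_swap_id Transposition.transpose_def assms[of Z Y] assms[of Z X] assms[of Y X]
        assms[of W X] assms[of W Y] assms[of W Z] field_simps fact_numeral)
qed

lemma all_less_8: "(\<forall>i<8::nat. P i) \<longleftrightarrow> P 0 \<and> P 1 \<and> P 2 \<and> P 3 \<and> P 4 \<and> P 5 \<and> P 6 \<and> P 7"
  by (simp add: eval_nat_numeral All_less_Suc conj_ac)

section \<open>Quaternionic structures on an 8-dimensional space and adapted frames\<close>

locale quaternionic = inner_product h for h :: "real^8 \<Rightarrow> real^8 \<Rightarrow> real" +
  fixes I J K :: "real^8 \<Rightarrow> real^8"
  assumes linI: "linear I" and linJ: "linear J"
    and II: "I (I u) = - u" and JJ: "J (J u) = - u" and IJ: "I (J u) = K u" and JI: "J (I u) = - K u"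
    and hII: "h (I u) (I v) = h u v" and hJJ: "h (J u) (J v) = h u v"
begin

lemma linK: "linear K"
  using linear_compose[OF linJ linI] by (simp add: o_def IJ)

lemmas IJK_simps = linear_add[OF linI] linear_cmul[OF linI] linear_neg[OF linI] linear_diff[OF linI] linear_0[OF linI]
  linear_add[OF linJ] linear_cmul[OF linJ] linear_neg[OF linJ] linear_diff[OF linJ] linear_0[OF linJ]
  linear_add[OF linK] linear_cmul[OF linK] linear_neg[OF linK] linear_diff[OF linK] linear_0[OF linK]

lemma mult: "K (K u) = - u" "J (K u) = I u" "K (I u) = J u" "K (J u) = - I u" "I (K u) = - J u"
  using IJ[of u] JI[of u] JJ[of "I u"] II[of "J u"] JJ[of u] II[of u] IJ[of "J u"] JI[of "J u"] IJ[of "I u"]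
    IJ[of "K u"] JI[of "K u"]
  by (simp_all add: IJK_simps) (metis IJ JI II JJ minus_minus linear_neg[OF linI] linear_neg[OF linJ])+

lemmas quat = II JJ IJ JI mult

lemma hKK: "h (K u) (K v) = h u v"
  unfolding IJ[symmetric] hII hJJ ..

lemma h_skew: "h (I u) v = - h u (I v)" "h (J u) v = - h u (J v)" "h (K u) v = - h u (K v)"
  using hII[of u "I v"] hJJ[of u "J v"] hKK[of u "K v"] by (simp_all add: quat h_simps)

lemma h_self: "h u (I u) = 0" "h u (J u) = 0" "h u (K u) = 0"
  using h_skew[of u u] sym[of u "I u"] sym[of u "J u"] sym[of u "K u"] by auto

text \<open>Most of what follows singles out \<open>I\<close>; rotating the triple carries it over
  to \<open>J\<close> and \<open>K\<close>.\<close>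

lemma cyclic: "quaternionic h J K I"
  by unfold_locales (simp_all add: quat hJJ hKK IJK_simps)

text \<open>In this order \<open>I\<close> maps each vector of even index to its successor, which
  puts \<open>F\<close> into standard block form (\<open>F_E\<close>).\<close>

definition qframe :: "real^8 \<Rightarrow> real^8 \<Rightarrow> nat \<Rightarrow> real^8" where
  "qframe e f i = [e, I e, J e, K e, f, I f, J f, K f] ! i"

definition adapted :: "real^8 \<Rightarrow> real^8 \<Rightarrow> bool" where
  "adapted e f \<longleftrightarrow> h e e = 1 \<and> h f f = 1 \<and> h f e = 0 \<and> h f (I e) = 0 \<and> h f (J e) = 0 \<and> h f (K e) = 0"

lemma adapted_frame:
  assumes "adapted e f"
  shows "orthonormal_frame h (qframe e f)"
proof -
  note a = assms[unfolded adapted_def]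
  have b: "h e f = 0" "h e (I f) = 0" "h e (J f) = 0" "h e (K f) = 0"
    using a h_skew[of f e] sym[of e f] sym[of e "I f"] sym[of e "J f"] sym[of e "K f"] by auto
  show ?thesis
    unfolding orthonormal_frame_def
    by (simp add: all_less_8 qframe_def h_skew quat h_simps h_self a b)
qed

definition normalize_vec :: "real^8 \<Rightarrow> real^8" where
  "normalize_vec v = (1 / sqrt (h v v)) *\<^sub>R v"

text \<open>Gram-Schmidt is given by formulas, rather than by mere existence, because in a chart the
  frame will have to depend continuously on the point.\<close>

definition project_off :: "real^8 \<Rightarrow> real^8 \<Rightarrow> real^8" where
  "project_off e w = w - h w e *\<^sub>R e - h w (I e) *\<^sub>R I e - h w (J e) *\<^sub>R J e - h w (K e) *\<^sub>R K e"

lemma h_normalize_vec: "v \<noteq> 0 \<Longrightarrow> h (normalize_vec v) (normalize_vec v) = 1"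
  using pos[of v] by (simp add: normalize_vec_def h_simps)

lemma adapted_gram_schmidt:
  assumes "h e e = 1" "project_off e w \<noteq> 0"
  shows "adapted e (normalize_vec (project_off e w))"
proof -
  have "h (project_off e w) x = 0" if "x \<in> {e, I e, J e, K e}" for x
    using that assms(1) by (auto simp: project_off_def h_simps h_skew quat h_self)
  then show ?thesis
    using h_normalize_vec[OF assms(2)] assms(1) unfolding adapted_def
    by (simp add: normalize_vec_def h_simps)
qed

lemma adapted_exists: "\<exists>e f. adapted e f"
proof -
  obtain b :: "real^8" where "b \<in> Basis" using nonempty_Basis by blast
  then have "b \<noteq> 0" by (rule nonzero_Basis)
  define e where "e = normalize_vec b"
  have e: "h e e = 1" using h_normalize_vec[OF \<open>b \<noteq> 0\<close>] by (simp add: e_def)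
  \<comment> \<open>The quaternionic line through \<open>e\<close> has real dimension at most 4, so
    it leaves room for a second vector.\<close>
  have "card {e, I e, J e, K e} \<le> 4" by (simp add: card_insert_if)
  then have "dim {e, I e, J e, K e} \<le> 4" using dim_le_card'[of "{e, I e, J e, K e}"] by simp
  then have "span {e, I e, J e, K e} \<noteq> UNIV" using dim_eq_full[of "{e, I e, J e, K e}"] by auto
  then obtain w where w: "w \<notin> span {e, I e, J e, K e}" by blast
  have "project_off e w \<noteq> 0"
  proof
    assume "project_off e w = 0"
    then have "w = h w e *\<^sub>R e + h w (I e) *\<^sub>R I e + h w (J e) *\<^sub>R J e + h w (K e) *\<^sub>R K e"
      by (simp add: project_off_def algebra_simps)
    also have "\<dots> \<in> span {e, I e, J e, K e}"
      by (intro span_add span_scale span_base) auto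
    finally show False using w by blast
  qed
  with e adapted_gram_schmidt show ?thesis by blast
qed

definition F :: "(real^8) form" where "F vs = h (vs ! 0) (I (vs ! 1))"

lemma F_skew: "F [u, v] = - F [v, u]"
  by (simp add: F_def h_skew(1)[symmetric] sym)

lemma F_linear: "linear (\<lambda>u. F [u, v])" "linear (\<lambda>v. F [u, v])"
  using lin(1) linear_compose[OF linI lin(2)] by (simp_all add: F_def o_def)

text \<open>This is F \<and> F / 2 as expanded in \<open>wedge22\<close>, so that basis computations
  involve no sum over permutations.\<close>

definition Phi :: "(real^8) form" where
  "Phi vs = F [vs ! 0, vs ! 1] * F [vs ! 2, vs ! 3] - F [vs ! 0, vs ! 2] * F [vs ! 1, vs ! 3]
     + F [vs ! 0, vs ! 3] * F [vs ! 1, vs ! 2]"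

text \<open>\<open>F_wedge d\<close> is \<open>F \<and> d\<close> for a 3-form \<open>d\<close>; for \<open>d = dF\<close> it is the exterior derivative of \<open>\<Phi>\<close>.\<close>

definition F_wedge :: "(real^8) form \<Rightarrow> (real^8) form" where
  "F_wedge d vs = F [vs!0, vs!1] * d [vs!2, vs!3, vs!4] - F [vs!0, vs!2] * d [vs!1, vs!3, vs!4]
     + F [vs!0, vs!3] * d [vs!1, vs!2, vs!4] - F [vs!0, vs!4] * d [vs!1, vs!2, vs!3]
     + F [vs!1, vs!2] * d [vs!0, vs!3, vs!4] - F [vs!1, vs!3] * d [vs!0, vs!2, vs!4]
     + F [vs!1, vs!4] * d [vs!0, vs!2, vs!3] + F [vs!2, vs!3] * d [vs!0, vs!1, vs!4]
     - F [vs!2, vs!4] * d [vs!0, vs!1, vs!3] + F [vs!3, vs!4] * d [vs!0, vs!1, vs!2]"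

end

section \<open>Alternating forms of degree three, four and five\<close>

text \<open>Fixing the first argument lowers the degree by one, so a concrete form requires only the
  swap of its first two arguments at each level.\<close>

lemma alternating_SucI:
  fixes \<alpha> :: "'a::real_vector form"
  assumes tl: "\<And>v. alternating k (\<lambda>l. \<alpha> (v # l))"
    and lin: "\<And>l. length l = k \<Longrightarrow> linear (\<lambda>v. \<alpha> (v # l))"
    and swap: "\<And>a b l. Suc (length l) = k \<Longrightarrow> \<alpha> (a # b # l) = - \<alpha> (b # a # l)"
  shows "alternating (Suc k) \<alpha>"
proof (rule alternatingI)
  show "multilinear (Suc k) \<alpha>"
    unfolding multilinear_def
  proof (intro allI impI)
    fix xs ys :: "'a list" assume l: "length xs + length ys + 1 = Suc k"
    show "linear (\<lambda>v. \<alpha> (xs @ v # ys))"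
    proof (cases xs)
      case Nil then show ?thesis using lin[of ys] l by simp
    next
      case (Cons x xs')
      then have "length xs' + length ys + 1 = k" using l by simp
      from multilinearD[OF alternating_multilinear[OF tl[of x]] this] show ?thesis by (simp add: Cons)
    qed
  qed
  fix xs ys :: "'a list" and a b assume l: "length xs + length ys + 2 = Suc k"
  show "\<alpha> (xs @ a # b # ys) = - \<alpha> (xs @ b # a # ys)"
  proof (cases xs)
    case Nil then show ?thesis using swap[of ys a b] l by simp
  next
    case (Cons x xs')
    then have "length xs' + length ys + 2 = k" using l by simp
    from alternating_swap[OF tl[of x] this, of a b] show ?thesis by (simp add: Cons)
  qed
qed

lemma alternating_0: "alternating 0 \<alpha>"
  by (simp add: alternating_def multilinear_def)

lemma alternating_3I:
  assumes "\<And>b c. linear (\<lambda>v. \<alpha> [v, b, c])" "\<And>a b c. \<alpha> [a, b, c] = - \<alpha> [b, a, c]"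
    "\<And>a b c. \<alpha> [a, b, c] = - \<alpha> [a, c, b]"
  shows "alternating 3 \<alpha>"
proof -
  have l2: "linear (\<lambda>v. \<alpha> [a, v, c])" for a c
    unfolding assms(2)[of a] by (intro linear_compose_neg assms(1))
  have l3: "linear (\<lambda>v. \<alpha> [a, b, v])" for a b
    unfolding assms(3)[of a b] by (intro linear_compose_neg l2)
  show ?thesis
    unfolding numeral_3_eq_3
    by (intro alternating_SucI alternating_0) (auto simp: length_Suc_conv intro: assms l2 l3)
qed

lemma alternating_3_simps:
  assumes "alternating 3 \<alpha>"
  shows "\<alpha> [u + v, b, c] = \<alpha> [u, b, c] + \<alpha> [v, b, c]" "\<alpha> [a, u + v, c] = \<alpha> [a, u, c] + \<alpha> [a, v, c]"
    "\<alpha> [a, b, u + v] = \<alpha> [a, b, u] + \<alpha> [a, b, v]"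
    "\<alpha> [r *\<^sub>R u, b, c] = r * \<alpha> [u, b, c]" "\<alpha> [a, r *\<^sub>R u, c] = r * \<alpha> [a, u, c]"
    "\<alpha> [a, b, r *\<^sub>R u] = r * \<alpha> [a, b, u]"
    "\<alpha> [- u, b, c] = - \<alpha> [u, b, c]" "\<alpha> [a, - u, c] = - \<alpha> [a, u, c]" "\<alpha> [a, b, - u] = - \<alpha> [a, b, u]"
proof -
  have l: "linear (\<lambda>v. \<alpha> [v, b, c])" "linear (\<lambda>v. \<alpha> [a, v, c])" "linear (\<lambda>v. \<alpha> [a, b, v])" for a b c
    using multilinearD[OF alternating_multilinear[OF assms], of "[]" "[b, c]"]
      multilinearD[OF alternating_multilinear[OF assms], of "[a]" "[c]"]
      multilinearD[OF alternating_multilinear[OF assms], of "[a, b]" "[]"] by simp_all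
  show "\<alpha> [u + v, b, c] = \<alpha> [u, b, c] + \<alpha> [v, b, c]" "\<alpha> [a, u + v, c] = \<alpha> [a, u, c] + \<alpha> [a, v, c]"
    "\<alpha> [a, b, u + v] = \<alpha> [a, b, u] + \<alpha> [a, b, v]"
    "\<alpha> [r *\<^sub>R u, b, c] = r * \<alpha> [u, b, c]" "\<alpha> [a, r *\<^sub>R u, c] = r * \<alpha> [a, u, c]"
    "\<alpha> [a, b, r *\<^sub>R u] = r * \<alpha> [a, b, u]"
    "\<alpha> [- u, b, c] = - \<alpha> [u, b, c]" "\<alpha> [a, - u, c] = - \<alpha> [a, u, c]" "\<alpha> [a, b, - u] = - \<alpha> [a, b, u]"
    by (simp_all add: linear_add[OF l(1)] linear_add[OF l(2)] linear_add[OF l(3)] linear_cmul[OF l(1)]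
        linear_cmul[OF l(2)] linear_cmul[OF l(3)] linear_neg[OF l(1)] linear_neg[OF l(2)] linear_neg[OF l(3)])
qed

lemma alternating_3_swap:
  assumes "alternating 3 \<alpha>"
  shows "\<alpha> [b, a, c] = - \<alpha> [a, b, c]" "\<alpha> [c, b, a] = - \<alpha> [c, a, b]" "\<alpha> [a, a, c] = 0" "\<alpha> [c, a, a] = 0"
proof -
  show 1: "\<alpha> [b, a, c] = - \<alpha> [a, b, c]" for a b c
    by (rule alternating_swap[OF assms, of "[]", unfolded append.simps]) simp
  show 2: "\<alpha> [c, b, a] = - \<alpha> [c, a, b]" for a b c
    by (rule alternating_swap[OF assms, of "[c]", unfolded append.simps]) simp
  show "\<alpha> [a, a, c] = 0" "\<alpha> [c, a, a] = 0" using 1[of a a c] 2[of c a a] by simp_all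
qed

lemma alternating_4I:
  fixes \<alpha> :: "'a::real_vector form"
  assumes "\<And>a. alternating 3 (\<lambda>l. \<alpha> (a # l))"
    and "\<And>b c d. linear (\<lambda>v. \<alpha> [v, b, c, d])" "\<And>a b c d. \<alpha> [a, b, c, d] = - \<alpha> [b, a, c, d]"
  shows "alternating 4 \<alpha>"
proof -
  have "alternating (Suc 3) \<alpha>"
  proof (rule alternating_SucI)
    fix l :: "'a list" assume "length l = 3"
    then obtain b c d where "l = [b, c, d]" by (auto simp: numeral_3_eq_3 length_Suc_conv)
    then show "linear (\<lambda>v. \<alpha> (v # l))" by (simp add: assms(2))
  next
    fix a b and l :: "'a list" assume "Suc (length l) = 3"
    then obtain c d where "l = [c, d]" by (auto simp: numeral_3_eq_3 length_Suc_conv)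
    then show "\<alpha> (a # b # l) = - \<alpha> (b # a # l)" using assms(3)[of a b c d] by simp
  qed (rule assms(1))
  then show ?thesis by (simp add: numeral_eq_Suc)
qed

lemma alternating_5I:
  fixes \<alpha> :: "'a::real_vector form"
  assumes "\<And>a. alternating 4 (\<lambda>l. \<alpha> (a # l))"
    and "\<And>b c d e. linear (\<lambda>v. \<alpha> [v, b, c, d, e])" "\<And>a b c d e. \<alpha> [a, b, c, d, e] = - \<alpha> [b, a, c, d, e]"
  shows "alternating 5 \<alpha>"
proof -
  have "alternating (Suc 4) \<alpha>"
  proof (rule alternating_SucI)
    fix l :: "'a list" assume "length l = 4"
    then obtain b c d e where "l = [b, c, d, e]" by (auto simp: numeral_eq_Suc length_Suc_conv)
    then show "linear (\<lambda>v. \<alpha> (v # l))" by (simp add: assms(2))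
  next
    fix a b and l :: "'a list" assume "Suc (length l) = 4"
    then obtain c d e where "l = [c, d, e]" by (auto simp: numeral_eq_Suc length_Suc_conv)
    then show "\<alpha> (a # b # l) = - \<alpha> (b # a # l)" using assms(3)[of a b c d e] by simp
  qed (rule assms(1))
  then show ?thesis by (simp add: numeral_eq_Suc)
qed

lemma upt_upto_8: "[0..<Suc 0] = [0]" "[0..<2] = [0, 1]" "[0..<3] = [0, 1, 2]" "[0..<4] = [0, 1, 2, 3]"
  "[0..<5] = [0, 1, 2, 3, 4]" "[0..<6] = [0, 1, 2, 3, 4, 5]" "[0..<7] = [0, 1, 2, 3, 4, 5, 6]"
  "[0..<8] = [0, 1, 2, 3, 4, 5, 6, 7]"
  by (simp_all add: upt_rec)

lemma sum_lessThan_8: "(\<Sum>s<8. g s) = g 0 + g 1 + g 2 + g 3 + g 4 + g 5 + g 6 + g (7::nat)" for g :: "nat \<Rightarrow> real"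
  by (simp add: eval_nat_numeral)

text \<open>On an orthonormal frame a Hodge dual at \<open>is\<close> is, up to sign, the form at
  the complementary indices; \<open>complement8 is @ is\<close> is the permutation that carries the
  sign.\<close>

definition complement8 :: "nat list \<Rightarrow> nat list" where
  "complement8 is = filter (\<lambda>x. x \<notin> set is) [0..<8]"

lemma complement8:
  assumes "distinct is" "set is \<subseteq> {..<8}"
  shows "distinct (complement8 is @ is)" "set (complement8 is @ is) = {..<8}"
    "length (complement8 is) = 8 - length is"
proof -
  show d: "distinct (complement8 is @ is)" using assms by (auto simp: complement8_def)
  show s: "set (complement8 is @ is) = {..<8}" using assms by (auto simp: complement8_def)
  have "card (set (complement8 is @ is)) = length (complement8 is) + length is"
    using distinct_card[OF d] by simp
  then show "length (complement8 is) = 8 - length is" unfolding s by simp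
qed

section \<open>Hodge duals of \<Phi> and of F \<and> dF\<close>

context quaternionic begin

lemma F_simps: "F [u + v, w] = F [u, w] + F [v, w]" "F [w, u + v] = F [w, u] + F [w, v]"
  "F [c *\<^sub>R u, w] = c * F [u, w]" "F [w, c *\<^sub>R u] = c * F [w, u]"
  using F_linear by (simp_all add: linear_iff)

lemma Phi_alternating: "alternating 4 Phi"
proof (rule alternating_4I)
  show "alternating 3 (\<lambda>l. Phi (a # l))" for a
  proof (rule alternating_3I)
    fix b c d
    show "linear (\<lambda>v. Phi [a, v, b, c])"
      by (rule linearI) (simp_all add: Phi_def F_simps algebra_simps)
    show "Phi [a, b, c, d] = - Phi [a, c, b, d]" by (simp add: Phi_def F_skew[of c b])
    show "Phi [a, b, c, d] = - Phi [a, b, d, c]" by (simp add: Phi_def F_skew[of d c])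
  qed
  fix a b c d
  show "linear (\<lambda>v. Phi [v, b, c, d])"
    by (rule linearI) (simp_all add: Phi_def F_simps algebra_simps)
  show "Phi [a, b, c, d] = - Phi [b, a, c, d]" by (simp add: Phi_def F_skew[of b a])
qed

lemma F_wedge_alternating:
  assumes d: "alternating 3 d"
  shows "alternating 5 (F_wedge d)"
proof -
  note dl = alternating_3_simps(1-6)[OF d]
  note ds1 = alternating_3_swap(1)[OF d] and ds2 = alternating_3_swap(2)[OF d]
  show ?thesis
  proof (rule alternating_5I, rule alternating_4I, rule alternating_3I)
    fix a b c x y
    show "linear (\<lambda>v. F_wedge d [a, b, v, c, x])" "linear (\<lambda>v. F_wedge d [a, v, b, c, x])"
      "linear (\<lambda>v. F_wedge d [v, a, b, c, x])"
      by (rule linearI; simp add: F_wedge_def F_simps dl algebra_simps)+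
    show "F_wedge d [a, b, c, x, y] = - F_wedge d [b, a, c, x, y]"
      by (simp add: F_wedge_def F_skew[of b a] ds1[of b a] ds2[of _ b a])
    show "F_wedge d [a, b, c, x, y] = - F_wedge d [a, c, b, x, y]"
      by (simp add: F_wedge_def F_skew[of c b] ds1[of c b] ds2[of _ c b])
    show "F_wedge d [a, b, c, x, y] = - F_wedge d [a, b, x, c, y]"
      by (simp add: F_wedge_def F_skew[of x c] ds1[of x c] ds2[of _ x c])
    show "F_wedge d [a, b, c, x, y] = - F_wedge d [a, b, c, y, x]"
      by (simp add: F_wedge_def F_skew[of y x] ds1[of y x] ds2[of _ y x])
  qed
qed

lemma hodge_basis:
  assumes E: "orthonormal_frame h E" and \<alpha>: "alternating k \<alpha>"
    and js: "distinct js" "set js \<subseteq> {..<8}" "length js + k = 8"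
  shows "hodge k h \<alpha> (map E js) = volume_form h (map E (complement8 js @ js)) * \<alpha> (map E (complement8 js))"
proof -
  have "hodge k h \<alpha> (map E (drop k (complement8 js @ js))) =
     volume_form h (map E (complement8 js @ js)) * \<alpha> (map E (take k (complement8 js @ js)))"
    by (rule hodge_frame_perm[OF E \<alpha>]) (use complement8[OF js(1,2)] js(3) in simp_all)
  moreover have "length (complement8 js) = k" using complement8(3)[OF js(1,2)] js(3) by simp
  ultimately show ?thesis by simp
qed

text \<open>The premise \<open>b < a\<close> orients each equation, so rewriting sorts the index
  list and thereby computes the sign of its permutation.\<close>

lemma volume_swaps:
  fixes E :: "nat \<Rightarrow> real^8"
  defines "V \<equiv> \<lambda>js. volume_form h (map E js)"
  shows "b < a \<Longrightarrow> V [a, b, i, j, k, l, m, n] = - V [b, a, i, j, k, l, m, n]"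
    "b < a \<Longrightarrow> V [i, a, b, j, k, l, m, n] = - V [i, b, a, j, k, l, m, n]"
    "b < a \<Longrightarrow> V [i, j, a, b, k, l, m, n] = - V [i, j, b, a, k, l, m, n]"
    "b < a \<Longrightarrow> V [i, j, k, a, b, l, m, n] = - V [i, j, k, b, a, l, m, n]"
    "b < a \<Longrightarrow> V [i, j, k, l, a, b, m, n] = - V [i, j, k, l, b, a, m, n]"
    "b < a \<Longrightarrow> V [i, j, k, l, m, a, b, n] = - V [i, j, k, l, m, b, a, n]"
    "b < a \<Longrightarrow> V [i, j, k, l, m, n, a, b] = - V [i, j, k, l, m, n, b, a]"
proof -
  have sw: "V (xs @ a # b # ys) = - V (xs @ b # a # ys)" if "length xs + length ys = 6" for xs ys a b
    unfolding V_def map_append list.map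
    by (rule alternating_swap[OF volume_alternating]) (use that in simp)
  show "V [a, b, i, j, k, l, m, n] = - V [b, a, i, j, k, l, m, n]"
    by (rule sw[of "[]", unfolded append.simps]) simp
  show "V [i, a, b, j, k, l, m, n] = - V [i, b, a, j, k, l, m, n]"
    by (rule sw[of "[i]", unfolded append.simps]) simp
  show "V [i, j, a, b, k, l, m, n] = - V [i, j, b, a, k, l, m, n]"
    by (rule sw[of "[i,j]", unfolded append.simps]) simp
  show "V [i, j, k, a, b, l, m, n] = - V [i, j, k, b, a, l, m, n]"
    by (rule sw[of "[i,j,k]", unfolded append.simps]) simp
  show "V [i, j, k, l, a, b, m, n] = - V [i, j, k, l, b, a, m, n]"
    by (rule sw[of "[i,j,k,l]", unfolded append.simps]) simp
  show "V [i, j, k, l, m, a, b, n] = - V [i, j, k, l, m, b, a, n]"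
    by (rule sw[of "[i,j,k,l,m]", unfolded append.simps]) simp
  show "V [i, j, k, l, m, n, a, b] = - V [i, j, k, l, m, n, b, a]"
    by (rule sw[of "[i,j,k,l,m,n]", unfolded append.simps]) simp
qed

context
  fixes e f :: "real^8"
  assumes ad: "adapted e f"
begin

abbreviation "E \<equiv> qframe e f"

lemma E_frame: "orthonormal_frame h E" by (rule adapted_frame[OF ad])

lemma h_E: "i < 8 \<Longrightarrow> j < 8 \<Longrightarrow> h (E i) (E j) = (if i = j then 1 else 0)"
  using frame_nth[OF E_frame] by simp

lemma E_expand: "v = (\<Sum>s<8. h v (E s) *\<^sub>R E s)"
  using frame_expand[OF E_frame] by simp

lemma I_E: "I (E 0) = E 1" "I (E 1) = - E 0" "I (E (Suc 0)) = - E 0" "I (E 2) = E 3" "I (E 3) = - E 2"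
   "I (E 4) = E 5" "I (E 5) = - E 4" "I (E 6) = E 7" "I (E 7) = - E 6"
  by (simp_all add: qframe_def quat)

lemma J_E: "J (E 0) = E 2" "J (E 1) = - E 3" "J (E (Suc 0)) = - E 3" "J (E 2) = - E 0" "J (E 3) = E 1"
   "J (E 4) = E 6" "J (E 5) = - E 7" "J (E 6) = - E 4" "J (E 7) = E 5"
  by (simp_all add: qframe_def quat)

lemma K_E: "K (E 0) = E 3" "K (E 1) = E 2" "K (E (Suc 0)) = E 2" "K (E 2) = - E 1" "K (E 3) = - E 0"
   "K (E 4) = E 7" "K (E 5) = E 6" "K (E 6) = - E 5" "K (E 7) = - E 4"
  by (simp_all add: qframe_def quat)

lemma F_E: "i < 8 \<Longrightarrow> j < 8 \<Longrightarrow>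
  F [E i, E j] = (if even i then (if j = Suc i then -1 else 0) else (if i = Suc j then 1 else 0))"
proof -
  have "\<forall>i<8. \<forall>j<8. F [E i, E j] = (if even i then (if j = Suc i then -1 else 0) else (if i = Suc j then 1 else 0))"
    by (simp add: all_less_8 F_def I_E h_simps h_E)
  then show "i < 8 \<Longrightarrow> j < 8 \<Longrightarrow>
    F [E i, E j] = (if even i then (if j = Suc i then -1 else 0) else (if i = Suc j then 1 else 0))" by blast
qed

text \<open>On increasing lists \<open>Phi\<close> is 1 for a union of two planes spanned by a
  vector and its image under \<open>I\<close>, and 0 otherwise. The complement of such a union is
  another one, and moving blocks of length two past each other is an even permutation. The volume
  factor is the orientation of the frame.\<close>

lemma hodge_Phi:
  assumes "length vs = 4"
  shows "hodge 4 h Phi vs = volume_form h (map E [0..<8]) * Phi vs"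
proof (rule alternating_eqI[OF _ alternating_cmult[OF Phi_alternating] E_expand _ assms])
  show "alternating 4 (hodge 4 h Phi)" using hodge_alternating[of 4 Phi] by simp
  fix js :: "nat list" assume js: "set js \<subseteq> {..<8}" "length js = 4" "sorted_wrt (<) js"
  define V where "V l = volume_form h (map E l)" for l
  note sw = volume_swaps[of _ _ E, folded V_def]
  define Q where "Q js \<longleftrightarrow> V (complement8 js @ js) * Phi (map E (complement8 js)) = V [0..<8] * Phi (map E js)" for js
  \<comment> \<open>The bounded quantifiers unroll into one numerical goal for each of the 70
    increasing lists.\<close>
  have "\<forall>l\<in>set [0..<8]. \<forall>k\<in>set [0..<l]. \<forall>j\<in>set [0..<k]. \<forall>i\<in>set [0..<j]. Q [i, j, k, l]"
    by (simp del: set_upt add: upt_upto_8, intro conjI; simp only: Q_def complement8_def upt_upto_8;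
        simp add: sw Phi_def F_E)
  moreover obtain i j k l where "js = [i, j, k, l]" "i < j" "j < k" "k < l" "l < 8"
    using js by (auto simp: numeral_eq_Suc length_Suc_conv)
  ultimately have "Q js" by simp
  then show "hodge 4 h Phi (map E js) = volume_form h (map E [0..<8]) * Phi (map E js)"
    using hodge_basis[OF E_frame Phi_alternating, of js] js by (simp add: Q_def V_def strict_sorted_iff)
qed

text \<open>Weil's identity for the Hodge star in complex dimension 4. If \<open>\<theta>\<close>
  vanishes (\<open>d\<close> is primitive), the dual of F \<and> d is \<open>d\<close> rotated by
  \<open>I\<close>, up to orientation; the trace term corrects the part of the form \<alpha> \<and>
  F. Since both sides are alternating, the identity is verified on the 56 increasing triples of
  frame vectors.\<close>

lemma hodge_F_wedge:
  assumes d: "alternating 3 d"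
  defines "\<theta> \<equiv> \<lambda>X. metric_trace h (\<lambda>u v. d [X, I u, v]) / 2"
  shows "- volume_form h (map E [0..<8]) * hodge 5 h (F_wedge d) [X, Y, Z] =
     d [I X, I Y, I Z] - (\<theta> (I X) * F [Y, Z] - \<theta> (I Y) * F [X, Z] + \<theta> (I Z) * F [X, Y])"
proof -
  note dn = alternating_3_simps(7-9)[OF d] and dl = alternating_3_simps(1-6)[OF d]
  note ds1 = alternating_3_swap(1)[OF d] and ds2 = alternating_3_swap(2)[OF d]
  note d0 = alternating_3_swap(3,4)[OF d]
  have \<theta>: "\<theta> X = (\<Sum>s<8. d [X, I (E s), E s]) / 2" for X
  proof -
    have "bilinear (\<lambda>u v. d [X, I u, v])"
      unfolding bilinear_def by (intro conjI allI linearI) (simp_all add: dl IJK_simps)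
    from metric_trace_frame[OF E_frame this] show ?thesis by (simp add: \<theta>_def)
  qed
  have \<theta>l: "\<theta> (u + v) = \<theta> u + \<theta> v" "\<theta> (c *\<^sub>R u) = c * \<theta> u" for u v c
    by (simp_all add: \<theta> dl sum.distrib sum_distrib_left add_divide_distrib)
  define R where "R l = d [I (l!0), I (l!1), I (l!2)] -
    (\<theta> (I (l!0)) * F [l!1, l!2] - \<theta> (I (l!1)) * F [l!0, l!2] + \<theta> (I (l!2)) * F [l!0, l!1])" for l
  have altR: "alternating 3 R"
  proof (rule alternating_3I)
    fix a b c
    show "linear (\<lambda>v. R [v, b, c])"
      by (rule linearI) (simp_all add: R_def dl IJK_simps \<theta>l F_simps algebra_simps)
    show "R [a, b, c] = - R [b, a, c]"
      by (simp add: R_def ds1[of "I b" "I a"] F_skew[of b a])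
    show "R [a, b, c] = - R [a, c, b]"
      by (simp add: R_def ds2[of "I a" "I c" "I b"] F_skew[of c b])
  qed
  define V where "V l = volume_form h (map E l)" for l
  note sw = volume_swaps[of _ _ E, folded V_def]
  have VV: "V [0..<8] * V [0..<8] = 1"
    using volume_frame[OF E_frame] by (simp add: V_def power2_eq_square)
  have "hodge 5 h (F_wedge d) [X, Y, Z] = - V [0..<8] * R [X, Y, Z]"
  proof (rule alternating_eqI[OF _ alternating_cmult[OF altR] E_expand])
    show "alternating 3 (hodge 5 h (F_wedge d))" using hodge_alternating[of 5 "F_wedge d"] by simp
    fix js :: "nat list" assume js: "set js \<subseteq> {..<8}" "length js = 3" "sorted_wrt (<) js"
    \<comment> \<open>The frame components of \<open>d\<close>. The conditional rules sort their
      indices, so that both sides of each goal are expressed in the same components.\<close>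
    define D where "D i j k = d [E i, E j, E k]" for i j k
    have D: "j < i \<Longrightarrow> D i j k = - D j i k" "k < j \<Longrightarrow> D i j k = - D i k j" "D i i k = 0" "D i k k = 0" for i j k
      using ds1[of "E j" "E i"] ds2[of "E i" "E k" "E j"] d0 by (simp_all add: D_def)
    define Q where "Q js \<longleftrightarrow> V (complement8 js @ js) * F_wedge d (map E (complement8 js)) = - V [0..<8] * R (map E js)" for js
    have "\<forall>k\<in>set [0..<8]. \<forall>j\<in>set [0..<k]. \<forall>i\<in>set [0..<j]. Q [i, j, k]"
      by (simp del: set_upt add: upt_upto_8, intro conjI; simp only: Q_def complement8_def upt_upto_8;
          simp add: sw F_wedge_def F_E R_def \<theta> sum_lessThan_8 I_E dn D_def[symmetric] D; simp add: field_simps)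
    moreover obtain i j k where "js = [i, j, k]" "i < j" "j < k" "k < 8"
      using js by (auto simp: numeral_eq_Suc length_Suc_conv)
    ultimately have "Q js" by simp
    then show "hodge 5 h (F_wedge d) (map E js) = - V [0..<8] * R (map E js)"
      using hodge_basis[OF E_frame F_wedge_alternating[OF d], of js] js by (simp add: Q_def V_def strict_sorted_iff)
  qed simp
  then have "- V [0..<8] * hodge 5 h (F_wedge d) [X, Y, Z] = (V [0..<8] * V [0..<8]) * R [X, Y, Z]"
    by simp
  then show ?thesis unfolding VV by (simp add: R_def V_def)
qed

end

end

section \<open>Forms of type (3,0)+(0,3), and traces of skew torsion\<close>

context quaternionic begin

text \<open>A 3-form satisfying \<open>type\<close> has type $(3,0)+(0,3)$ with respect to \<open>I\<close>.  In dimension 8 such forms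
  make up a copy of the tangent space, so they can be recovered from their trace \<open>\<nu>\<close>.\<close>

lemma skew_type_form:
  assumes N: "alternating 3 N" and type: "\<And>u v w. N [I u, v, w] = N [u, I v, w]"
  defines "\<nu> \<equiv> \<lambda>X. metric_trace h (\<lambda>u v. N [J X, J u, v]) / 4"
  shows "N [X, Y, Z] =
    (- \<nu> (J X)) * h Y (J Z) - (- \<nu> (J Y)) * h X (J Z) + (- \<nu> (J Z)) * h X (J Y) -
    ((- \<nu> (K X)) * h Y (K Z) - (- \<nu> (K Y)) * h X (K Z) + (- \<nu> (K Z)) * h X (K Y))"
proof -
  obtain e f where ad: "adapted e f" using adapted_exists by blast
  let ?E = "qframe e f"
  note h_E = h_E[OF ad] and E_frame = E_frame[OF ad]
  note dn = alternating_3_simps(7-9)[OF N] and dl = alternating_3_simps(1-6)[OF N]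
  note ds1 = alternating_3_swap(1)[OF N] and ds2 = alternating_3_swap(2)[OF N]
  note d0 = alternating_3_swap(3,4)[OF N]
  have type2: "N [u, v, I w] = N [I u, v, w]" for u v w
    using ds2[of u v "I w"] ds2[of "I u" v w] type[of u w v] by simp
  have \<nu>: "\<nu> X = (\<Sum>s<8. N [J X, J (?E s), ?E s]) / 4" for X
  proof -
    have "bilinear (\<lambda>u v. N [J X, J u, v])"
      unfolding bilinear_def by (intro conjI allI linearI) (simp_all add: dl IJK_simps)
    from metric_trace_frame[OF E_frame this] show ?thesis by (simp add: \<nu>_def)
  qed
  have \<nu>l: "\<nu> (u + v) = \<nu> u + \<nu> v" "\<nu> (c *\<^sub>R u) = c * \<nu> u" for u v c
    by (simp_all add: \<nu> dl IJK_simps sum.distrib sum_distrib_left add_divide_distrib)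
  define R where "R l = (- \<nu> (J (l!0))) * h (l!1) (J (l!2)) - (- \<nu> (J (l!1))) * h (l!0) (J (l!2)) + (- \<nu> (J (l!2))) * h (l!0) (J (l!1)) -
    ((- \<nu> (K (l!0))) * h (l!1) (K (l!2)) - (- \<nu> (K (l!1))) * h (l!0) (K (l!2)) + (- \<nu> (K (l!2))) * h (l!0) (K (l!1)))" for l
  have hs: "h b (J a) = - h a (J b)" "h b (K a) = - h a (K b)" for a b
    using h_skew[of a b] sym by (metis minus_minus)+
  have altR: "alternating 3 R"
  proof (rule alternating_3I)
    fix a b c
    show "linear (\<lambda>v. R [v, b, c])"
      by (rule linearI) (simp_all add: R_def h_simps IJK_simps \<nu>l algebra_simps)
    show "R [a, b, c] = - R [b, a, c]"
      by (simp add: R_def hs[of b a])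
    show "R [a, b, c] = - R [a, c, b]"
      by (simp add: R_def hs[of c b])
  qed
  have "N [X, Y, Z] = R [X, Y, Z]"
  proof (rule alternating_eqI[OF N altR E_expand[OF ad]])
    fix js :: "nat list" assume js: "set js \<subseteq> {..<8}" "length js = 3" "sorted_wrt (<) js"
    define D where "D i j k = N [?E i, ?E j, ?E k]" for i j k
    have IE: "I (?E i) = (if even i then ?E (Suc i) else - ?E (i - 1))" if "i < 8" for i
    proof -
      have "\<forall>i<8. I (?E i) = (if even i then ?E (Suc i) else - ?E (i - 1))"
        by (simp add: all_less_8 I_E[OF ad])
      then show ?thesis using that by blast
    qed
    have odd_E: "?E i = I (?E (i - 1))" if "odd i" "i < 8" for i
      using IE[of "i - 1"] that by (cases i) auto
    \<comment> \<open>These rules shift \<open>I\<close> into the first slot, sort the indices and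
      discard components with two indices in one \<open>I\<close>-plane. What remains are three
      distinct \<open>I\<close>-planes out of four with the first index even or odd: eight
      components, as many as the dimension of the tangent space.\<close>
    have D: "odd j \<Longrightarrow> i < 8 \<Longrightarrow> j < 8 \<Longrightarrow> D i j k = (if even i then D (Suc i) (j - 1) k else - D (i - 1) (j - 1) k)"
      "odd k \<Longrightarrow> i < 8 \<Longrightarrow> k < 8 \<Longrightarrow> D i j k = (if even i then D (Suc i) j (k - 1) else - D (i - 1) j (k - 1))"
      "even i \<Longrightarrow> even j \<Longrightarrow> j < i \<Longrightarrow> D i j k = - D j i k"
      "odd i \<Longrightarrow> even j \<Longrightarrow> i < 8 \<Longrightarrow> Suc j < i \<Longrightarrow> D i j k = - D (Suc j) (i - 1) k"
      "k < j \<Longrightarrow> D i j k = - D i k j" "D i i k = 0" "D i k k = 0"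
      "even j \<Longrightarrow> j < 8 \<Longrightarrow> i = Suc j \<Longrightarrow> D i j k = 0" for i j k
    proof -
      show "D i j k = (if even i then D (Suc i) (j - 1) k else - D (i - 1) (j - 1) k)" if "odd j" "i < 8" "j < 8"
        using type[of "?E i" "?E (j - 1)" "?E k"] IE[OF that(2)] odd_E[OF that(1,3)] by (auto simp: D_def dn)
      show "D i j k = (if even i then D (Suc i) j (k - 1) else - D (i - 1) j (k - 1))" if "odd k" "i < 8" "k < 8"
        using type2[of "?E i" "?E j" "?E (k - 1)"] IE[OF that(2)] odd_E[OF that(1,3)] by (auto simp: D_def dn)
      show "D i j k = - D j i k" for i j k using ds1[of "?E i" "?E j"] by (simp add: D_def)
      show "D i j k = - D i k j" using ds2[of "?E i" "?E j"] by (simp add: D_def)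
      show "D i i k = 0" "D i k k = 0" by (simp_all add: D_def d0)
      show "D i j k = - D (Suc j) (i - 1) k" if "odd i" "even j" "i < 8" "Suc j < i"
        using type[of "?E (i - 1)" "?E j" "?E k"] ds1[of "?E (i - 1)" "I (?E j)" "?E k"]
          IE[of j] odd_E[OF that(1,3)] that by (simp add: D_def)
      show "D i j k = 0" if "even j" "j < 8" "i = Suc j"
        using type[of "?E j" "?E j" "?E k"] ds1[of "?E j" "I (?E j)" "?E k"] IE[of j] that by (simp add: D_def)
    qed
    define Q where "Q js \<longleftrightarrow> N (map ?E js) = R (map ?E js)" for js
    have "\<forall>k\<in>set [0..<8]. \<forall>j\<in>set [0..<k]. \<forall>i\<in>set [0..<j]. Q [i, j, k]"
      by (simp del: set_upt add: upt_upto_8, intro conjI; simp only: Q_def;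
          simp add: R_def \<nu> sum_lessThan_8 J_E[OF ad] K_E[OF ad] dn h_E h_simps IJK_simps D_def[symmetric] D)
    moreover obtain i j k where "js = [i, j, k]" "i < j" "j < k" "k < 8"
      using js by (auto simp: numeral_eq_Suc length_Suc_conv)
    ultimately have "Q js" by simp
    then show "N (map ?E js) = R (map ?E js)" by (simp add: Q_def)
  qed simp
  then show ?thesis by (simp add: R_def)
qed

lemma frame_rotate:
  assumes "orthonormal_frame h b"
  shows "orthonormal_frame h (\<lambda>s. I (b s))"
  using assms by (simp add: orthonormal_frame_def hII)

text \<open>The two bilinear forms agree on the diagonal: of the three terms of
  \<open>d [X, I u, u]\<close>, two contain a repeated argument, and the third is a cyclic rotation
  of \<open>T [I X, I u, u]\<close>. With \<open>d\<close> the exterior derivative of F, this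
  expresses the Lee form through the torsion.\<close>

lemma skew_torsion_lee:
  assumes T: "alternating 3 T"
    and d: "\<And>u v w. d [u, v, w] = T [u, v, I w] + T [v, w, I u] + T [w, u, I v]"
  shows "metric_trace h (\<lambda>u v. d [X, I u, v]) = metric_trace h (\<lambda>u v. T [I X, I u, v])"
proof -
  obtain e f where ad: "adapted e f" using adapted_exists by blast
  let ?E = "qframe e f"
  note dn = alternating_3_simps(7-9)[OF T] and dl = alternating_3_simps(1-6)[OF T]
  note ds1 = alternating_3_swap(1)[OF T] and ds2 = alternating_3_swap(2)[OF T]
  note d0 = alternating_3_swap(3,4)[OF T]
  have eq: "d [X, I u, u] = T [I X, I u, u]" for u
    using ds1[of u "I X" "I u"] ds2[of "I X" u "I u"] ds1[of "I u" "I X" u] ds2[of "I u" "I X" u] ds1[of u X u] ds2[of X u u] ds2[of u X u]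
    by (simp add: d quat dn d0)
  have "bilinear (\<lambda>u v. d [X, I u, v])" "bilinear (\<lambda>u v. T [I X, I u, v])"
    unfolding bilinear_def by (intro conjI allI linearI; simp add: d dl IJK_simps algebra_simps)+
  then show ?thesis by (simp add: metric_trace_frame[OF E_frame[OF ad]] eq)
qed

text \<open>Together with \<open>skew_torsion_lee\<close> for \<open>J\<close> and \<open>K\<close>,
  this is the relation \<nu>^a = \<theta>^b - \<theta>^c.\<close>

lemma skew_torsion_nu:
  assumes T: "alternating 3 T"
    and N: "\<And>u v w. N [u, v, w] = T [u, v, w] - T [I u, I v, w] - T [I u, v, I w] - T [u, I v, I w]"
  shows "metric_trace h (\<lambda>u v. N [J X, J u, v]) / 4 =
    metric_trace h (\<lambda>u v. T [J X, J u, v]) / 2 - metric_trace h (\<lambda>u v. T [K X, K u, v]) / 2"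
proof -
  obtain e f where ad: "adapted e f" using adapted_exists by blast
  let ?E = "qframe e f"
  note E = E_frame[OF ad]
  note dn = alternating_3_simps(7-9)[OF T] and dl = alternating_3_simps(1-6)[OF T]
  have b: "bilinear (\<lambda>u v. N [J X, J u, v])" "bilinear (\<lambda>u v. T [Y, J u, v])" "bilinear (\<lambda>u v. T [Y, K u, v])"
    "bilinear (\<lambda>u v. T [Y, J u, I v])" "bilinear (\<lambda>u v. T [Y, K u, I v])" for Y
    unfolding bilinear_def by (intro conjI allI linearI; simp add: N dl IJK_simps algebra_simps)+
  \<comment> \<open>Replacing the frame by its image under \<open>I\<close> turns the mixed traces
    into the two pure ones, which therefore occur twice.\<close>
  have s: "(\<Sum>s<8. T [Y, J (?E s), I (?E s)]) = (\<Sum>s<8. T [Y, K (?E s), ?E s])"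
    "(\<Sum>s<8. T [Y, K (?E s), I (?E s)]) = - (\<Sum>s<8. T [Y, J (?E s), ?E s])" for Y
    using trace_frame[OF E frame_rotate[OF E] b(4)[of Y]] trace_frame[OF E frame_rotate[OF E] b(5)[of Y]]
    by (simp_all add: quat dn sum_negf)
  have "N [J X, J u, u] = T [J X, J u, u] - T [K X, K u, u] - T [K X, J u, I u] - T [J X, K u, I u]" for u
    by (simp add: N quat)
  then show ?thesis
    by (simp add: metric_trace_frame[OF E b(1)] metric_trace_frame[OF E b(2)] metric_trace_frame[OF E b(3)]
        sum_subtractf s)
qed

end

section \<open>Connections with skew-symmetric torsion\<close>

definition skew3 :: "('e \<Rightarrow> 'e \<Rightarrow> 'e \<Rightarrow> real) \<Rightarrow> bool" where
  "skew3 T \<longleftrightarrow> (\<forall>u v w. T u v w = - T v u w \<and> T u v w = - T u w v)"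

lemma skew3D: "skew3 T \<Longrightarrow> T v u w = - T u v w" "skew3 T \<Longrightarrow> T u w v = - T u v w"
  unfolding skew3_def by (metis minus_minus)+

lemma totally_skew_skew3: "totally_skew \<alpha> \<longleftrightarrow> skew3 (\<lambda>u v w. \<alpha> [u, v, w])"
  by (simp add: totally_skew_def skew3_def)

text \<open>Here \<open>S\<close> stands for the difference of two connections with skew torsion that preserve the metric
  and \<open>J\<close>.\<close>

lemma skew_torsion_unique:
  fixes S :: "'e::real_vector \<Rightarrow> 'e \<Rightarrow> 'e \<Rightarrow> real"
  assumes a: "\<And>u v w. S u v w = - S u w v"
    and T: "skew3 (\<lambda>u v w. S u v w - S v u w)"
    and J: "\<And>u v w. S u (J v) w = - S u v (J w)"
    and JJ: "\<And>u. J (J u) = - u" and neg: "\<And>u v w. S (- u) v w = - S u v w"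
  shows "S u v w = 0"
proof -
  \<comment> \<open>As for the Koszul formula, skewness in the last two slots together with a skew
    torsion difference makes \<open>S\<close> itself totally skew.\<close>
  have s: "S u v w = - S v u w" for u v w
    using skew3D(1)[OF T, of u v w] skew3D(1)[OF T, of u w v] skew3D(2)[OF T, of u v w] skew3D(1)[OF T, of v w u]
      skew3D(2)[OF T, of v u w] a[of u v w] a[of v u w] a[of w u v] by linarith
  \<comment> \<open>Moving \<open>J\<close> from one slot of a totally skew \<open>S\<close> to
    another costs a sign. Once round the three slots makes three signs, so the value equals its own
    negative.\<close>
  have z: "S (J u) v w = 0" for u v w
    using J[of w u v] s[of w "J u" v] s[of w u "J v"] J[of u v w] a[of "J u" w v] a[of u w "J v"]
      s[of "J u" v w] a[of v "J u" w] J[of v w u] s[of v w "J u"] s[of v "J w" u] a[of v w "J u"]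
      a[of v u "J w"] s[of v u "J w"] a[of u v "J w"] a[of v "J w" u] by linarith
  show ?thesis using z[of "J u" v w] by (simp add: JJ neg)
qed

definition trilinear :: "('e::real_vector \<Rightarrow> 'e \<Rightarrow> 'e \<Rightarrow> real) \<Rightarrow> bool" where
  "trilinear T \<longleftrightarrow> (\<forall>a b. linear (\<lambda>v. T v a b) \<and> linear (\<lambda>v. T a v b) \<and> linear (\<lambda>v. T a b v))"

text \<open>The 1-jet of an almost Hermitian structure at a point, in coordinates: \<open>B u\<close> and \<open>C u\<close> are the
  derivatives of the metric and of \<open>J\<close> in direction \<open>u\<close>.\<close>

locale hermitian_jet = inner_product h for h :: "'e::euclidean_space \<Rightarrow> 'e \<Rightarrow> real" +
  fixes J :: "'e \<Rightarrow> 'e" and B :: "'e \<Rightarrow> 'e \<Rightarrow> 'e \<Rightarrow> real" and C :: "'e \<Rightarrow> 'e \<Rightarrow> 'e"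
  assumes linJ: "linear J" and JJ: "J (J u) = - u" and hJ: "h (J u) (J v) = h u v"
    and B_lin: "linear (\<lambda>u. B u v w)" and B_bil: "bilinear (B u)" and B_sym: "B u v w = B u w v"
    and C_bil: "bilinear C" and C_J: "C u (J v) = - J (C u v)"
    and B_J: "B u (J v) (J w) + h (C u v) (J w) + h (J v) (C u w) = B u v w"
begin

lemma h_skew: "h (J u) v = - h u (J v)"
  using hJ[of u "J v"] by (simp add: JJ h_simps)

lemma B_lin': "linear (\<lambda>v. B u v w)" "linear (\<lambda>w. B u v w)"
  using B_bil by (auto simp: bilinear_def)

lemma C_lin: "linear (\<lambda>u. C u v)" "linear (\<lambda>v. C u v)"
  using C_bil by (auto simp: bilinear_def)

lemmas jet_simps = linear_neg[OF linJ] linear_neg[OF B_lin] linear_neg[OF B_lin'(1)] linear_neg[OF B_lin'(2)]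
  linear_neg[OF C_lin(1)] linear_neg[OF C_lin(2)]
  linear_add[OF linJ] linear_diff[OF linJ]

lemmas jet_linear = linear_add[OF linJ] linear_add[OF B_lin] linear_add[OF B_lin'(1)] linear_add[OF B_lin'(2)]
  linear_add[OF C_lin(1)] linear_add[OF C_lin(2)]
  linear_cmul[OF linJ] linear_cmul[OF B_lin] linear_cmul[OF B_lin'(1)] linear_cmul[OF B_lin'(2)]
  linear_cmul[OF C_lin(1)] linear_cmul[OF C_lin(2)]

definition DF :: "'e \<Rightarrow> 'e \<Rightarrow> 'e \<Rightarrow> real" where "DF u v w = B u v (J w) + h v (C u w)"

definition dF :: "'e \<Rightarrow> 'e \<Rightarrow> 'e \<Rightarrow> real" where "dF u v w = DF u v w - DF v u w + DF w u v"

text \<open>The Nijenhuis tensor on constant fields: the bracket of the fields themselves vanishes,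
  and the other brackets produce derivatives of \<open>J\<close>.\<close>

definition nij :: "'e \<Rightarrow> 'e \<Rightarrow> 'e \<Rightarrow> real" where
  "nij u v w = h (C (J u) v - C (J v) u - J (C u v) + J (C v u)) w"

lemma DF_skew: "DF u v w = - DF u w v"
  using B_J[of u v "J w"] B_sym[of u "J v" w] sym[of v "C u w"] sym[of "J v" "C u (J w)"]
  by (simp add: DF_def C_J JJ jet_simps h_simps h_skew hJ sym[of "C u v"])

lemma dF_skew: "skew3 dF"
  unfolding skew3_def dF_def using DF_skew by (smt (verit, best))

lemma nij_type: "nij u (J v) w = nij (J u) v w"
  by (simp add: nij_def C_J JJ jet_simps h_simps)

text \<open>The torsion of the connection of Friedrich and Ivanov.\<close>

definition canonical_torsion :: "'e \<Rightarrow> 'e \<Rightarrow> 'e \<Rightarrow> real" where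
  "canonical_torsion u v w = - dF (J u) (J v) (J w) + nij u v w"

context
  fixes \<Gamma> :: "'e \<Rightarrow> 'e \<Rightarrow> 'e"
  assumes metric: "B u v w = h (\<Gamma> u v) w + h v (\<Gamma> u w)"
    and compat: "C u v + \<Gamma> u (J v) = J (\<Gamma> u v)"
    and skew: "skew3 (\<lambda>u v w. h (\<Gamma> u v - \<Gamma> v u) w)"
begin

abbreviation (input) "tor u v w \<equiv> h (\<Gamma> u v - \<Gamma> v u) w"

lemma C_eq: "C u v = J (\<Gamma> u v) - \<Gamma> u (J v)"
  using compat[of u v] by (simp add: algebra_simps)

text \<open>Since the connection preserves the metric and \<open>J\<close>, the derivatives of both
  are expressed by \<Gamma>; in the alternating sum only differences of the two lower orders of
  \<Gamma> survive.\<close>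

lemma dF_torsion: "dF u v w = tor u v (J w) + tor v w (J u) + tor w u (J v)"
proof -
  have "DF u v w = h (\<Gamma> u v) (J w) - h (\<Gamma> u w) (J v)" for u v w
    by (simp add: DF_def metric C_eq h_simps sym[of v "J _"] h_skew)
  then show ?thesis by (simp add: dF_def h_simps)
qed

lemma nij_torsion: "nij u v w = tor u v w - tor (J u) (J v) w - tor (J u) v (J w) - tor u (J v) (J w)"
  by (simp add: nij_def C_eq h_simps jet_simps JJ h_skew)

lemma nij_skew: "skew3 nij"
  unfolding skew3_def nij_torsion using skew3D[OF skew] by (smt (verit, best))

text \<open>Inserting \<open>J\<close> into all slots of \<open>dF_torsion\<close> gives exactly the
  three rotated torsion terms that \<open>nij_torsion\<close> subtracts, so only the torsion itself
  is left.\<close>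

lemma torsion_canonical: "tor u v w = canonical_torsion u v w"
proof -
  define t where "t u v w = tor u v w" for u v w
  have t: "skew3 t" using skew unfolding t_def .
  have tn: "t u v (- w) = - t u v w" for u v w by (simp add: t_def h_simps)
  note dF = dF_torsion[folded t_def] and nij = nij_torsion[folded t_def]
  have "t u v w = canonical_torsion u v w"
    unfolding canonical_torsion_def dF nij JJ tn
    using skew3D(1)[OF t, of "J v" u "J w"] skew3D(2)[OF t, of "J v" "J w" u]
      skew3D(1)[OF t, of "J w" "J u" v] skew3D(2)[OF t, of "J u" v "J w"] by linarith
  then show ?thesis by (simp only: t_def)
qed

end

definition koszul :: "'e \<Rightarrow> 'e \<Rightarrow> 'e \<Rightarrow> real" where
  "koszul u v w = (B u v w + B v u w - B w u v) / 2"

text \<open>\<open>koszul\<close> gives the Christoffel symbols of the Levi-Civita connection (with lowered index), and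
  \<open>nablaJ u v w\<close> is $g((\nabla^g_u J) v, w)$.\<close>

definition nablaJ :: "'e \<Rightarrow> 'e \<Rightarrow> 'e \<Rightarrow> real" where
  "nablaJ u v w = h (C u v) w + koszul u (J v) w + koszul u v (J w)"

lemma koszul_neg: "koszul (- u) v w = - koszul u v w" "koszul u (- v) w = - koszul u v w"
  "koszul u v (- w) = - koszul u v w"
  by (simp_all add: koszul_def jet_simps field_simps)

lemma dF_trilinear: "trilinear dF"
  unfolding trilinear_def dF_def DF_def
  by (intro conjI allI linearI) (simp_all add: jet_linear h_simps algebra_simps)

lemma nij_trilinear: "trilinear nij"
  unfolding trilinear_def nij_def
  by (intro conjI allI linearI) (simp_all add: jet_linear h_simps algebra_simps)

lemma koszul_trilinear: "trilinear koszul"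
  unfolding trilinear_def koszul_def
  by (intro conjI allI linearI) (simp_all add: jet_linear field_simps)

lemma canonical_trilinear: "trilinear canonical_torsion"
  using dF_trilinear nij_trilinear
  unfolding trilinear_def canonical_torsion_def linear_iff by (simp add: jet_linear algebra_simps)

lemma nablaJ_neg: "nablaJ (- u) v w = - nablaJ u v w" "nablaJ u (- v) w = - nablaJ u v w" "nablaJ u v (- w) = - nablaJ u v w"
  by (simp_all add: nablaJ_def jet_simps koszul_neg h_simps)

lemma koszul_sym: "koszul u v w = koszul v u w"
  using B_sym[of w u v] by (simp add: koszul_def)

lemma koszul_metric: "koszul u v w + koszul u w v = B u v w"
  using B_sym[of u v w] B_sym[of v u w] B_sym[of w u v] by (simp add: koszul_def field_simps)

lemma nablaJ_skew: "nablaJ u v w = - nablaJ u w v"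
  using koszul_metric[of u "J v" w] koszul_metric[of u "J w" v] DF_skew[of u v w] B_sym[of u "J v" w]
    B_sym[of u "J w" v] sym[of v "C u w"] sym[of w "C u v"]
  unfolding nablaJ_def DF_def by linarith

lemma nablaJ_J: "nablaJ u (J v) w = nablaJ u v (J w)"
  by (simp add: nablaJ_def C_J JJ h_simps h_skew koszul_neg)

text \<open>The Christoffel terms cancel because \<open>koszul\<close> is symmetric in its first two
  arguments; the same symmetry yields \<open>nij_nablaJ\<close>. Thus both tensors depend on the jet
  only through the Levi-Civita derivative of \<open>J\<close>.\<close>

lemma dF_nablaJ: "dF u v w = nablaJ u w v + nablaJ v u w + nablaJ w v u"
proof -
  have D: "DF u v w = nablaJ u w v + koszul u v (J w) - koszul u w (J v)" for u v w
    using koszul_metric[of u v "J w"] sym[of v "C u w"] by (simp add: DF_def nablaJ_def)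
  have "dF u v w = DF u v w + DF v w u + DF w u v"
    using DF_skew[of v u w] by (simp add: dF_def)
  then show ?thesis
    using koszul_sym[of u v "J w"] koszul_sym[of v w "J u"] koszul_sym[of w u "J v"] unfolding D by linarith
qed

lemma nij_nablaJ: "nij u v w = nablaJ (J u) v w - nablaJ (J v) u w - nablaJ v u (J w) + nablaJ u v (J w)"
  using koszul_sym[of "J u" "J v" w] koszul_sym[of "J u" v "J w"] koszul_sym[of "J v" u "J w"] koszul_sym[of u v w]
  by (simp add: nij_def nablaJ_def h_simps h_skew JJ koszul_neg)

context
  assumes nij: "skew3 nij"
begin

lemma canonical_torsion_skew: "skew3 canonical_torsion"
  unfolding skew3_def canonical_torsion_def
  using skew3D[OF nij] skew3D[OF dF_skew] by (smt (verit, best))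

text \<open>This says that \<open>J\<close> is parallel for the Levi-Civita connection plus half of
  \<open>canonical_torsion\<close>. All terms become values of \<open>nablaJ\<close>; the total
  skewness of N supplies the linear relation that the symmetries of \<open>nablaJ\<close> alone do
  not give.\<close>

lemma nablaJ_canonical: "2 * nablaJ u v w + (canonical_torsion u (J v) w + canonical_torsion u v (J w)) = 0"
proof -
  have qs: "nablaJ a b (J c) = - nablaJ a c (J b)" for a b c
    using nablaJ_skew[of a b "J c"] nablaJ_J[of a c b] by simp
  have "nij (J u) v w = - nij (J u) w v" by (rule skew3D(2)[OF nij])
  moreover have "nij u v (J w) = nij (J u) v w"
    using skew3D(2)[OF nij, of u v "J w"] skew3D(2)[OF nij, of "J u" v w] nij_type[of u w v] by simp
  moreover have "canonical_torsion u (J v) w + canonical_torsion u v (J w) =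
      nij (J u) v w + nij u v (J w) - dF (J u) (J (J v)) (J w) - dF (J u) (J v) (J (J w))"
    by (simp add: canonical_torsion_def nij_type)
  moreover have "dF (J u) (J (J v)) (J w) = - nablaJ (J u) w (J v) + nablaJ v u w + nablaJ (J w) u (J v)"
    unfolding dF_nablaJ by (simp add: JJ nablaJ_neg nablaJ_J qs[of "J w" v u] qs[of "J u" v w])
  moreover have "dF (J u) (J v) (J (J w)) = - nablaJ (J u) w (J v) - nablaJ (J v) u (J w) + nablaJ w v u"
    unfolding dF_nablaJ by (simp add: JJ nablaJ_neg nablaJ_J)
  moreover have "nij (J u) v w = - nablaJ u v w - nablaJ (J v) u (J w) + nablaJ v u w + nablaJ (J u) v (J w)"
    unfolding nij_nablaJ by (simp add: JJ nablaJ_neg nablaJ_J)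
  moreover have "nij (J u) w v = - nablaJ u w v - nablaJ (J w) u (J v) + nablaJ w u v + nablaJ (J u) w (J v)"
    unfolding nij_nablaJ by (simp add: JJ nablaJ_neg nablaJ_J)
  ultimately show ?thesis
    using nablaJ_skew[of u v w] nablaJ_skew[of v u w] nablaJ_skew[of w u v] qs[of "J u" v w] qs[of "J v" u w] qs[of "J w" u v]
    by linarith
qed

text \<open>Adding half of a totally skew tensor to the Levi-Civita connection keeps it metric and
  makes that tensor its torsion; only the compatibility with \<open>J\<close> rests on
  \<open>nablaJ_canonical\<close>.\<close>

lemma canonical_connection:
  assumes \<Gamma>: "\<And>u v w. h (\<Gamma> u v) w = koszul u v w + canonical_torsion u v w / 2"
  shows "B u v w = h (\<Gamma> u v) w + h v (\<Gamma> u w)"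
    and "C u v + \<Gamma> u (J v) = J (\<Gamma> u v)"
    and "h (\<Gamma> u v - \<Gamma> v u) w = canonical_torsion u v w"
proof -
  show "B u v w = h (\<Gamma> u v) w + h v (\<Gamma> u w)"
    using koszul_metric[of u v w] skew3D(2)[OF canonical_torsion_skew, of u v w]
    by (simp add: sym[of v] \<Gamma>)
  show "h (\<Gamma> u v - \<Gamma> v u) w = canonical_torsion u v w"
    using skew3D(1)[OF canonical_torsion_skew, of u v w] koszul_sym[of u v w]
    by (simp add: h_simps \<Gamma>)
  show "C u v + \<Gamma> u (J v) = J (\<Gamma> u v)"
  proof (rule nondegenerate)
    fix w
    show "h (C u v + \<Gamma> u (J v)) w = h (J (\<Gamma> u v)) w"
      using nablaJ_canonical[of u v w] by (simp add: h_simps h_skew \<Gamma> nablaJ_def field_simps)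
  qed
qed

end

end

section \<open>Almost Hermitian structures in a chart\<close>

lemma isCont_param:
  fixes L :: "'c::euclidean_space \<Rightarrow> 'a::euclidean_space \<Rightarrow> 'b::real_normed_vector" and Y :: "'c::euclidean_space \<Rightarrow> 'a::euclidean_space"
  assumes S: "open S" "x \<in> S" and L: "\<And>v. isCont (\<lambda>y. L y v) x"
    and lin: "\<And>y. y \<in> S \<Longrightarrow> linear (L y)" and Y: "isCont Y x"
  shows "isCont (\<lambda>y. L y (Y y)) x"
proof -
  have "isCont (\<lambda>y. \<Sum>b\<in>Basis. (Y y \<bullet> b) *\<^sub>R L y b) x"
    by (intro continuous_sum continuous_scaleR continuous_inner continuous_const L Y)
  moreover have "eventually (\<lambda>y. (\<Sum>b\<in>Basis. (Y y \<bullet> b) *\<^sub>R L y b) = L y (Y y)) (nhds x)"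
    using S by (auto simp: eventually_nhds linear_expand[OF lin, symmetric] intro!: exI[of _ S])
  ultimately show ?thesis by (simp add: isCont_cong)
qed

lemma ext_deriv_2: "ext_deriv 2 \<alpha> x [u, v, w] =
    frechet_derivative (\<lambda>y. \<alpha> y [v, w]) (at x) u - frechet_derivative (\<lambda>y. \<alpha> y [u, w]) (at x) v +
    frechet_derivative (\<lambda>y. \<alpha> y [u, v]) (at x) w"
  by (simp add: ext_deriv_def numeral_2_eq_2)

lemma ext_deriv_4: "ext_deriv 4 \<alpha> x [a, b, c, d, e] =
    frechet_derivative (\<lambda>y. \<alpha> y [b, c, d, e]) (at x) a - frechet_derivative (\<lambda>y. \<alpha> y [a, c, d, e]) (at x) b +
    frechet_derivative (\<lambda>y. \<alpha> y [a, b, d, e]) (at x) c - frechet_derivative (\<lambda>y. \<alpha> y [a, b, c, e]) (at x) d +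
    frechet_derivative (\<lambda>y. \<alpha> y [a, b, c, d]) (at x) e"
  by (simp add: ext_deriv_def eval_nat_numeral)

lemma hodge_cong: "(\<And>vs. length vs = k \<Longrightarrow> \<alpha> vs = \<beta> vs) \<Longrightarrow> hodge k h \<alpha> ws = hodge k h \<beta> ws"
  unfolding hodge_def by (intro arg_cong2[where f = "(/)"] sum.cong refl) auto

lemma hodge_cmult: "hodge k h (\<lambda>vs. c * \<alpha> vs) ws = c * hodge k h \<alpha> ws"
  by (simp add: hodge_def sum_distrib_left mult.assoc)

locale metric_chart =
  fixes S :: "'e::euclidean_space set" and G :: "'e metric"
  assumes open_S: "open S"
    and G_smooth: "\<And>u v. smooth_on S (\<lambda>x. G x u v)"
    and G_inner: "\<And>x. x \<in> S \<Longrightarrow> inner_product (G x)"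
begin

definition dG :: "'e \<Rightarrow> 'e \<Rightarrow> 'e \<Rightarrow> 'e \<Rightarrow> real" where
  "dG x u v w = frechet_derivative (\<lambda>y. G y v w) (at x) u"

lemma G_lin: "x \<in> S \<Longrightarrow> linear (\<lambda>u. G x u v)" "x \<in> S \<Longrightarrow> linear (\<lambda>v. G x u v)"
  using inner_product.lin[OF G_inner] by auto

lemma G_deriv: "x \<in> S \<Longrightarrow> ((\<lambda>y. G y v w) has_derivative (\<lambda>u. dG x u v w)) (at x)"
  using smooth_on_has_derivative[OF G_smooth] by (simp add: dG_def[abs_def])

lemma G_differentiable: "x \<in> S \<Longrightarrow> (\<lambda>y. G y v w) differentiable (at x)"
  by (rule smooth_on_differentiable[OF G_smooth])

lemma dG_lin: "x \<in> S \<Longrightarrow> linear (\<lambda>u. dG x u v w)" "x \<in> S \<Longrightarrow> linear (\<lambda>v. dG x u v w)"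
  "x \<in> S \<Longrightarrow> linear (\<lambda>w. dG x u v w)"
  using has_derivative_linear[OF G_deriv]
    linear_frechet_param[OF open_S _ G_differentiable G_lin(1)]
    linear_frechet_param[OF open_S _ G_differentiable G_lin(2)]
  by (auto simp: dG_def)

lemma G_deriv_fields:
  assumes x: "x \<in> S" and Y: "(Y has_derivative Y') (at x)" and Z: "(Z has_derivative Z') (at x)"
  shows "((\<lambda>y. G y (Y y) (Z y)) has_derivative
    (\<lambda>u. dG x u (Y x) (Z x) + G x (Y' u) (Z x) + G x (Y x) (Z' u))) (at x)"
  using has_derivative_param2[OF open_S x G_differentiable[OF x] G_lin Y Z] by (simp add: dG_def)

lemma G_cont:
  assumes x: "x \<in> S" and "isCont Y x" "isCont Z x"
  shows "isCont (\<lambda>y. G y (Y y) (Z y)) x"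
proof -
  have "isCont (\<lambda>y. G y v w) x" for v w
    using has_derivative_continuous[OF G_deriv[OF x]] .
  then have Z: "isCont (\<lambda>y. G y v (Z y)) x" for v
    by (rule isCont_param[where L = "\<lambda>y. G y v", OF open_S x _ G_lin(2) assms(3)])
  show ?thesis
    by (rule isCont_param[where L = "\<lambda>y v. G y v (Z y)", OF open_S x Z G_lin(1) assms(2)])
qed

end

locale hermitian_chart = metric_chart S G for S :: "'e::euclidean_space set" and G +
  fixes I :: "'e endo"
  assumes I_smooth: "\<And>u. smooth_on S (\<lambda>x. I x u)"
    and I_lin: "\<And>x. x \<in> S \<Longrightarrow> linear (I x)"
    and I_I: "\<And>x u. x \<in> S \<Longrightarrow> I x (I x u) = - u"
    and G_I: "\<And>x u v. x \<in> S \<Longrightarrow> G x (I x u) (I x v) = G x u v"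
begin

definition dI :: "'e \<Rightarrow> 'e \<Rightarrow> 'e \<Rightarrow> 'e" where
  "dI x u v = frechet_derivative (\<lambda>y. I y v) (at x) u"

lemma I_deriv: "x \<in> S \<Longrightarrow> ((\<lambda>y. I y v) has_derivative (\<lambda>u. dI x u v)) (at x)"
  using smooth_on_has_derivative[OF I_smooth] by (simp add: dI_def[abs_def])

lemma I_differentiable: "x \<in> S \<Longrightarrow> (\<lambda>y. I y v) differentiable (at x)"
  by (rule smooth_on_differentiable[OF I_smooth])

lemma dI_lin: "x \<in> S \<Longrightarrow> linear (\<lambda>u. dI x u v)" "x \<in> S \<Longrightarrow> linear (\<lambda>v. dI x u v)"
  using has_derivative_linear[OF I_deriv] linear_frechet_param[OF open_S _ I_differentiable I_lin]
  by (auto simp: dI_def)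

lemma I_deriv_field:
  assumes x: "x \<in> S" and Y: "(Y has_derivative Y') (at x)"
  shows "((\<lambda>y. I y (Y y)) has_derivative (\<lambda>u. dI x u (Y x) + I x (Y' u))) (at x)"
  using has_derivative_param[OF open_S x I_differentiable[OF x] I_lin Y] by (simp add: dI_def)

lemma I_cont: "x \<in> S \<Longrightarrow> isCont Y x \<Longrightarrow> isCont (\<lambda>y. I y (Y y)) x"
  by (rule isCont_param[OF open_S _ has_derivative_continuous[OF I_deriv] I_lin])

text \<open>The two relations on derivatives demanded by \<open>hermitian_jet\<close> arise by
  differentiating J^2 = -1 and g(JX, JY) = g(X, Y).\<close>

lemma jet: 
  assumes x: "x \<in> S" shows "hermitian_jet (G x) (I x) (dG x) (dI x)"
proof -
  interpret inner_product "G x" by (rule G_inner[OF x])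
  show ?thesis
  proof (intro hermitian_jet.intro hermitian_jet_axioms.intro G_inner[OF x])
    show "linear (I x)" by (rule I_lin[OF x])
    show "I x (I x u) = - u" "G x (I x u) (I x v) = G x u v" for u v
      using I_I[OF x] G_I[OF x] by auto
    show "linear (\<lambda>u. dG x u v w)" "bilinear (dG x u)" for u v w
      using dG_lin[OF x] by (auto simp: bilinear_def)
    show "bilinear (dI x)" using dI_lin[OF x] by (auto simp: bilinear_def)
    have "frechet_derivative (\<lambda>y. G y v w) (at x) = frechet_derivative (\<lambda>y. G y w v) (at x)" for v w
      by (rule frechet_derivative_transform_within_open[OF G_differentiable[OF x] open_S x])
        (rule inner_product.sym[OF G_inner])
    then show "dG x u v w = dG x u w v" for u v w by (simp add: dG_def)
    show "dI x u (I x v) = - I x (dI x u v)" for u v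
    proof -
      have "((\<lambda>y. - v) has_derivative (\<lambda>u. dI x u (I x v) + I x (dI x u v))) (at x)"
        by (rule has_derivative_transform_within_open[OF I_deriv_field[OF x I_deriv[OF x]] open_S x])
          (simp add: I_I)
      from fun_cong[OF has_derivative_unique[OF this has_derivative_const], of u] show ?thesis
        by (simp add: eq_neg_iff_add_eq_0)
    qed
    show "dG x u (I x v) (I x w) + G x (dI x u v) (I x w) + G x (I x v) (dI x u w) = dG x u v w" for u v w
    proof -
      have "((\<lambda>y. G y v w) has_derivative
         (\<lambda>u. dG x u (I x v) (I x w) + G x (dI x u v) (I x w) + G x (I x v) (dI x u w))) (at x)"
        by (rule has_derivative_transform_within_open[OF G_deriv_fields[OF x I_deriv[OF x] I_deriv[OF x]] open_S x])
          (simp add: G_I)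
      from fun_cong[OF has_derivative_unique[OF this G_deriv[OF x]], of u] show ?thesis .
    qed
  qed
qed

abbreviation "DF x \<equiv> hermitian_jet.DF (G x) (I x) (dG x) (dI x)"
abbreviation "dF x \<equiv> hermitian_jet.dF (G x) (I x) (dG x) (dI x)"
abbreviation "nij x \<equiv> hermitian_jet.nij (G x) (I x) (dI x)"
abbreviation "canonical x \<equiv> hermitian_jet.canonical_torsion (G x) (I x) (dG x) (dI x)"

lemma F_deriv:
  assumes x: "x \<in> S"
  shows "((\<lambda>y. fundamental_form G I y [v, w]) has_derivative (\<lambda>u. DF x u v w)) (at x)"
  using G_deriv_fields[OF x has_derivative_const[of v] I_deriv[OF x, of w]]
  by (simp add: fundamental_form_def hermitian_jet.DF_def[OF jet[OF x]] linear_0[OF G_lin(1)[OF x]])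

lemma ext_deriv_fundamental_form:
  assumes x: "x \<in> S"
  shows "ext_deriv 2 (fundamental_form G I) x [u, v, w] = dF x u v w"
proof -
  have "frechet_derivative (\<lambda>y. fundamental_form G I y [v, w]) (at x) u = DF x u v w" for u v w
    using fun_cong[OF frechet_derivative_at[OF F_deriv[OF x]]] by simp
  then show ?thesis unfolding ext_deriv_2 hermitian_jet.dF_def[OF jet[OF x]] by simp
qed

lemma nijenhuis_tensor_jet:
  assumes x: "x \<in> S"
  shows "nijenhuis_tensor G I x [u, v, w] = nij x u v w"
  by (simp add: nijenhuis_tensor_def nijenhuis_def lie_bracket_def hermitian_jet.nij_def[OF jet[OF x]]
      dI_def linear_neg[OF I_lin[OF x]] algebra_simps)

lemma F_skew:
  assumes x: "x \<in> S"
  shows "fundamental_form G I x [u, v] = - fundamental_form G I x [v, u]"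
  using hermitian_jet.h_skew[OF jet[OF x], of v u] inner_product.sym[OF G_inner[OF x], of "I x v" u]
  by (simp add: fundamental_form_def)

lemma Phi_form_jet:
  assumes x: "x \<in> S"
  shows "Phi_form G I x [a, b, c, d] =
    fundamental_form G I x [a, b] * fundamental_form G I x [c, d]
    - fundamental_form G I x [a, c] * fundamental_form G I x [b, d]
    + fundamental_form G I x [a, d] * fundamental_form G I x [b, c]"
  unfolding Phi_form_def by (rule wedge22) (rule F_skew[OF x])

lemma Phi_deriv:
  assumes x: "x \<in> S"
  shows "((\<lambda>y. Phi_form G I y [a, b, c, d]) has_derivative (\<lambda>u.
     fundamental_form G I x [a, b] * DF x u c d + DF x u a b * fundamental_form G I x [c, d]
     - (fundamental_form G I x [a, c] * DF x u b d + DF x u a c * fundamental_form G I x [b, d])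
     + (fundamental_form G I x [a, d] * DF x u b c + DF x u a d * fundamental_form G I x [b, c]))) (at x)"
  by (rule has_derivative_transform_within_open[OF _ open_S x Phi_form_jet[symmetric]])
    (intro has_derivative_add has_derivative_diff has_derivative_mult F_deriv[OF x])

end

section \<open>Almost hyperhermitian charts and the codifferential of \<Phi>\<close>

locale quat_chart = metric_chart S G for S :: "(real^8) set" and G +
  fixes I J K :: "(real^8) endo"
  assumes herm: "hermitian_chart S G I" "hermitian_chart S G J" "hermitian_chart S G K"
    and I_J: "\<And>x u. x \<in> S \<Longrightarrow> I x (J x u) = K x u"
    and J_I: "\<And>x u. x \<in> S \<Longrightarrow> J x (I x u) = - K x u"
begin

sublocale HI: hermitian_chart S G I by (rule herm)
sublocale HJ: hermitian_chart S G J by (rule herm)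
sublocale HK: hermitian_chart S G K by (rule herm)

lemma quat:
  assumes x: "x \<in> S" shows "quaternionic (G x) (I x) (J x) (K x)"
  by (intro quaternionic.intro quaternionic_axioms.intro G_inner[OF x] HI.I_lin HJ.I_lin HI.I_I HJ.I_I
      I_J J_I HI.G_I HJ.G_I x)

lemma cyclic: "quat_chart S G J K I"
  using quaternionic.mult[OF quat]
  by (intro quat_chart.intro quat_chart_axioms.intro herm metric_chart_axioms) auto

lemma qframe_cont:
  assumes x: "x \<in> S" and ab: "isCont a x" "isCont b x" and k: "k < 8"
  shows "isCont (\<lambda>y. quaternionic.qframe (I y) (J y) (K y) (a y) (b y) k) x"
proof -
  have "\<forall>k<8. isCont (\<lambda>y. [a y, I y (a y), J y (a y), K y (a y), b y, I y (b y), J y (b y), K y (b y)] ! k) x"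
    by (simp add: all_less_8 ab HI.I_cont[OF x] HJ.I_cont[OF x] HK.I_cont[OF x])
  moreover have "eventually (\<lambda>y. quaternionic.qframe (I y) (J y) (K y) (a y) (b y) k =
     [a y, I y (a y), J y (a y), K y (a y), b y, I y (b y), J y (b y), K y (b y)] ! k) (nhds x)"
    using open_S x quaternionic.qframe_def[OF quat] by (auto simp: eventually_nhds)
  ultimately show ?thesis using k by (simp add: isCont_cong)
qed

lemma volume_cont:
  assumes x: "x \<in> S" and E: "\<And>k. k < 8 \<Longrightarrow> isCont (\<lambda>y. E y k) x"
  shows "isCont (\<lambda>y. volume_form (G y) (map (E y) [0..<8])) x"
proof -
  have 1: "isCont (\<lambda>y. ldet 8 (\<lambda>i j. G y (coord_frame i) (coord_frame j))) x"
    unfolding ldet_def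
    by (intro continuous_sum continuous_mult continuous_const continuous_prod G_cont[OF x])
  have 2: "isCont (\<lambda>y. ldet 8 (\<lambda>i j. coord_frame i \<bullet> (map (E y) [0..<8] ! j))) x"
    unfolding ldet_def
  proof (intro continuous_sum continuous_mult continuous_const continuous_prod continuous_inner)
    fix \<sigma> i assume "\<sigma> \<in> {\<sigma>. \<sigma> permutes {..<8::nat}}" "i \<in> {..<8::nat}"
    then have "\<sigma> i < 8" using permutes_in_image[of \<sigma> "{..<8}" i] by simp
    then show "isCont (\<lambda>y. map (E y) [0..<8] ! \<sigma> i) x" using E by simp
  qed
  show ?thesis
    using continuous_mult[OF isCont_o2[OF 1 isCont_real_sqrt] 2]
    unfolding volume_form_def by simp
qed

lemma Phi_form_Phi:
  assumes x: "x \<in> S" and "length vs = 4"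
  shows "Phi_form G I x vs = quaternionic.Phi (G x) (I x) vs"
proof -
  obtain a b c d where "vs = [a, b, c, d]" using assms(2) by (auto simp: numeral_eq_Suc length_Suc_conv)
  then show ?thesis
    by (simp add: HI.Phi_form_jet[OF x] quaternionic.Phi_def[OF quat[OF x]] quaternionic.F_def[OF quat[OF x]]
        fundamental_form_def)
qed

text \<open>The sign relating \<open>\<Phi>\<close> to its Hodge dual, i.e. the orientation of the quaternionic frames relative
  to that of the chart, is locally constant, since such frames can be chosen continuously.\<close>

lemma hodge_Phi_form:
  assumes x: "x \<in> S" and ad: "quaternionic.adapted (G x) (I x) (J x) (K x) e f"
  shows "eventually (\<lambda>y. \<forall>vs. length vs = 4 \<longrightarrow> hodge 4 (G y) (Phi_form G I y) vs =
     volume_form (G x) (map (quaternionic.qframe (I x) (J x) (K x) e f) [0..<8]) * Phi_form G I y vs) (nhds x)"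
proof -
  \<comment> \<open>Gram-Schmidt at the point \<open>y\<close>, started from the fixed vectors
    \<open>e\<close> and \<open>f\<close>. It returns \<open>e\<close> and \<open>f\<close> at
    \<open>x\<close> and depends continuously on \<open>y\<close>.\<close>
  define ey where "ey y = (1 / sqrt (G y e e)) *\<^sub>R e" for y
  define py where "py y = f - G y f (ey y) *\<^sub>R ey y - G y f (I y (ey y)) *\<^sub>R I y (ey y)
     - G y f (J y (ey y)) *\<^sub>R J y (ey y) - G y f (K y (ey y)) *\<^sub>R K y (ey y)" for y
  define fy where "fy y = (1 / sqrt (G y (py y) (py y))) *\<^sub>R py y" for y
  note [simp] = quaternionic.adapted_def[OF quat[OF x]]
  have e: "e \<noteq> 0" using ad linear_0[OF G_lin(1)[OF x]] by auto
  have "G y e e > 0" if "y \<in> S" for y using inner_product.pos[OF G_inner[OF that] e] .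
  note epos = this
  have ex: "ey x = e" and px: "py x = f" and fx: "fy x = f" using ad by (auto simp: ey_def py_def fy_def)
  have f: "f \<noteq> 0" using ad linear_0[OF G_lin(1)[OF x]] by auto
  have G1: "isCont (\<lambda>y. 1 / sqrt (G y (a y) (a y))) x" if "isCont a x" "G x (a x) (a x) > 0" for a
    using that by (intro continuous_divide continuous_const isCont_o2[OF G_cont[OF x] isCont_real_sqrt]) auto
  have ec: "isCont ey x"
    unfolding ey_def[abs_def] using epos[OF x] by (intro continuous_scaleR G1 continuous_const) auto
  have pc: "isCont py x"
    unfolding py_def[abs_def]
    by (intro continuous_diff continuous_scaleR continuous_const G_cont[OF x] ec HI.I_cont[OF x] HJ.I_cont[OF x] HK.I_cont[OF x])
  have fc: "isCont fy x"
    unfolding fy_def[abs_def] using inner_product.pos[OF G_inner[OF x] f] px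
    by (intro continuous_scaleR G1 pc) auto
  define V where "V y = volume_form (G y) (map (quaternionic.qframe (I y) (J y) (K y) (ey y) (fy y)) [0..<8])" for y
  have "isCont V x"
    unfolding V_def[abs_def] by (rule volume_cont[OF x qframe_cont[OF x ec fc]])
  then have "eventually (\<lambda>y. \<bar>V y - V x\<bar> < 1) (nhds x)"
    using tendstoD[of V "V x" "nhds x" 1] by (simp add: isCont_def tendsto_at_iff_tendsto_nhds dist_real_def)
  moreover have "eventually (\<lambda>y. py y \<noteq> 0) (nhds x)"
  proof (rule tendsto_imp_eventually_ne)
    show "(py \<longlongrightarrow> py x) (nhds x)" using pc unfolding isCont_def tendsto_at_iff_tendsto_nhds .
  qed (use f px in simp)
  moreover have "eventually (\<lambda>y. y \<in> S) (nhds x)"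
    using open_S x by (simp add: eventually_nhds) blast
  ultimately show ?thesis
  proof eventually_elim
    case (elim y)
    interpret Qy: quaternionic "G y" "I y" "J y" "K y" by (rule quat[OF elim(3)])
    have "Qy.adapted (ey y) (fy y)"
    proof -
      have "G y (ey y) (ey y) = 1" using Qy.h_normalize_vec[OF e] by (simp add: Qy.normalize_vec_def ey_def)
      moreover have "py y = Qy.project_off (ey y) f" by (simp add: py_def Qy.project_off_def)
      ultimately show ?thesis using Qy.adapted_gram_schmidt[of "ey y" f] elim(2)
        by (simp add: fy_def Qy.normalize_vec_def)
    qed
    note hod = Qy.hodge_Phi[OF this] and fr = Qy.adapted_frame[OF this]
    interpret Qx: quaternionic "G x" "I x" "J x" "K x" by (rule quat[OF x])
    \<comment> \<open>Both volumes are 1 or -1 and differ by less than 1, hence coincide.\<close>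
    have "(V y)\<^sup>2 = 1" using Qy.volume_frame[OF fr] by (simp add: V_def)
    moreover have "(V x)\<^sup>2 = 1" using Qx.volume_frame[OF Qx.adapted_frame[OF ad]] by (simp add: V_def ex fx)
    ultimately have "V y = V x" using elim(1) by (auto simp: power2_eq_1_iff)
    show ?case
    proof (intro allI impI)
      fix vs :: "(real^8) list" assume "length vs = 4"
      then show "hodge 4 (G y) (Phi_form G I y) vs =
         volume_form (G x) (map (Qx.qframe e f) [0..<8]) * Phi_form G I y vs"
        using hod[of vs] hodge_cong[of 4 "Phi_form G I y" Qy.Phi "G y" vs] Phi_form_Phi[OF elim(3)] \<open>V y = V x\<close>
        by (simp add: V_def ex fx)
    qed
  qed
qed

definition dF_form :: "real^8 \<Rightarrow> (real^8) form" where
  "dF_form x vs = HI.dF x (vs ! 0) (vs ! 1) (vs ! 2)"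

lemma dF_form_alternating:
  assumes x: "x \<in> S" shows "alternating 3 (dF_form x)"
proof (rule alternating_3I)
  note sk = hermitian_jet.dF_skew[OF HI.jet[OF x], unfolded skew3_def, rule_format]
  fix a b c
  show "linear (\<lambda>v. dF_form x [v, b, c])"
    using hermitian_jet.dF_trilinear[OF HI.jet[OF x]] by (simp add: dF_form_def trilinear_def)
  show "dF_form x [a, b, c] = - dF_form x [b, a, c]" "dF_form x [a, b, c] = - dF_form x [a, c, b]"
    using sk[of a b c] by (simp_all add: dF_form_def)
qed

lemma ext_deriv_Phi:
  assumes x: "x \<in> S" and "length vs = 5"
  shows "ext_deriv 4 (Phi_form G I) x vs = quaternionic.F_wedge (G x) (I x) (dF_form x) vs"
proof -
  obtain a b c d e where vs: "vs = [a, b, c, d, e]" using assms(2) by (auto simp: numeral_eq_Suc length_Suc_conv)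
  note D = fun_cong[OF frechet_derivative_at[OF HI.Phi_deriv[OF x]], symmetric]
  show ?thesis
    unfolding vs ext_deriv_4 D quaternionic.F_wedge_def[OF quat[OF x]]
    by (simp add: dF_form_def hermitian_jet.dF_def[OF HI.jet[OF x]] quaternionic.F_def[OF quat[OF x]]
        fundamental_form_def algebra_simps)
qed

text \<open>Near \<open>x\<close> the dual of \<Phi> is \<open>s\<close> times \<Phi> with a
  constant sign, so the sign passes through the derivative, and the exterior derivative of \<Phi> is
  F \<and> dF. The outer Hodge star is then evaluated by \<open>hodge_F_wedge\<close>, whose volume
  factor is the same \<open>s\<close>.\<close>

lemma codifferential_Phi:
  assumes x: "x \<in> S"
  shows "codifferential 4 G (Phi_form G I) x [X, Y, Z] = HI.dF x (I x X) (I x Y) (I x Z) +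
    wedge 1 2 (J_act I x (lee_form G I x)) (fundamental_form G I x) [X, Y, Z]"
proof -
  interpret Q: quaternionic "G x" "I x" "J x" "K x" by (rule quat[OF x])
  obtain e f where ad: "Q.adapted e f" using Q.adapted_exists by blast
  define s where "s = volume_form (G x) (map (Q.qframe e f) [0..<8])"
  obtain U where U: "open U" "x \<in> U"
    and hU: "\<And>y vs. y \<in> U \<Longrightarrow> length vs = 4 \<Longrightarrow> hodge 4 (G y) (Phi_form G I y) vs = s * Phi_form G I y vs"
    using hodge_Phi_form[OF x ad] unfolding eventually_nhds s_def by blast
  have D: "frechet_derivative (\<lambda>y. hodge 4 (G y) (Phi_form G I y) vs) (at x) u =
      s * frechet_derivative (\<lambda>y. Phi_form G I y vs) (at x) u" if l: "length vs = 4" for vs u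
  proof -
    obtain a b c d where vs: "vs = [a, b, c, d]" using l by (auto simp: numeral_eq_Suc length_Suc_conv)
    note P = HI.Phi_deriv[OF x, of a b c d, folded vs]
    have "((\<lambda>y. hodge 4 (G y) (Phi_form G I y) vs) has_derivative
        (\<lambda>u. s * frechet_derivative (\<lambda>y. Phi_form G I y vs) (at x) u)) (at x)"
      by (rule has_derivative_transform_within_open[OF has_derivative_mult_right[OF P[unfolded frechet_derivative_at[OF P]]] U])
        (simp add: hU l)
    from fun_cong[OF frechet_derivative_at[OF this]] show ?thesis by simp
  qed
  have "ext_deriv 4 (\<lambda>y. hodge 4 (G y) (Phi_form G I y)) x vs = s * Q.F_wedge (dF_form x) vs"
    if l: "length vs = 5" for vs
  proof -
    obtain a b c d e where vs: "vs = [a, b, c, d, e]" using l by (auto simp: numeral_eq_Suc length_Suc_conv)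
    show ?thesis
      unfolding ext_deriv_Phi[OF x l, symmetric] unfolding vs ext_deriv_4
      by (simp add: D algebra_simps)
  qed
  then have "codifferential 4 G (Phi_form G I) x [X, Y, Z] = - (s * hodge 5 (G x) (Q.F_wedge (dF_form x)) [X, Y, Z])"
    unfolding codifferential_def using hodge_cong[of 5 _ "\<lambda>vs. s * Q.F_wedge (dF_form x) vs"]
    by (simp add: hodge_cmult)
  also have "\<dots> = dF_form x [I x X, I x Y, I x Z] -
      (lee_form G I x [I x X] * Q.F [Y, Z] - lee_form G I x [I x Y] * Q.F [X, Z] + lee_form G I x [I x Z] * Q.F [X, Y])"
    using Q.hodge_F_wedge[OF ad dF_form_alternating[OF x], of X Y Z]
    by (simp add: s_def lee_form_def HI.ext_deriv_fundamental_form[OF x] dF_form_def)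
  also have "\<dots> = HI.dF x (I x X) (I x Y) (I x Z) +
    wedge 1 2 (J_act I x (lee_form G I x)) (fundamental_form G I x) [X, Y, Z]"
    unfolding wedge12[of "fundamental_form G I x", OF HI.F_skew[OF x]]
    by (simp add: J_act_def dF_form_def fundamental_form_def Q.F_def)
  finally show ?thesis .
qed

end

section \<open>Connections compatible with the structure at one point\<close>

context metric_chart begin

definition torsion :: "('e \<Rightarrow> 'e \<Rightarrow> 'e) \<Rightarrow> 'e \<Rightarrow> 'e \<Rightarrow> 'e \<Rightarrow> 'e \<Rightarrow> real" where
  "torsion \<Gamma> x u v w = G x (\<Gamma> u v - \<Gamma> v u) w"

lemma torsion_alternating:
  assumes x: "x \<in> S" and sk: "skew3 (torsion \<Gamma> x)"
  shows "alternating 3 (\<lambda>vs. torsion \<Gamma> x (vs ! 0) (vs ! 1) (vs ! 2))"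
proof (rule alternating_3I)
  fix a b c
  \<comment> \<open>\<Gamma> is not assumed linear; total skewness rotates the first argument into
    the slot where the metric provides linearity.\<close>
  have eq: "torsion \<Gamma> x v b c = torsion \<Gamma> x b c v" for v
    using skew3D(1)[OF sk, of v b c] skew3D(2)[OF sk, of b v c] by simp
  show "linear (\<lambda>v. torsion \<Gamma> x ([v, b, c] ! 0) ([v, b, c] ! 1) ([v, b, c] ! 2))"
    by (simp add: eq) (simp add: torsion_def G_lin(2)[OF x])
  show "torsion \<Gamma> x ([a, b, c] ! 0) ([a, b, c] ! 1) ([a, b, c] ! 2) = - torsion \<Gamma> x ([b, a, c] ! 0) ([b, a, c] ! 1) ([b, a, c] ! 2)"
    "torsion \<Gamma> x ([a, b, c] ! 0) ([a, b, c] ! 1) ([a, b, c] ! 2) = - torsion \<Gamma> x ([a, c, b] ! 0) ([a, c, b] ! 1) ([a, c, b] ! 2)"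
    using skew3D(1)[OF sk, of b a c] skew3D(2)[OF sk, of a c b] by simp_all
qed

lemma torsion_tensor_eq: "torsion_tensor G \<Gamma> x [u, v, w] = torsion (\<Gamma> x) x u v w"
  by (simp add: torsion_tensor_def torsion_def nabla_def lie_bracket_def)

end

context hermitian_chart begin

text \<open>\<Gamma> is the value of the Christoffel symbols at the single point \<open>x\<close>.
  Testing on constant fields makes the conditions algebraic in \<Gamma>, so existence and uniqueness
  can be decided point by point.\<close>

definition compatible :: "('e \<Rightarrow> 'e \<Rightarrow> 'e) \<Rightarrow> 'e \<Rightarrow> bool" where
  "compatible \<Gamma> x \<longleftrightarrow> (\<forall>u v w. dG x u v w = G x (\<Gamma> u v) w + G x v (\<Gamma> u w)) \<and>
     (\<forall>u v. dI x u v + \<Gamma> u (I x v) = I x (\<Gamma> u v)) \<and> skew3 (torsion \<Gamma> x)"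

lemma compatibleD:
  assumes "compatible \<Gamma> x"
  shows "dG x u v w = G x (\<Gamma> u v) w + G x v (\<Gamma> u w)" "dI x u v + \<Gamma> u (I x v) = I x (\<Gamma> u v)"
    "skew3 (\<lambda>u v w. G x (\<Gamma> u v - \<Gamma> v u) w)" "skew3 (torsion \<Gamma> x)"
  using assms unfolding compatible_def torsion_def[abs_def] by blast+

lemma compatible_torsion:
  assumes x: "x \<in> S" and c: "compatible \<Gamma> x"
  shows "torsion \<Gamma> x u v w = canonical x u v w"
  unfolding torsion_def by (rule hermitian_jet.torsion_canonical[OF jet[OF x] compatibleD(1-3)[OF c]])

lemma compatible_nijenhuis_skew:
  assumes x: "x \<in> S" and c: "compatible \<Gamma> x"
  shows "totally_skew (nijenhuis_tensor G I x)"
  unfolding totally_skew_skew3 nijenhuis_tensor_jet[OF x]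
  by (rule hermitian_jet.nij_skew[OF jet[OF x] compatibleD(1-3)[OF c]])

lemma nijenhuis_alternating:
  assumes x: "x \<in> S" and N: "totally_skew (nijenhuis_tensor G I x)"
  shows "alternating 3 (nijenhuis_tensor G I x)"
proof (rule alternating_3I)
  fix a b c
  have "nijenhuis_tensor G I x [v, b, c] = nijenhuis_tensor G I x [b, c, v]" for v
    using N[unfolded totally_skew_def, rule_format, of v b c] N[unfolded totally_skew_def, rule_format, of b v c] by simp
  then show "linear (\<lambda>v. nijenhuis_tensor G I x [v, b, c])"
    using G_lin(2)[OF x] by (simp add: nijenhuis_tensor_def)
  show "nijenhuis_tensor G I x [a, b, c] = - nijenhuis_tensor G I x [b, a, c]"
    "nijenhuis_tensor G I x [a, b, c] = - nijenhuis_tensor G I x [a, c, b]"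
    using N unfolding totally_skew_def by blast+
qed

lemma nijenhuis_type:
  "x \<in> S \<Longrightarrow> nijenhuis_tensor G I x [I x u, v, w] = nijenhuis_tensor G I x [u, I x v, w]"
  by (simp add: nijenhuis_tensor_jet hermitian_jet.nij_type[OF jet])

definition J_wedge :: "'e \<Rightarrow> 'e form \<Rightarrow> 'e form" where
  "J_wedge x \<alpha> vs = wedge 1 2 (J_act I x \<alpha>) (fundamental_form G I x) vs"

lemma J_wedge_eq:
  assumes x: "x \<in> S"
  shows "J_wedge x \<alpha> [X, Y, Z] =
    (- \<alpha> [I x X]) * G x Y (I x Z) - (- \<alpha> [I x Y]) * G x X (I x Z) + (- \<alpha> [I x Z]) * G x X (I x Y)"
  unfolding J_wedge_def wedge12[of "fundamental_form G I x", OF F_skew[OF x]]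
  by (simp add: J_act_def fundamental_form_def)

lemma J_wedge_diff:
  assumes x: "x \<in> S" and \<alpha>: "\<And>v. \<alpha> [v] = \<beta> [v] - \<gamma> [v]"
  shows "J_wedge x \<alpha> [X, Y, Z] = J_wedge x \<beta> [X, Y, Z] - J_wedge x \<gamma> [X, Y, Z]"
  unfolding J_wedge_eq[OF x] \<alpha> by (simp add: algebra_simps)

lemma canonical_eq: "x \<in> S \<Longrightarrow> canonical x u v w = - dF x (I x u) (I x v) (I x w) + nijenhuis_tensor G I x [u, v, w]"
  by (simp add: hermitian_jet.canonical_torsion_def[OF jet] nijenhuis_tensor_jet)

lemma lee_form_linear:
  assumes x: "x \<in> S" shows "linear (\<lambda>v. lee_form G I x [v])"
proof -
  have l: "linear (\<lambda>v. dF x v a b)" for a b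
    using hermitian_jet.dF_trilinear[OF jet[OF x]] by (simp add: trilinear_def)
  show ?thesis
    unfolding lee_form_def metric_trace_def
    by (rule linearI) (simp_all add: ext_deriv_fundamental_form[OF x] linear_add[OF l] linear_cmul[OF l]
        sum.distrib sum_distrib_left add_divide_distrib)
qed

end

context quat_chart begin

lemma canonical_codifferential:
  assumes x: "x \<in> S"
  shows "HI.canonical x X Y Z = - codifferential 4 G (Phi_form G I) x [X, Y, Z] + HI.J_wedge x (lee_form G I x) [X, Y, Z]
    + nijenhuis_tensor G I x [X, Y, Z]"
  using codifferential_Phi[OF x, of X Y Z] by (simp add: HI.canonical_eq[OF x] HI.J_wedge_def)

lemma nijenhuis_formula:
  assumes x: "x \<in> S" and N: "totally_skew (nijenhuis_tensor G I x)"
  shows "nijenhuis_tensor G I x [X, Y, Z] =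
    HJ.J_wedge x (nu_form G I J x) [X, Y, Z] - HK.J_wedge x (nu_form G I J x) [X, Y, Z]"
  using quaternionic.skew_type_form[of "G x" "I x" "J x" "K x" "nijenhuis_tensor G I x" X Y Z,
      OF quat[OF x] HI.nijenhuis_alternating[OF x N] HI.nijenhuis_type[OF x]]
  by (simp add: HJ.J_wedge_eq[OF x] HK.J_wedge_eq[OF x] nu_form_def)

text \<open>Contracting F \<and> F / 2 with a vector v leaves F(v, -) \<and> F, and for v dual to
  \<open>\<theta>\<close> the first factor is \<open>\<theta>\<close> composed with the complex
  structure, which is minus the action of that structure on \<open>\<theta>\<close>.\<close>

lemma interior_formula:
  assumes x: "x \<in> S" and \<theta>: "linear (\<lambda>v. \<theta> [v])"
  shows "- interior_mult (G x) \<theta> (\<lambda>vs. Phi_form G J x vs - Phi_form G K x vs) [X, Y, Z] =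
    HJ.J_wedge x \<theta> [X, Y, Z] - HK.J_wedge x \<theta> [X, Y, Z]"
proof -
  interpret Q: quaternionic "G x" "I x" "J x" "K x" by (rule quat[OF x])
  obtain e f where "Q.adapted e f" using Q.adapted_exists by blast
  note s = Q.h_sharp[OF Q.adapted_frame[OF this] \<theta>]
  show ?thesis
    by (simp add: interior_mult_def HJ.Phi_form_jet[OF x] HK.Phi_form_jet[OF x] HJ.J_wedge_eq[OF x] HK.J_wedge_eq[OF x]
        fundamental_form_def s)
qed

text \<open>All three 1-forms are traces of one and the same torsion; this is where a common
  connection for \<open>I\<close>, \<open>J\<close> and \<open>K\<close> is used.\<close>

lemma nu_lee:
  assumes x: "x \<in> S" and c: "HI.compatible \<Gamma> x" "HJ.compatible \<Gamma> x" "HK.compatible \<Gamma> x"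
  shows "nu_form G I J x [X] = lee_form G J x [X] - lee_form G K x [X]"
proof -
  interpret Q: quaternionic "G x" "I x" "J x" "K x" by (rule quat[OF x])
  interpret QJ: quaternionic "G x" "J x" "K x" "I x" by (rule Q.cyclic)
  interpret QK: quaternionic "G x" "K x" "I x" "J x" by (rule QJ.cyclic)
  let ?T = "\<lambda>vs. torsion \<Gamma> x (vs ! 0) (vs ! 1) (vs ! 2)"
  have T: "alternating 3 ?T" by (rule torsion_alternating[OF x HI.compatibleD(4)[OF c(1)]])
  have "nu_form G I J x [X] = metric_trace (G x) (\<lambda>u v. ?T [J x X, J x u, v]) / 2 - metric_trace (G x) (\<lambda>u v. ?T [K x X, K x u, v]) / 2"
    using Q.skew_torsion_nu[OF T, of "nijenhuis_tensor G I x" X]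
      hermitian_jet.nij_torsion[OF HI.jet[OF x] HI.compatibleD(1-3)[OF c(1)]]
    by (simp add: nu_form_def HI.nijenhuis_tensor_jet[OF x] torsion_def)
  also have "metric_trace (G x) (\<lambda>u v. ?T [J x X, J x u, v]) / 2 = lee_form G J x [X]"
    using QJ.skew_torsion_lee[OF T, of "ext_deriv 2 (fundamental_form G J) x" X]
      hermitian_jet.dF_torsion[OF HJ.jet[OF x] HJ.compatibleD(1-3)[OF c(2)]]
    by (simp add: lee_form_def HJ.ext_deriv_fundamental_form[OF x] torsion_def)
  also have "metric_trace (G x) (\<lambda>u v. ?T [K x X, K x u, v]) / 2 = lee_form G K x [X]"
    using QK.skew_torsion_lee[OF T, of "ext_deriv 2 (fundamental_form G K) x" X]
      hermitian_jet.dF_torsion[OF HK.jet[OF x] HK.compatibleD(1-3)[OF c(3)]]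
    by (simp add: lee_form_def HK.ext_deriv_fundamental_form[OF x] torsion_def)
  finally show ?thesis .
qed

text \<open>Writing each \<open>nu_form\<close> as a difference of Lee forms turns everything into
  wedge terms of Lee forms with one of the three fundamental forms. With \<open>J\<close> the Lee
  forms add up to that of \<open>I\<close>, with \<open>K\<close> to its negative, and with
  \<open>I\<close> to the difference that is \<open>nu_form G I J x\<close>.\<close>

lemma canonical_difference:
  assumes x: "x \<in> S"
    and N: "totally_skew (nijenhuis_tensor G J x)" "totally_skew (nijenhuis_tensor G K x)"
    and \<nu>: "\<And>v. nu_form G I J x [v] = lee_form G J x [v] - lee_form G K x [v]"
      "\<And>v. nu_form G J K x [v] = lee_form G K x [v] - lee_form G I x [v]"
      "\<And>v. nu_form G K I x [v] = lee_form G I x [v] - lee_form G J x [v]"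
  shows "HJ.canonical x X Y Z - HK.canonical x X Y Z =
    HI.J_wedge x (nu_form G I J x) [X, Y, Z] + HJ.J_wedge x (lee_form G I x) [X, Y, Z] - HK.J_wedge x (lee_form G I x) [X, Y, Z]
    - (codifferential 4 G (Phi_form G J) x [X, Y, Z] - codifferential 4 G (Phi_form G K) x [X, Y, Z])"
proof -
  note QJ = cyclic
  note QK = quat_chart.cyclic[OF QJ]
  show ?thesis
    unfolding quat_chart.canonical_codifferential[OF QJ x] quat_chart.canonical_codifferential[OF QK x]
      quat_chart.nijenhuis_formula[OF QJ x N(1)] quat_chart.nijenhuis_formula[OF QK x N(2)]
      HI.J_wedge_diff[of x "nu_form G I J x" "lee_form G J x" "lee_form G K x", OF x \<nu>(1)]
      HI.J_wedge_diff[of x "nu_form G J K x" "lee_form G K x" "lee_form G I x", OF x \<nu>(2)]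
      HI.J_wedge_diff[of x "nu_form G K I x" "lee_form G I x" "lee_form G J x", OF x \<nu>(3)]
      HJ.J_wedge_diff[of x "nu_form G K I x" "lee_form G I x" "lee_form G J x", OF x \<nu>(3)]
      HK.J_wedge_diff[of x "nu_form G J K x" "lee_form G K x" "lee_form G I x", OF x \<nu>(2)]
    by simp
qed

end

text \<open>A compatible connection is unique at each point. Pulling \<Gamma>' back along \<tau>
  gives another compatible connection, and equality with \<Gamma> is the transformation law.\<close>

lemma (in hermitian_chart) compatible_transform:
  fixes \<tau> :: "'e \<Rightarrow> 'e"
  defines "D \<equiv> \<lambda>y. frechet_derivative \<tau> (at y)"
  assumes chart': "hermitian_chart S' G' I'"
    and U: "open U" "x \<in> U" "U \<subseteq> S" and \<tau>: "smooth_on U \<tau>" "\<And>y. y \<in> U \<Longrightarrow> \<tau> y \<in> S'"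
    and G\<tau>: "\<And>y u v. y \<in> U \<Longrightarrow> G y u v = G' (\<tau> y) (D y u) (D y v)"
    and I\<tau>: "\<And>y u. y \<in> U \<Longrightarrow> D y (I y u) = I' (\<tau> y) (D y u)"
    and \<Gamma>: "bilinear \<Gamma>" "compatible \<Gamma> x" and \<Gamma>': "bilinear \<Gamma>'" "hermitian_chart.compatible G' I' \<Gamma>' (\<tau> x)"
  shows "D x (\<Gamma> u v) = frechet_derivative (\<lambda>y. D y v) (at x) u + \<Gamma>' (D x u) (D x v)"
proof -
  interpret H': hermitian_chart S' G' I' by (rule chart')
  have x: "x \<in> S" "\<tau> x \<in> S'" using U \<tau> by auto
  interpret j': hermitian_jet "G' (\<tau> x)" "I' (\<tau> x)" "H'.dG (\<tau> x)" "H'.dI (\<tau> x)" by (rule H'.jet[OF x(2)])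
  define D2 where "D2 u v = frechet_derivative (\<lambda>y. D y v) (at x) u" for u v
  have \<tau>D: "(\<tau> has_derivative D y) (at y)" if "y \<in> U" for y
    using smooth_on_has_derivative[OF \<tau>(1) that] by (simp add: D_def)
  have Dlin: "linear (D y)" if "y \<in> U" for y using has_derivative_linear[OF \<tau>D[OF that]] .
  have D2: "((\<lambda>y. D y v) has_derivative (\<lambda>u. D2 u v)) (at x)" for v
    using smooth_on_has_derivative[OF smooth_on_frechet[OF \<tau>(1)] U(2)] by (simp add: D2_def[abs_def] D_def)
  have D2_sym: "D2 u v = D2 v u" for u v
    using frechet_derivative_symmetric[OF U(1,2) \<tau>(1)] by (simp add: D2_def D_def)
  have D2_neg: "D2 (- u) v = - D2 u v" for u v
    using linear_neg[OF has_derivative_linear[OF D2]] .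
  have Gcomp: "((\<lambda>y. G' (\<tau> y) v w) has_derivative (\<lambda>u. H'.dG (\<tau> x) (D x u) v w)) (at x)" for v w
    by (rule has_derivative_compose[OF \<tau>D[OF U(2)] H'.G_deriv[OF x(2)]])
  have Icomp: "((\<lambda>y. I' (\<tau> y) v) has_derivative (\<lambda>u. H'.dI (\<tau> x) (D x u) v)) (at x)" for v
    by (rule has_derivative_compose[OF \<tau>D[OF U(2)] H'.I_deriv[OF x(2)]])
  have dG: "dG x u v w = H'.dG (\<tau> x) (D x u) (D x v) (D x w) + G' (\<tau> x) (D2 u v) (D x w) + G' (\<tau> x) (D x v) (D2 u w)" for u v w
  proof -
    have "((\<lambda>y. G' (\<tau> y) (D y v) (D y w)) has_derivative (\<lambda>u. frechet_derivative (\<lambda>y. G' (\<tau> y) (D x v) (D x w)) (at x) u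
        + G' (\<tau> x) (D2 u v) (D x w) + G' (\<tau> x) (D x v) (D2 u w))) (at x)"
      by (rule has_derivative_param2[where L = "\<lambda>y. G' (\<tau> y)", OF U(1,2) _ _ _ D2 D2])
        (use Gcomp H'.G_lin \<tau>(2) in \<open>auto simp: differentiable_def\<close>)
    then have "((\<lambda>y. G y v w) has_derivative (\<lambda>u. frechet_derivative (\<lambda>y. G' (\<tau> y) (D x v) (D x w)) (at x) u
        + G' (\<tau> x) (D2 u v) (D x w) + G' (\<tau> x) (D x v) (D2 u w))) (at x)"
      by (rule has_derivative_transform_within_open[OF _ U(1,2)]) (simp add: G\<tau>)
    from fun_cong[OF has_derivative_unique[OF G_deriv[OF x(1)] this], of u]
    show ?thesis by (simp add: frechet_derivative_at[OF Gcomp, symmetric])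
  qed
  have dI: "D2 u (I x v) + D x (dI x u v) = H'.dI (\<tau> x) (D x u) (D x v) + I' (\<tau> x) (D2 u v)" for u v
  proof -
    have "((\<lambda>y. I' (\<tau> y) (D y v)) has_derivative
        (\<lambda>u. frechet_derivative (\<lambda>y. I' (\<tau> y) (D x v)) (at x) u + I' (\<tau> x) (D2 u v))) (at x)"
      by (rule has_derivative_param[where L = "\<lambda>y. I' (\<tau> y)", OF U(1,2) _ _ D2])
        (use Icomp H'.I_lin \<tau>(2) in \<open>auto simp: differentiable_def\<close>)
    then have 1: "((\<lambda>y. D y (I y v)) has_derivative
        (\<lambda>u. frechet_derivative (\<lambda>y. I' (\<tau> y) (D x v)) (at x) u + I' (\<tau> x) (D2 u v))) (at x)"
      by (rule has_derivative_transform_within_open[OF _ U(1,2)]) (simp add: I\<tau>)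
    have "((\<lambda>y. D y (I y v)) has_derivative
        (\<lambda>u. frechet_derivative (\<lambda>y. D y (I x v)) (at x) u + D x (dI x u v))) (at x)"
      by (rule has_derivative_param[where L = D, OF U(1,2) _ Dlin I_deriv[OF x(1)]])
        (use D2 in \<open>auto simp: differentiable_def\<close>)
    from fun_cong[OF has_derivative_unique[OF this 1], of u]
    show ?thesis by (simp add: D2_def frechet_derivative_at[OF Icomp, symmetric])
  qed
  \<comment> \<open>The defect of the transformation law. Read through the metric and
    \<open>D x\<close>, it is the difference of two compatible connections, as
    \<open>skew_torsion_unique\<close> requires.\<close>
  define R where "R u v = D x (\<Gamma> u v) - D2 u v - \<Gamma>' (D x u) (D x v)" for u v
  have Dx: "D x (u + v) = D x u + D x v" "D x (u - v) = D x u - D x v" "D x (- u) = - D x u" for u v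
    using Dlin[OF U(2)] by (simp_all add: linear_add linear_diff linear_neg)
  note c = compatibleD[OF \<Gamma>(2)] and c' = H'.compatibleD[OF \<Gamma>'(2)]
  have R0: "G' (\<tau> x) (R u v) (D x w) = 0" for u v w
  proof (rule skew_torsion_unique[where J = "I x" and S = "\<lambda>u v w. G' (\<tau> x) (R u v) (D x w)"])
    fix u v w
    show "I x (I x u) = - u" by (rule I_I[OF x(1)])
    have "\<Gamma> (- u) v = - \<Gamma> u v" "\<Gamma>' (- D x u) (D x v) = - \<Gamma>' (D x u) (D x v)"
      using \<Gamma>(1) \<Gamma>'(1) by (simp_all add: bilinear_lneg)
    then show "G' (\<tau> x) (R (- u) v) (D x w) = - G' (\<tau> x) (R u v) (D x w)"
      by (simp add: R_def Dx D2_neg j'.h_simps)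
    have "G' (\<tau> x) (D x (\<Gamma> u v)) (D x w) + G' (\<tau> x) (D x v) (D x (\<Gamma> u w)) = dG x u v w"
      using c(1)[of u v w] G\<tau>[OF U(2)] by simp
    then show "G' (\<tau> x) (R u v) (D x w) = - G' (\<tau> x) (R u w) (D x v)"
      unfolding dG c'(1)
      by (simp add: R_def j'.h_simps j'.sym[of "D x v"])
    have "R u (I x v) = I' (\<tau> x) (R u v)"
    proof -
      have 1: "\<Gamma> u (I x v) = I x (\<Gamma> u v) - dI x u v" "\<Gamma>' (D x u) (I' (\<tau> x) (D x v)) = I' (\<tau> x) (\<Gamma>' (D x u) (D x v)) - H'.dI (\<tau> x) (D x u) (D x v)"
        using c(2)[of u v] c'(2)[of "D x u" "D x v"] by (simp_all add: algebra_simps)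
      have 2: "D2 u (I x v) = H'.dI (\<tau> x) (D x u) (D x v) + I' (\<tau> x) (D2 u v) - D x (dI x u v)"
        using dI[of u v] by (simp add: algebra_simps)
      show ?thesis
        by (simp add: R_def 1 2 I\<tau>[OF U(2)] Dx linear_diff[OF j'.linJ])
    qed
    then show "G' (\<tau> x) (R u (I x v)) (D x w) = - G' (\<tau> x) (R u v) (D x (I x w))"
      by (simp add: j'.h_skew I\<tau>[OF U(2)])
    \<comment> \<open>The second derivative of \<tau> is symmetric, so it cancels and a difference
      of two skew torsions remains.\<close>
    have tor: "G' (\<tau> x) (R u v) (D x w) - G' (\<tau> x) (R v u) (D x w) =
       torsion \<Gamma> x u v w - H'.torsion \<Gamma>' (\<tau> x) (D x u) (D x v) (D x w)" for u v w
      by (simp add: R_def D2_sym[of v u] torsion_def H'.torsion_def G\<tau>[OF U(2)] Dx j'.h_simps)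
    show "skew3 (\<lambda>u v w. G' (\<tau> x) (R u v) (D x w) - G' (\<tau> x) (R v u) (D x w))"
      unfolding tor skew3_def
      using skew3D(1)[OF c(4)] skew3D(2)[OF c(4)] skew3D(1)[OF c'(4)] skew3D(2)[OF c'(4)]
      by (metis (no_types) minus_diff_minus)
  qed
  \<comment> \<open>\<open>R0\<close> tests the defect only against vectors in the image of
    \<open>D x\<close>; since \<tau> preserves the metric this map is injective, hence onto.\<close>
  have "inj (D x)"
    unfolding linear_injective_0[OF Dlin[OF U(2)]]
  proof (intro allI impI)
    fix a assume "D x a = 0"
    then have "G x a a = 0" using G\<tau>[OF U(2), of a a] by (simp add: j'.h_simps)
    then show "a = 0" using inner_product.pos[OF G_inner[OF x(1)], of a] by force
  qed
  then have "surj (D x)" by (rule linear_injective_imp_surjective[OF Dlin[OF U(2)]]) (rule refl)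
  then obtain w where "R u v = D x w" by (metis surjD)
  then have "G' (\<tau> x) (R u v) (R u v) = 0" using R0[of u v w] by simp
  then have "R u v = 0" using j'.pos[of "R u v"] by force
  then show ?thesis by (simp add: R_def D2_def algebra_simps)
qed

section \<open>Smoothness and existence of the canonical connection\<close>

lemma smooth_on_trilinear:
  fixes T :: "'c::euclidean_space \<Rightarrow> 'e::euclidean_space \<Rightarrow> 'e \<Rightarrow> 'e \<Rightarrow> real"
  assumes S: "open S" and T: "\<And>u v w. smooth_on S (\<lambda>x. T x u v w)" "\<And>x. x \<in> S \<Longrightarrow> trilinear (T x)"
    and abc: "smooth_on S a" "smooth_on S b" "smooth_on S c"
  shows "smooth_on S (\<lambda>x. T x (a x) (b x) (c x))"
proof -
  have 1: "smooth_on S (\<lambda>x. T x u v (c x))" for u v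
    by (rule smooth_on_param[where L = "\<lambda>x. T x u v", OF S T(1) _ abc(3)])
      (use T(2) in \<open>auto simp: trilinear_def\<close>)
  have 2: "smooth_on S (\<lambda>x. T x u (b x) (c x))" for u
    by (rule smooth_on_param[where L = "\<lambda>x v. T x u v (c x)", OF S 1 _ abc(2)])
      (use T(2) in \<open>auto simp: trilinear_def\<close>)
  show ?thesis
    by (rule smooth_on_param[where L = "\<lambda>x v. T x v (b x) (c x)", OF S 2 _ abc(1)])
      (use T(2) in \<open>auto simp: trilinear_def\<close>)
qed

lemma smooth_on_det:
  fixes M :: "'a::euclidean_space \<Rightarrow> real^'n^'n"
  assumes "open S" "\<And>i j. smooth_on S (\<lambda>x. M x $ i $ j)"
  shows "smooth_on S (\<lambda>x. det (M x))"
  unfolding det_def by (intro smooth_intros assms)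

text \<open>A vector defined by its inner products, such as \<open>sharp\<close>, carries no
  smoothness of its own. Cramer's rule writes its coordinates as quotients of determinants of smooth
  entries, with nonzero denominator since the metric is definite.\<close>

lemma smooth_on_solution:
  fixes G :: "(real^'n) metric"
  assumes S: "open S" and G: "\<And>u v. smooth_on S (\<lambda>x. G x u v)" "\<And>x. x \<in> S \<Longrightarrow> inner_product (G x)"
    and \<phi>: "\<And>w. smooth_on S (\<lambda>x. \<phi> x w)" and c: "\<And>x w. x \<in> S \<Longrightarrow> G x (c x) w = \<phi> x w"
  shows "smooth_on S c"
proof -
  define A where "A x = (\<chi> i j. G x (axis i 1) (axis j 1))" for x
  define b where "b x = (\<chi> i. \<phi> x (axis i 1))" for x
  define M where "M x k = (\<chi> i j. if j = k then b x $ i else A x $ i $ j)" for x k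
  have mult: "(A x *v u) $ i = G x (axis i 1) u" if "x \<in> S" for x u i
  proof -
    interpret inner_product "G x" by (rule G(2)[OF that])
    have "u = (\<Sum>j\<in>UNIV. u $ j *\<^sub>R axis j 1)"
      using basis_expansion[of u] by (simp add: scalar_mult_eq_scaleR)
    then have "G x (axis i 1) u = (\<Sum>j\<in>UNIV. u $ j * G x (axis i 1) (axis j 1))"
      using linear_sum[OF lin(2), of "axis i 1" "\<lambda>j. u $ j *\<^sub>R axis j 1" UNIV] by (simp add: h_simps)
    then show ?thesis by (simp add: matrix_vector_mult_def A_def mult.commute)
  qed
  have det: "det (A x) \<noteq> 0" if x: "x \<in> S" for x
  proof -
    interpret inner_product "G x" by (rule G(2)[OF x])
    have "u = 0" if "A x *v u = 0" for u
    proof (rule nondegenerate)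
      fix w :: "real^'n"
      have "w = (\<Sum>j\<in>UNIV. w $ j *\<^sub>R axis j 1)"
        using basis_expansion[of w] by (simp add: scalar_mult_eq_scaleR)
      then have "G x w u = (\<Sum>j\<in>UNIV. w $ j * G x (axis j 1) u)"
        using linear_sum[OF lin(1), of "\<lambda>j. w $ j *\<^sub>R axis j 1" UNIV u] by (simp add: h_simps)
      also have "\<dots> = 0" using that by (simp flip: mult[OF x])
      finally show "G x u w = G x 0 w" by (simp add: h_simps sym)
    qed
    then show ?thesis
      using matrix_left_invertible_ker[of "A x"] invertible_left_inverse[of "A x"] invertible_det_nz[of "A x"] by blast
  qed
  have "c x = (\<chi> k. det (M x k) / det (A x))" if x: "x \<in> S" for x
  proof -
    interpret inner_product "G x" by (rule G(2)[OF x])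
    have "A x *v c x = b x"
      unfolding b_def vec_eq_iff mult[OF x] sym[of "axis _ 1" "c x"] c[OF x] by simp
    then show ?thesis using cramer[OF det[OF x], of "c x" "b x"] by (simp add: M_def)
  qed
  then have eq: "(\<Sum>k\<in>UNIV. (det (M x k) / det (A x)) *\<^sub>R axis k 1) = c x" if "x \<in> S" for x
    using basis_expansion[of "c x"] that by (simp add: scalar_mult_eq_scaleR)
  have A: "smooth_on S (\<lambda>x. A x $ i $ j)" for i j by (simp add: A_def G)
  have "smooth_on S (\<lambda>x. M x k $ i $ j)" for i j k by (cases "j = k") (simp_all add: M_def b_def A \<phi>)
  then have "smooth_on S (\<lambda>x. \<Sum>k\<in>UNIV. (det (M x k) / det (A x)) *\<^sub>R axis k 1)"
    by (intro smooth_intros smooth_on_det S A det)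
  from smooth_on_cong[OF S eq this] show ?thesis .
qed

context hermitian_chart begin

abbreviation "koszul x \<equiv> hermitian_jet.koszul (dG x)"

lemma dG_smooth: "smooth_on S (\<lambda>x. dG x u v w)"
  unfolding dG_def by (rule smooth_on_frechet[OF G_smooth])

lemma dI_smooth: "smooth_on S (\<lambda>x. dI x u v)"
  unfolding dI_def by (rule smooth_on_frechet[OF I_smooth])

lemma G_smooth_fields: 
  assumes Y: "smooth_on S Y" and Z: "smooth_on S Z" shows "smooth_on S (\<lambda>x. G x (Y x) (Z x))"
proof -
  have "smooth_on S (\<lambda>x. G x v (Z x))" for v
    by (rule smooth_on_param[where L = "\<lambda>x. G x v", OF open_S G_smooth G_lin(2) Z])
  from smooth_on_param[where L = "\<lambda>x v. G x v (Z x)", OF open_S this G_lin(1) Y] show ?thesis .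
qed

lemma I_smooth_field: "smooth_on S Y \<Longrightarrow> smooth_on S (\<lambda>x. I x (Y x))"
  by (rule smooth_on_param[OF open_S I_smooth I_lin])

lemma dF_smooth: "smooth_on S (\<lambda>x. dF x u v w)"
proof -
  have "smooth_on S (\<lambda>x. dG x u v (I x w) + G x v (dI x u w))" for u v w
    by (intro smooth_on_add open_S G_smooth_fields smooth_on_const dI_smooth
        smooth_on_param[where L = "\<lambda>x. dG x u v", OF open_S dG_smooth dG_lin(3) I_smooth])
  note D = this
  show ?thesis
    by (rule smooth_on_cong[OF open_S _ smooth_on_add[OF open_S smooth_on_diff[OF open_S D[of u v w] D[of v u w]] D[of w u v]]])
      (simp add: hermitian_jet.dF_def[OF jet] hermitian_jet.DF_def[OF jet])
qed

lemma nij_smooth: "smooth_on S (\<lambda>x. nij x u v w)"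
proof -
  have 1: "smooth_on S (\<lambda>x. dI x (I x u) v)" for u v
    by (rule smooth_on_param[where L = "\<lambda>x u. dI x u v", OF open_S dI_smooth dI_lin(1) I_smooth])
  have "smooth_on S (\<lambda>x. G x (dI x (I x u) v - dI x (I x v) u - I x (dI x u v) + I x (dI x v u)) w)"
    by (intro G_smooth_fields smooth_on_const smooth_on_add smooth_on_diff open_S 1 I_smooth_field dI_smooth)
  then show ?thesis
    by (rule smooth_on_cong[OF open_S, rotated]) (simp add: hermitian_jet.nij_def[OF jet])
qed

lemma canonical_smooth: "smooth_on S (\<lambda>x. canonical x u v w)"
proof -
  have "smooth_on S (\<lambda>x. - dF x (I x u) (I x v) (I x w) + nij x u v w)"
    by (intro smooth_on_add smooth_on_minus open_S nij_smooth
        smooth_on_trilinear[where T = "\<lambda>x. dF x", OF open_S dF_smooth hermitian_jet.dF_trilinear[OF jet]] I_smooth)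
  then show ?thesis
    by (rule smooth_on_cong[OF open_S, rotated]) (simp add: hermitian_jet.canonical_torsion_def[OF jet])
qed

lemma koszul_smooth: "smooth_on S (\<lambda>x. koszul x u v w)"
proof -
  have "smooth_on S (\<lambda>x. (dG x u v w + dG x v u w - dG x w u v) * (1 / 2))"
    by (intro smooth_on_mult smooth_on_add smooth_on_diff smooth_on_const open_S dG_smooth)
  then show ?thesis
    by (rule smooth_on_cong[OF open_S, rotated]) (simp add: hermitian_jet.koszul_def[OF jet])
qed

lemma canonical_compatible:
  assumes x: "x \<in> S" and N: "totally_skew (nijenhuis_tensor G I x)"
    and \<Gamma>: "\<And>u v w. G x (\<Gamma> u v) w = koszul x u v w + canonical x u v w / 2"
  shows "compatible \<Gamma> x"
proof -
  have "skew3 (nij x)" using N unfolding totally_skew_skew3 nijenhuis_tensor_jet[OF x] .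
  note can = hermitian_jet.canonical_connection[OF jet[OF x] this \<Gamma>]
    hermitian_jet.canonical_torsion_skew[OF jet[OF x] this]
  have "torsion \<Gamma> x = canonical x" using can(3) by (simp add: torsion_def fun_eq_iff)
  then show ?thesis using can by (simp add: compatible_def)
qed

lemma compatible_fields:
  assumes x: "x \<in> S" and c: "compatible (\<Gamma> x) x"
    and Y: "smooth_on S Y" and Z: "smooth_on S Z"
  shows "frechet_derivative (\<lambda>y. G y (Y y) (Z y)) (at x) (X x) =
      G x (nabla \<Gamma> X Y x) (Z x) + G x (Y x) (nabla \<Gamma> X Z x)"
    and "nabla \<Gamma> X (\<lambda>y. I y (Y y)) x = I x (nabla \<Gamma> X Y x)"
proof -
  note YD = smooth_on_has_derivative[OF Y x] and ZD = smooth_on_has_derivative[OF Z x]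
  show "frechet_derivative (\<lambda>y. G y (Y y) (Z y)) (at x) (X x) =
      G x (nabla \<Gamma> X Y x) (Z x) + G x (Y x) (nabla \<Gamma> X Z x)"
    using compatibleD(1)[OF c, of "X x" "Y x" "Z x"]
    by (simp add: frechet_derivative_at[OF G_deriv_fields[OF x YD ZD], symmetric] nabla_def
        linear_add[OF G_lin(1)[OF x]] linear_add[OF G_lin(2)[OF x]])
  show "nabla \<Gamma> X (\<lambda>y. I y (Y y)) x = I x (nabla \<Gamma> X Y x)"
    by (simp add: frechet_derivative_at[OF I_deriv_field[OF x YD], symmetric] nabla_def
        linear_add[OF I_lin[OF x]] compatibleD(2)[OF c, symmetric])
qed

text \<open>On fields with constant components the derivatives of the fields vanish and only the
  tensorial conditions on \<Gamma> remain.\<close>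

lemma compatible_of_fields:
  assumes x: "x \<in> S"
    and 1: "\<And>X Y Z. smooth_on S X \<Longrightarrow> smooth_on S Y \<Longrightarrow> smooth_on S Z \<Longrightarrow>
      frechet_derivative (\<lambda>y. G y (Y y) (Z y)) (at x) (X x) =
      G x (nabla \<Gamma> X Y x) (Z x) + G x (Y x) (nabla \<Gamma> X Z x)"
    and 2: "\<And>X Y. smooth_on S X \<Longrightarrow> smooth_on S Y \<Longrightarrow> nabla \<Gamma> X (\<lambda>y. I y (Y y)) x = I x (nabla \<Gamma> X Y x)"
    and T: "totally_skew (torsion_tensor G \<Gamma> x)"
  shows "compatible (\<Gamma> x) x"
proof -
  note s = smooth_on_const[OF open_S]
  have "dG x u v w = G x (\<Gamma> x u v) w + G x v (\<Gamma> x u w)" for u v w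
    using 1[OF s[of u] s[of v] s[of w]] by (simp add: dG_def nabla_def)
  moreover have "dI x u v + \<Gamma> x u (I x v) = I x (\<Gamma> x u v)" for u v
    using 2[OF s[of u] s[of v]] by (simp add: dI_def nabla_def)
  moreover have "skew3 (torsion (\<Gamma> x) x)"
    using T unfolding totally_skew_skew3 torsion_tensor_eq .
  ultimately show ?thesis unfolding compatible_def by blast
qed

end

context quat_chart begin

text \<open>Levi-Civita plus half of the canonical torsion of \<open>I\<close>. The connection sees
  \<open>J\<close> and \<open>K\<close> only when their canonical torsions coincide with that of
  \<open>I\<close>.\<close>

definition conn :: "(real^8) christoffel" where
  "conn x u v = sharp (G x) (\<lambda>ws. HI.koszul x u v (ws ! 0) + HI.canonical x u v (ws ! 0) / 2)"

lemma G_conn: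
  assumes x: "x \<in> S"
  shows "G x (conn x u v) w = HI.koszul x u v w + HI.canonical x u v w / 2"
proof -
  interpret Q: quaternionic "G x" "I x" "J x" "K x" by (rule quat[OF x])
  obtain e f where "Q.adapted e f" using Q.adapted_exists by blast
  note fr = Q.adapted_frame[OF this]
  have "linear (\<lambda>w. HI.koszul x u v w + HI.canonical x u v w / 2)"
    using hermitian_jet.koszul_trilinear[OF HI.jet[OF x]] hermitian_jet.canonical_trilinear[OF HI.jet[OF x]]
    by (simp add: trilinear_def linear_iff algebra_simps add_divide_distrib)
  then show ?thesis
    unfolding conn_def by (subst Q.h_sharp[OF fr]) simp_all
qed

lemma conn_bilinear:
  assumes x: "x \<in> S" shows "bilinear (conn x)"
proof -
  interpret Q: quaternionic "G x" "I x" "J x" "K x" by (rule quat[OF x])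
  show ?thesis
    unfolding bilinear_def
    by (intro conjI allI linearI Q.nondegenerate)
      (use hermitian_jet.koszul_trilinear[OF HI.jet[OF x]] hermitian_jet.canonical_trilinear[OF HI.jet[OF x]] in
        \<open>simp_all add: trilinear_def linear_iff Q.h_simps G_conn[OF x] algebra_simps add_divide_distrib\<close>)
qed

lemma conn_smooth: "smooth_on S (\<lambda>x. conn x u v)"
proof (rule smooth_on_solution[OF open_S G_smooth G_inner _ G_conn])
  fix w
  have "smooth_on S (\<lambda>x. HI.koszul x u v w + HI.canonical x u v w * (1 / 2))"
    by (intro smooth_on_add smooth_on_mult smooth_on_const open_S HI.koszul_smooth HI.canonical_smooth)
  then show "smooth_on S (\<lambda>x. HI.koszul x u v w + HI.canonical x u v w / 2)" by simp
qed

end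

context quat_chart begin

lemma compatible_formulas:
  assumes x: "x \<in> S"
    and c: "HI.compatible (\<Gamma> x) x" "HJ.compatible (\<Gamma> x) x" "HK.compatible (\<Gamma> x) x"
  shows "nijenhuis_tensor G I x [X, Y, Z] =
      wedge 1 2 (J_act J x (nu_form G I J x)) (fundamental_form G J x) [X, Y, Z]
      - wedge 1 2 (J_act K x (nu_form G I J x)) (fundamental_form G K x) [X, Y, Z]" (is ?N)
    and "torsion_tensor G \<Gamma> x [X, Y, Z] = - codifferential 4 G (Phi_form G I) x [X, Y, Z]
      + wedge 1 2 (J_act I x (lee_form G I x)) (fundamental_form G I x) [X, Y, Z]
      + wedge 1 2 (J_act J x (nu_form G I J x)) (fundamental_form G J x) [X, Y, Z]
      - wedge 1 2 (J_act K x (nu_form G I J x)) (fundamental_form G K x) [X, Y, Z]"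
proof -
  show ?N
    using nijenhuis_formula[OF x HI.compatible_nijenhuis_skew[OF x c(1)], of X Y Z]
    by (simp add: HJ.J_wedge_def HK.J_wedge_def)
  then show "torsion_tensor G \<Gamma> x [X, Y, Z] = - codifferential 4 G (Phi_form G I) x [X, Y, Z]
      + wedge 1 2 (J_act I x (lee_form G I x)) (fundamental_form G I x) [X, Y, Z]
      + wedge 1 2 (J_act J x (nu_form G I J x)) (fundamental_form G J x) [X, Y, Z]
      - wedge 1 2 (J_act K x (nu_form G I J x)) (fundamental_form G K x) [X, Y, Z]"
    unfolding torsion_tensor_eq HI.compatible_torsion[OF x c(1)] canonical_codifferential[OF x] HI.J_wedge_def by simp
qed

lemma canonical_eq_iff:
  assumes x: "x \<in> S"
    and N: "totally_skew (nijenhuis_tensor G J x)" "totally_skew (nijenhuis_tensor G K x)"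
    and \<nu>: "\<And>v. nu_form G I J x [v] = lee_form G J x [v] - lee_form G K x [v]"
      "\<And>v. nu_form G J K x [v] = lee_form G K x [v] - lee_form G I x [v]"
      "\<And>v. nu_form G K I x [v] = lee_form G I x [v] - lee_form G J x [v]"
  shows "HJ.canonical x X Y Z = HK.canonical x X Y Z \<longleftrightarrow>
    codifferential 4 G (Phi_form G J) x [X, Y, Z] - codifferential 4 G (Phi_form G K) x [X, Y, Z] =
      wedge 1 2 (J_act I x (nu_form G I J x)) (fundamental_form G I x) [X, Y, Z]
      + wedge 1 2 (J_act J x (lee_form G I x)) (fundamental_form G J x) [X, Y, Z]
      - wedge 1 2 (J_act K x (lee_form G I x)) (fundamental_form G K x) [X, Y, Z]"
  using canonical_difference[OF assms, of X Y Z] unfolding HI.J_wedge_def HJ.J_wedge_def HK.J_wedge_def by auto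

lemma compatible_condition:
  assumes x: "x \<in> S"
    and c: "HI.compatible \<Gamma> x" "HJ.compatible \<Gamma> x" "HK.compatible \<Gamma> x"
  shows "codifferential 4 G (Phi_form G J) x [X, Y, Z] - codifferential 4 G (Phi_form G K) x [X, Y, Z] =
      wedge 1 2 (J_act I x (nu_form G I J x)) (fundamental_form G I x) [X, Y, Z]
      + wedge 1 2 (J_act J x (lee_form G I x)) (fundamental_form G J x) [X, Y, Z]
      - wedge 1 2 (J_act K x (lee_form G I x)) (fundamental_form G K x) [X, Y, Z]"
proof -
  note QJ = cyclic
  note QK = quat_chart.cyclic[OF QJ]
  have "HJ.canonical x X Y Z = HK.canonical x X Y Z"
    using HJ.compatible_torsion[OF x c(2)] HK.compatible_torsion[OF x c(3)] by simp
  then show ?thesis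
    using canonical_eq_iff[OF x HJ.compatible_nijenhuis_skew[OF x c(2)] HK.compatible_nijenhuis_skew[OF x c(3)]
        nu_lee[OF x c] quat_chart.nu_lee[OF QJ x c(2,3,1)] quat_chart.nu_lee[OF QK x c(3,1,2)]] by blast
qed

lemma interior_wedge:
  assumes x: "x \<in> S"
  shows "- interior_mult (G x) (lee_form G I x) (\<lambda>vs. Phi_form G J x vs - Phi_form G K x vs) [X, Y, Z] =
      wedge 1 2 (J_act J x (lee_form G I x)) (fundamental_form G J x) [X, Y, Z]
      - wedge 1 2 (J_act K x (lee_form G I x)) (fundamental_form G K x) [X, Y, Z]"
  using interior_formula[OF x HI.lee_form_linear[OF x], of X Y Z] by (simp add: HJ.J_wedge_def HK.J_wedge_def)

text \<open>The Koszul part depends on the metric alone, so with equal torsions the formula for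
  \<open>conn\<close> is at the same time the canonical connection of \<open>J\<close> and of
  \<open>K\<close>.\<close>

lemma conn_compatible:
  assumes x: "x \<in> S"
    and N: "totally_skew (nijenhuis_tensor G I x)" "totally_skew (nijenhuis_tensor G J x)"
      "totally_skew (nijenhuis_tensor G K x)"
    and eq: "\<And>X Y Z. HJ.canonical x X Y Z = HI.canonical x X Y Z" "\<And>X Y Z. HK.canonical x X Y Z = HI.canonical x X Y Z"
  shows "HI.compatible (conn x) x" "HJ.compatible (conn x) x" "HK.compatible (conn x) x"
  by (rule HI.canonical_compatible[OF x N(1)] HJ.canonical_compatible[OF x N(2)] HK.canonical_compatible[OF x N(3)],
      simp add: G_conn[OF x] eq)+

end

section \<open>From charts to the manifold\<close>

lemma ball_tripleI: "(\<And>a b c. (a, b, c) \<in> T \<Longrightarrow> P a b c) \<Longrightarrow> \<forall>(a, b, c)\<in>T. P a b c"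
  by auto

lemma ball_tripleD: "\<forall>(a, b, c)\<in>T. P a b c \<Longrightarrow> (a, b, c) \<in> T \<Longrightarrow> P a b c"
  by auto

lemma almost_hyperhermitian_chart:
  assumes ah: "almost_hyperhermitian A g J" and \<kappa>: "\<kappa> \<in> A"
  shows "quat_chart (chart_range \<kappa>) (g \<kappa>) (J 1 \<kappa>) (J 2 \<kappa>) (J 3 \<kappa>)"
proof -
  have m: "metric_chart (chart_range \<kappa>) (g \<kappa>)"
    using ah \<kappa> unfolding almost_hyperhermitian_def riemannian_metric_def smooth_atlas_def
    by (auto intro!: metric_chart.intro inner_product.intro)
  have h: "hermitian_chart (chart_range \<kappa>) (g \<kappa>) (J a \<kappa>)" if "a \<in> {1, 2, 3}" for a
    using ah \<kappa> that unfolding almost_hyperhermitian_def endomorphism_field_def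
    by (intro hermitian_chart.intro m hermitian_chart_axioms.intro) blast+
  show ?thesis
  proof (intro quat_chart.intro m quat_chart_axioms.intro h)
    fix x u assume "x \<in> chart_range \<kappa>"
    then have "J 1 \<kappa> x (J 2 \<kappa> x u) = J 3 \<kappa> x u \<and> - J 2 \<kappa> x (J 1 \<kappa> x u) = J 3 \<kappa> x u"
      using ah \<kappa> unfolding almost_hyperhermitian_def by blast
    then show "J 1 \<kappa> x (J 2 \<kappa> x u) = J 3 \<kappa> x u" "J 2 \<kappa> x (J 1 \<kappa> x u) = - J 3 \<kappa> x u"
      using minus_equation_iff[of "J 2 \<kappa> x (J 1 \<kappa> x u)" "J 3 \<kappa> x u"] by simp_all
  qed simp_all
qed

lemma almost_hyperhermitian_cyclic:
  assumes ah: "almost_hyperhermitian A g J" and \<kappa>: "\<kappa> \<in> A" and abc: "(a, b, c) \<in> cyclic_triples"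
  shows "quat_chart (chart_range \<kappa>) (g \<kappa>) (J a \<kappa>) (J b \<kappa>) (J c \<kappa>)"
proof -
  note 1 = almost_hyperhermitian_chart[OF ah \<kappa>]
  note 2 = quat_chart.cyclic[OF 1]
  note 3 = quat_chart.cyclic[OF 2]
  show ?thesis using abc 1 2 3 by (auto simp: cyclic_triples_def)
qed

lemma almost_hyperhermitian_hermitian:
  fixes A :: "('m::{t2_space, second_countable_topology}, real^8) chart set"
  assumes "almost_hyperhermitian A g J" "\<kappa> \<in> A" "a \<in> {1, 2, 3}"
  shows "hermitian_chart (chart_range \<kappa>) (g \<kappa>) (J a \<kappa>)"
  using quat_chart.herm[OF almost_hyperhermitian_chart[OF assms(1,2)]] assms(3) by auto

lemma transition_overlap:
  assumes A: "smooth_atlas A" and \<kappa>: "\<kappa> \<in> A" and \<mu>: "\<mu> \<in> A"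
  shows "open (chart_overlap \<kappa> \<mu>)" "chart_overlap \<kappa> \<mu> \<subseteq> chart_range \<kappa>"
    "smooth_on (chart_overlap \<kappa> \<mu>) (transition \<kappa> \<mu>)"
    "x \<in> chart_overlap \<kappa> \<mu> \<Longrightarrow> transition \<kappa> \<mu> x \<in> chart_range \<mu>"
proof -
  have o: "open (fst \<kappa>)" "open (fst \<mu>)" "open (chart_range \<kappa>)"
    and h: "homeomorphism (fst \<kappa>) (chart_range \<kappa>) (snd \<kappa>) (inv_into (fst \<kappa>) (snd \<kappa>))"
    using A \<kappa> \<mu> by (auto simp: smooth_atlas_def)
  have "openin (top_of_set (fst \<kappa>)) (fst \<kappa> \<inter> fst \<mu>)" using o by (auto simp: openin_open)
  from homeomorphism_imp_open_map[OF h this] show "open (chart_overlap \<kappa> \<mu>)"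
    using o(3) unfolding chart_overlap_def by (simp add: openin_open_eq)
  show "chart_overlap \<kappa> \<mu> \<subseteq> chart_range \<kappa>" by (auto simp: chart_overlap_def chart_range_def)
  show "smooth_on (chart_overlap \<kappa> \<mu>) (transition \<kappa> \<mu>)" using A \<kappa> \<mu> by (simp add: smooth_atlas_def)
  show "transition \<kappa> \<mu> x \<in> chart_range \<mu>" if x: "x \<in> chart_overlap \<kappa> \<mu>"
  proof -
    obtain p where p: "p \<in> fst \<kappa>" "p \<in> fst \<mu>" "x = snd \<kappa> p" using x by (auto simp: chart_overlap_def)
    then have "inv_into (fst \<kappa>) (snd \<kappa>) x = p" using h by (simp add: homeomorphism_def)
    then show ?thesis using p by (simp add: transition_def chart_range_def)
  qed
qed

lemma ahkt_connection_compatible: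
  fixes A :: "('m::{t2_space, second_countable_topology}, real^8) chart set"
  assumes ah: "almost_hyperhermitian A g J" and \<Gamma>: "ahkt_connection A g J \<Gamma>"
    and \<kappa>: "\<kappa> \<in> A" and a: "a \<in> {1, 2, 3}" and x: "x \<in> chart_range \<kappa>"
  shows "hermitian_chart.compatible (g \<kappa>) (J a \<kappa>) (\<Gamma> \<kappa> x) x"
  by (rule hermitian_chart.compatible_of_fields[OF almost_hyperhermitian_hermitian[OF ah \<kappa> a] x])
    (use \<Gamma> \<kappa> a x in \<open>auto simp: ahkt_connection_def\<close>)

text \<open>The chartwise symbols fit together by uniqueness: the transformation law follows from
  \<open>compatible_transform\<close> for \<open>J 1\<close>, since one almost Hermitian structure
  already determines the connection.\<close>

lemma compatible_ahkt_connection: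
  fixes A :: "('m::{t2_space, second_countable_topology}, real^8) chart set"
  assumes ah: "almost_hyperhermitian A g J"
    and \<Gamma>: "\<And>\<kappa> u v. \<kappa> \<in> A \<Longrightarrow> smooth_on (chart_range \<kappa>) (\<lambda>x. \<Gamma> \<kappa> x u v)"
      "\<And>\<kappa> x. \<kappa> \<in> A \<Longrightarrow> x \<in> chart_range \<kappa> \<Longrightarrow> bilinear (\<Gamma> \<kappa> x)"
    and comp: "\<And>\<kappa> x a. \<kappa> \<in> A \<Longrightarrow> a \<in> {1, 2, 3} \<Longrightarrow> x \<in> chart_range \<kappa> \<Longrightarrow>
      hermitian_chart.compatible (g \<kappa>) (J a \<kappa>) (\<Gamma> \<kappa> x) x"
  shows "ahkt_connection A g J \<Gamma>"
proof -
  have at: "smooth_atlas A" using ah by (simp add: almost_hyperhermitian_def)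
  note H = almost_hyperhermitian_hermitian[OF ah]
  have gt: "\<forall>\<kappa>\<in>A. \<forall>\<mu>\<in>A. \<forall>x\<in>chart_overlap \<kappa> \<mu>. \<forall>u v.
        g \<kappa> x u v = g \<mu> (transition \<kappa> \<mu> x) (dtransition \<kappa> \<mu> x u) (dtransition \<kappa> \<mu> x v)"
    using ah unfolding almost_hyperhermitian_def riemannian_metric_def by (elim conjE) assumption
  have "endomorphism_field A (J 1)" using ah by (simp add: almost_hyperhermitian_def)
  then have Jt: "\<forall>\<kappa>\<in>A. \<forall>\<mu>\<in>A. \<forall>x\<in>chart_overlap \<kappa> \<mu>. \<forall>u.
        dtransition \<kappa> \<mu> x (J 1 \<kappa> x u) = J 1 \<mu> (transition \<kappa> \<mu> x) (dtransition \<kappa> \<mu> x u)"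
    unfolding endomorphism_field_def by (elim conjE) assumption
  have "dtransition \<kappa> \<mu> x (\<Gamma> \<kappa> x u v) = frechet_derivative (\<lambda>y. dtransition \<kappa> \<mu> y v) (at x) u +
      \<Gamma> \<mu> (transition \<kappa> \<mu> x) (dtransition \<kappa> \<mu> x u) (dtransition \<kappa> \<mu> x v)"
    if \<kappa>: "\<kappa> \<in> A" and \<mu>: "\<mu> \<in> A" and x: "x \<in> chart_overlap \<kappa> \<mu>" for \<kappa> \<mu> x u v
  proof -
    note ov = transition_overlap[OF at \<kappa> \<mu>]
    have xr: "x \<in> chart_range \<kappa>" "transition \<kappa> \<mu> x \<in> chart_range \<mu>" using ov x by auto
    show ?thesis
    proof (rule hermitian_chart.compatible_transform[OF H[OF \<kappa>, of 1] H[OF \<mu>, of 1] ov(1) x ov(2,3)])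
      show "g \<kappa> y u v = g \<mu> (transition \<kappa> \<mu> y) (dtransition \<kappa> \<mu> y u) (dtransition \<kappa> \<mu> y v)"
        if "y \<in> chart_overlap \<kappa> \<mu>" for y u v
        by (rule gt[rule_format, OF \<kappa> \<mu> that])
      show "dtransition \<kappa> \<mu> y (J 1 \<kappa> y u) = J 1 \<mu> (transition \<kappa> \<mu> y) (dtransition \<kappa> \<mu> y u)"
        if "y \<in> chart_overlap \<kappa> \<mu>" for y u
        by (rule Jt[rule_format, OF \<kappa> \<mu> that])
    qed (use \<Gamma> comp \<kappa> \<mu> xr ov(4) in auto)
  qed
  then have "linear_connection A \<Gamma>" using \<Gamma> by (simp add: linear_connection_def)
  moreover have "frechet_derivative (\<lambda>y. g \<kappa> y (Y y) (Z y)) (at x) (X x) =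
      g \<kappa> x (nabla (\<Gamma> \<kappa>) X Y x) (Z x) + g \<kappa> x (Y x) (nabla (\<Gamma> \<kappa>) X Z x)"
    if "\<kappa> \<in> A" "x \<in> chart_range \<kappa>" "smooth_on (chart_range \<kappa>) Y" "smooth_on (chart_range \<kappa>) Z" for \<kappa> x X Y Z
    by (rule hermitian_chart.compatible_fields(1)[where \<Gamma> = "\<Gamma> \<kappa>", OF H[of \<kappa> 1] that(2) comp[of \<kappa> 1 x] that(3,4)])
      (use that in simp_all)
  moreover have "nabla (\<Gamma> \<kappa>) X (\<lambda>y. J a \<kappa> y (Y y)) x = J a \<kappa> x (nabla (\<Gamma> \<kappa>) X Y x)"
    if "a \<in> {1, 2, 3}" "\<kappa> \<in> A" "x \<in> chart_range \<kappa>" "smooth_on (chart_range \<kappa>) Y" for a \<kappa> x X Y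
    by (rule hermitian_chart.compatible_fields(2)[where \<Gamma> = "\<Gamma> \<kappa>", OF H[OF that(2,1)] that(3) comp[OF that(2,1,3)] that(4,4)])
  moreover have "totally_skew (torsion_tensor (g \<kappa>) (\<Gamma> \<kappa>) x)" if "\<kappa> \<in> A" "x \<in> chart_range \<kappa>" for \<kappa> x
  proof -
    interpret hermitian_chart "chart_range \<kappa>" "g \<kappa>" "J 1 \<kappa>" by (rule H) (use that in simp_all)
    show ?thesis
      unfolding totally_skew_skew3 torsion_tensor_eq
      using compatibleD(4)[OF comp[of \<kappa> 1 x]] that by simp
  qed
  ultimately show ?thesis unfolding ahkt_connection_def by blast
qed

theorem theorem9p2:
  fixes A :: "('m::{t2_space, second_countable_topology}, real^8) chart set"
    and g :: "('m, real^8) chart \<Rightarrow> (real^8) metric"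
    and J :: "nat \<Rightarrow> ('m, real^8) chart \<Rightarrow> (real^8) endo"
  assumes "almost_hyperhermitian A g J"
  shows
    "(ahkt A g J \<longleftrightarrow>
       (\<forall>a\<in>{1,2,3}. \<forall>\<kappa>\<in>A. \<forall>x\<in>chart_range \<kappa>.
          totally_skew (nijenhuis_tensor (g \<kappa>) (J a \<kappa>) x)) \<and>
       (\<forall>(a, b, c)\<in>cyclic_triples. \<forall>\<kappa>\<in>A. \<forall>x\<in>chart_range \<kappa>.
          let F = (\<lambda>i. fundamental_form (g \<kappa>) (J i \<kappa>) x);
              \<Phi> = (\<lambda>i. Phi_form (g \<kappa>) (J i \<kappa>) x);
              \<delta>\<Phi> = (\<lambda>i. codifferential 4 (g \<kappa>) (Phi_form (g \<kappa>) (J i \<kappa>)) x);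
              \<theta> = (\<lambda>i. lee_form (g \<kappa>) (J i \<kappa>) x);
              \<nu> = nu_form (g \<kappa>) (J a \<kappa>) (J b \<kappa>) x
          in (\<forall>X Y Z.
                \<delta>\<Phi> b [X, Y, Z] - \<delta>\<Phi> c [X, Y, Z] =
                  wedge 1 2 (J_act (J a \<kappa>) x \<nu>) (F a) [X, Y, Z]
                  - interior_mult (g \<kappa> x) (\<theta> a) (\<lambda>vs. \<Phi> b vs - \<Phi> c vs) [X, Y, Z] \<and>
                \<delta>\<Phi> b [X, Y, Z] - \<delta>\<Phi> c [X, Y, Z] =
                  wedge 1 2 (J_act (J a \<kappa>) x \<nu>) (F a) [X, Y, Z]
                  + wedge 1 2 (J_act (J b \<kappa>) x (\<theta> a)) (F b) [X, Y, Z]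
                  - wedge 1 2 (J_act (J c \<kappa>) x (\<theta> a)) (F c) [X, Y, Z]) \<and>
             (\<forall>X. \<nu> [X] = \<theta> b [X] - \<theta> c [X])))
     \<and>
     (\<forall>\<Gamma>. ahkt_connection A g J \<Gamma> \<longrightarrow>
       (\<forall>(a, b, c)\<in>cyclic_triples. \<forall>\<kappa>\<in>A. \<forall>x\<in>chart_range \<kappa>.
          let F = (\<lambda>i. fundamental_form (g \<kappa>) (J i \<kappa>) x);
              \<delta>\<Phi> = (\<lambda>i. codifferential 4 (g \<kappa>) (Phi_form (g \<kappa>) (J i \<kappa>)) x);
              \<theta> = (\<lambda>i. lee_form (g \<kappa>) (J i \<kappa>) x);
              \<nu> = nu_form (g \<kappa>) (J a \<kappa>) (J b \<kappa>) x
          in \<forall>X Y Z.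
               nijenhuis_tensor (g \<kappa>) (J a \<kappa>) x [X, Y, Z] =
                 wedge 1 2 (J_act (J b \<kappa>) x \<nu>) (F b) [X, Y, Z]
                 - wedge 1 2 (J_act (J c \<kappa>) x \<nu>) (F c) [X, Y, Z] \<and>
               torsion_tensor (g \<kappa>) (\<Gamma> \<kappa>) x [X, Y, Z] =
                 - \<delta>\<Phi> a [X, Y, Z]
                 + wedge 1 2 (J_act (J a \<kappa>) x (\<theta> a)) (F a) [X, Y, Z]
                 + wedge 1 2 (J_act (J b \<kappa>) x \<nu>) (F b) [X, Y, Z]
                 - wedge 1 2 (J_act (J c \<kappa>) x \<nu>) (F c) [X, Y, Z]))"
proof -
  note Q = almost_hyperhermitian_cyclic[OF assms]
  have comp: "hermitian_chart.compatible (g \<kappa>) (J a \<kappa>) (\<Gamma> \<kappa> x) x"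
    "hermitian_chart.compatible (g \<kappa>) (J b \<kappa>) (\<Gamma> \<kappa> x) x"
    "hermitian_chart.compatible (g \<kappa>) (J c \<kappa>) (\<Gamma> \<kappa> x) x"
    if "ahkt_connection A g J \<Gamma>" "\<kappa> \<in> A" "(a, b, c) \<in> cyclic_triples" "x \<in> chart_range \<kappa>" for \<Gamma> \<kappa> a b c x
    using ahkt_connection_compatible[OF assms that(1,2) _ that(4)] that(3) by (auto simp: cyclic_triples_def)
  have skew_of_ahkt: "\<forall>a\<in>{1,2,3}. \<forall>\<kappa>\<in>A. \<forall>x\<in>chart_range \<kappa>. totally_skew (nijenhuis_tensor (g \<kappa>) (J a \<kappa>) x)"
    if "ahkt_connection A g J \<Gamma>" for \<Gamma>
    using hermitian_chart.compatible_nijenhuis_skew[OF almost_hyperhermitian_hermitian[OF assms]]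
      ahkt_connection_compatible[OF assms that] by blast
  have ahkt_of_condition: "ahkt A g J"
    if N: "\<And>a \<kappa> x. a \<in> {1,2,3} \<Longrightarrow> \<kappa> \<in> A \<Longrightarrow> x \<in> chart_range \<kappa> \<Longrightarrow> totally_skew (nijenhuis_tensor (g \<kappa>) (J a \<kappa>) x)"
      and \<Phi>: "\<And>a b c \<kappa> x X Y Z. (a, b, c) \<in> cyclic_triples \<Longrightarrow> \<kappa> \<in> A \<Longrightarrow> x \<in> chart_range \<kappa> \<Longrightarrow>
        codifferential 4 (g \<kappa>) (Phi_form (g \<kappa>) (J b \<kappa>)) x [X, Y, Z] - codifferential 4 (g \<kappa>) (Phi_form (g \<kappa>) (J c \<kappa>)) x [X, Y, Z] =
          wedge 1 2 (J_act (J a \<kappa>) x (nu_form (g \<kappa>) (J a \<kappa>) (J b \<kappa>) x)) (fundamental_form (g \<kappa>) (J a \<kappa>) x) [X, Y, Z]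
          + wedge 1 2 (J_act (J b \<kappa>) x (lee_form (g \<kappa>) (J a \<kappa>) x)) (fundamental_form (g \<kappa>) (J b \<kappa>) x) [X, Y, Z]
          - wedge 1 2 (J_act (J c \<kappa>) x (lee_form (g \<kappa>) (J a \<kappa>) x)) (fundamental_form (g \<kappa>) (J c \<kappa>) x) [X, Y, Z]"
      and \<nu>: "\<And>a b c \<kappa> x X. (a, b, c) \<in> cyclic_triples \<Longrightarrow> \<kappa> \<in> A \<Longrightarrow> x \<in> chart_range \<kappa> \<Longrightarrow>
        nu_form (g \<kappa>) (J a \<kappa>) (J b \<kappa>) x [X] = lee_form (g \<kappa>) (J b \<kappa>) x [X] - lee_form (g \<kappa>) (J c \<kappa>) x [X]"
  proof -
    \<comment> \<open>The candidate is built from the first almost complex structure in every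
      chart.\<close>
    let ?\<Gamma> = "\<lambda>\<kappa>. quat_chart.conn (g \<kappa>) (J 1 \<kappa>)"
    have t: "(1, 2, 3) \<in> cyclic_triples" "(2, 3, 1) \<in> cyclic_triples" "(3, 1, 2) \<in> cyclic_triples"
      by (simp_all add: cyclic_triples_def)
    have comp: "hermitian_chart.compatible (g \<kappa>) (J a \<kappa>) (?\<Gamma> \<kappa> x) x"
      if \<kappa>: "\<kappa> \<in> A" and a: "a \<in> {1, 2, 3}" and x: "x \<in> chart_range \<kappa>" for \<kappa> a x
    proof -
      let ?can = "\<lambda>a. hermitian_jet.canonical_torsion (g \<kappa> x) (J a \<kappa> x) (metric_chart.dG (g \<kappa>) x)
        (hermitian_chart.dI (J a \<kappa>) x)"
      note N' = N[OF _ \<kappa> x] and q = Q[OF \<kappa> t(1)] Q[OF \<kappa> t(2)]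
        and n = \<nu>[OF t(1) \<kappa> x] \<nu>[OF t(2) \<kappa> x] \<nu>[OF t(3) \<kappa> x]
      \<comment> \<open>The condition for the triple (1,2,3) identifies the second and third
        canonical torsions, the one for (2,3,1) the third and the first.\<close>
      have 23: "?can 2 X Y Z = ?can 3 X Y Z" for X Y Z
        by (rule quat_chart.canonical_eq_iff[OF q(1) x N' N' n, THEN iffD2])
          (simp_all only: \<Phi>[OF t(1) \<kappa> x] insert_iff simp_thms)
      have 31: "?can 3 X Y Z = ?can 1 X Y Z" for X Y Z
        by (rule quat_chart.canonical_eq_iff[OF q(2) x N' N' n(2,3,1), THEN iffD2])
          (simp_all only: \<Phi>[OF t(2) \<kappa> x] insert_iff simp_thms)
      have "totally_skew (nijenhuis_tensor (g \<kappa>) (J 1 \<kappa>) x)" "totally_skew (nijenhuis_tensor (g \<kappa>) (J 2 \<kappa>) x)"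
        "totally_skew (nijenhuis_tensor (g \<kappa>) (J 3 \<kappa>) x)" by (rule N'; simp)+
      from quat_chart.conn_compatible[OF q(1) x this] show ?thesis using 23 31 a by auto
    qed
    have "ahkt_connection A g J ?\<Gamma>"
      by (rule compatible_ahkt_connection[OF assms quat_chart.conn_smooth[OF Q[OF _ t(1)]]
            quat_chart.conn_bilinear[OF Q[OF _ t(1)]] comp])
    then show ?thesis using assms by (auto simp: ahkt_def)
  qed
  show ?thesis
    unfolding Let_def
  \<comment> \<open>Cases 1 and 2 are the skewness and the identities of an AHKT manifold, case 3 is
    the converse, case 4 the formulas for N and T.\<close>
  proof (intro conjI iffI allI impI, goal_cases)
    case 1
    then show ?case by (auto simp: ahkt_def dest: skew_of_ahkt)
  next
    case 2
    then obtain \<Gamma> where \<Gamma>: "ahkt_connection A g J \<Gamma>" by (auto simp: ahkt_def)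
    show ?case
    proof (intro ball_tripleI ballI conjI allI)
      fix a b c \<kappa> x X Y Z assume abc: "(a, b, c) \<in> cyclic_triples" and \<kappa>: "\<kappa> \<in> A" and x: "x \<in> chart_range \<kappa>"
      note c = comp[OF \<Gamma> \<kappa> abc x]
      note q = Q[OF \<kappa> abc]
      note Phi = quat_chart.compatible_condition[OF q x c, of X Y Z]
      show "codifferential 4 (g \<kappa>) (Phi_form (g \<kappa>) (J b \<kappa>)) x [X, Y, Z] - codifferential 4 (g \<kappa>) (Phi_form (g \<kappa>) (J c \<kappa>)) x [X, Y, Z] =
        wedge 1 2 (J_act (J a \<kappa>) x (nu_form (g \<kappa>) (J a \<kappa>) (J b \<kappa>) x)) (fundamental_form (g \<kappa>) (J a \<kappa>) x) [X, Y, Z]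
        + wedge 1 2 (J_act (J b \<kappa>) x (lee_form (g \<kappa>) (J a \<kappa>) x)) (fundamental_form (g \<kappa>) (J b \<kappa>) x) [X, Y, Z]
        - wedge 1 2 (J_act (J c \<kappa>) x (lee_form (g \<kappa>) (J a \<kappa>) x)) (fundamental_form (g \<kappa>) (J c \<kappa>) x) [X, Y, Z]"
        by (rule Phi)
      show "codifferential 4 (g \<kappa>) (Phi_form (g \<kappa>) (J b \<kappa>)) x [X, Y, Z] - codifferential 4 (g \<kappa>) (Phi_form (g \<kappa>) (J c \<kappa>)) x [X, Y, Z] =
        wedge 1 2 (J_act (J a \<kappa>) x (nu_form (g \<kappa>) (J a \<kappa>) (J b \<kappa>) x)) (fundamental_form (g \<kappa>) (J a \<kappa>) x) [X, Y, Z]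
        - interior_mult (g \<kappa> x) (lee_form (g \<kappa>) (J a \<kappa>) x) (\<lambda>vs. Phi_form (g \<kappa>) (J b \<kappa>) x vs - Phi_form (g \<kappa>) (J c \<kappa>) x vs) [X, Y, Z]"
        using Phi quat_chart.interior_wedge[OF q x, of X Y Z] by linarith
      show "nu_form (g \<kappa>) (J a \<kappa>) (J b \<kappa>) x [X] = lee_form (g \<kappa>) (J b \<kappa>) x [X] - lee_form (g \<kappa>) (J c \<kappa>) x [X]"
        by (rule quat_chart.nu_lee[OF q x c])
    qed
  next
    case 3
    note N = 3[THEN conjunct1] and C = 3[THEN conjunct2, THEN ball_tripleD, THEN bspec, THEN bspec]
    show ?case
      by (rule ahkt_of_condition) (use N in blast, use C in blast, use C in blast)
  next
    case \<Gamma>: (4 \<Gamma>)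
    show ?case
    proof (intro ball_tripleI ballI conjI allI)
      fix a b c \<kappa> x X Y Z assume abc: "(a, b, c) \<in> cyclic_triples" and \<kappa>: "\<kappa> \<in> A" and x: "x \<in> chart_range \<kappa>"
      note f = quat_chart.compatible_formulas[where \<Gamma> = "\<Gamma> \<kappa>", OF Q[OF \<kappa> abc] x comp[OF \<Gamma> \<kappa> abc x], of X Y Z]
      show "nijenhuis_tensor (g \<kappa>) (J a \<kappa>) x [X, Y, Z] =
          wedge 1 2 (J_act (J b \<kappa>) x (nu_form (g \<kappa>) (J a \<kappa>) (J b \<kappa>) x)) (fundamental_form (g \<kappa>) (J b \<kappa>) x) [X, Y, Z]
          - wedge 1 2 (J_act (J c \<kappa>) x (nu_form (g \<kappa>) (J a \<kappa>) (J b \<kappa>) x)) (fundamental_form (g \<kappa>) (J c \<kappa>) x) [X, Y, Z]"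
        by (rule f(1))
      show "torsion_tensor (g \<kappa>) (\<Gamma> \<kappa>) x [X, Y, Z] = - codifferential 4 (g \<kappa>) (Phi_form (g \<kappa>) (J a \<kappa>)) x [X, Y, Z]
          + wedge 1 2 (J_act (J a \<kappa>) x (lee_form (g \<kappa>) (J a \<kappa>) x)) (fundamental_form (g \<kappa>) (J a \<kappa>) x) [X, Y, Z]
          + wedge 1 2 (J_act (J b \<kappa>) x (nu_form (g \<kappa>) (J a \<kappa>) (J b \<kappa>) x)) (fundamental_form (g \<kappa>) (J b \<kappa>) x) [X, Y, Z]
          - wedge 1 2 (J_act (J c \<kappa>) x (nu_form (g \<kappa>) (J a \<kappa>) (J b \<kappa>) x)) (fundamental_form (g \<kappa>) (J c \<kappa>) x) [X, Y, Z]"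
        by (rule f(2))
    qed
  qed
qed

end
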